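(* Let $\mu$ be a finite measure and $p\in(1,\infty)\setminus\{2\}$. Suppose that $(\mathbf{x}_j)_{j\in J}$ is a semi-normalized unconditional basis of a non-Hilbertian Banach space $\mathbb{X}\subseteq L_p(\mu)$ (a closed subspace, with the norm of $L_p(\mu)$), and suppose that $\mathbb{X}$ is complemented in $L_p(\mu)$. Then: (i) $\limsup_{j\in J}\|\mathbf{x}_j\|_q=\infty$ for any $q$ with $p<q$; and (ii) $\liminf_{j\in J}\|\mathbf{x}_j\|_q=0$ whenever $\max\{q,2\}<p$.
   Context: A basis of an infinite-dimensional (real or complex) separable Banach space $\mathbb{X}$ is a family $(\mathbf{x}_j)_{j\in J}$ with closed linear span $\mathbb{X}$ for which there are functionals $\mathbf{x}_j^*\in\mathbb{X}^*$ with $\mathbf{x}_j^*(\mathbf{x}_k)=\delta_{jk}$. It is semi-normalized if $0<\inf_j\|\mathbf{x}_j\|\le\sup_j\|\mathbf{x}_j\|<\infty$ (norm of $\mathbb{X}$, i.e. of $L_p(\mu)$). It is unconditional if $\sum_{n=1}^\infty\mathbf{x}_{\pi(n)}^*(f)\mathbf{x}_{\pi(n)}$ converges to $f$ for every $f\in\mathbb{X}$ and every bijection $\pi\colon\mathbb{N}\to J$; equivalently, the multipliers $f\mapsto\sum_j\varepsilon_j\mathbf{x}_j^*(f)\mathbf{x}_j$, $(\varepsilon_j)\in\{-1,1\}^J$, are well defined and uniformly bounded. Non-Hilbertian means not isomorphic to a Hilbert space; complemented means being the range of a bounded linear projection on $L_p(\mu)$. $\|f\|_q=(\int|f|^q\,d\mu)^{1/q}\in[0,\infty]$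 for $0<q<\infty$, and $\|f\|_\infty$ is the essential supremum of $|f|$; the index $q$ ranges over $(0,\infty]$. For a family $(a_j)_{j\in J}$ in $[0,\infty]$ indexed by an infinite countable set, $\limsup_{j\in J}a_j=\inf_{F}\sup_{j\in J\setminus F}a_j$ and $\liminf_{j\in J}a_j=\sup_F\inf_{j\in J\setminus F}a_j$, where $F$ runs over the finite subsets of $J$. *)

theory Defs
  imports "HOL-Probability.Probability" "HOL-Library.Function_Algebras"
begin

text \<open>
  \<open>L\<^sub>p(M)\<close> is handled through representatives: its elements are Borel measurable functions with
  finite \<open>p\<close>-norm, and functions that agree almost everywhere stand for the same element.
  Spanning and linearity of functions refer to the pointwise operations.  The scalar field
  \<open>'k\<close> is meant to be \<open>real\<close> or \<open>complex\<close>.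
\<close>

definition fscale :: "'k::field \<Rightarrow> ('a \<Rightarrow> 'k) \<Rightarrow> 'a \<Rightarrow> 'k"  (infixr "*\<^sub>F" 75)
  where "c *\<^sub>F f = (\<lambda>t. c * f t)"

global_interpretation pw: vector_space "fscale :: 'k::field \<Rightarrow> ('a \<Rightarrow> 'k) \<Rightarrow> 'a \<Rightarrow> 'k"
  by unfold_locales (auto simp: fscale_def fun_eq_iff algebra_simps)


subsection \<open>The spaces \<open>L\<^sub>p\<close>\<close>

definition Lnorm :: "'a measure \<Rightarrow> ennreal \<Rightarrow> ('a \<Rightarrow> 'k::real_normed_field) \<Rightarrow> ennreal" where
  "Lnorm M q f =
     (if q = \<infinity> then esssup M (\<lambda>t. ennreal (norm (f t)))
      else let I = (\<integral>\<^sup>+ t. ennreal (norm (f t) powr enn2real q) \<partial>M)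
           in if I = \<infinity> then \<infinity> else ennreal (enn2real I powr (1 / enn2real q)))"

definition Lp :: "'a measure \<Rightarrow> real \<Rightarrow> ('a \<Rightarrow> 'k::real_normed_field) set" where
  "Lp M p = {f \<in> borel_measurable M. Lnorm M (ennreal p) f < \<infinity>}"

definition Lp_closure ::
    "'a measure \<Rightarrow> real \<Rightarrow> ('a \<Rightarrow> 'k::real_normed_field) set \<Rightarrow> ('a \<Rightarrow> 'k) set" where
  "Lp_closure M p S = {f \<in> Lp M p. \<forall>e>0. \<exists>g\<in>S. Lnorm M (ennreal p) (f - g) < e}"

text \<open>A set that equals its closure is saturated under almost everywhere equality, so it
  determines, and is determined by, a set of elements of \<open>L\<^sub>p(M)\<close>.\<close>

definition closed_subspace ::
    "'a measure \<Rightarrow> real \<Rightarrow> ('a \<Rightarrow> 'k::real_normed_field) set \<Rightarrow> bool" where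
  "closed_subspace M p X \<longleftrightarrow> X \<subseteq> Lp M p \<and> pw.subspace X \<and> Lp_closure M p X = X"

definition separable_in ::
    "'a measure \<Rightarrow> real \<Rightarrow> ('a \<Rightarrow> 'k::real_normed_field) set \<Rightarrow> bool" where
  "separable_in M p X \<longleftrightarrow> (\<exists>D\<subseteq>X. countable D \<and> X \<subseteq> Lp_closure M p D)"

text \<open>The dimension is that of the quotient by almost everywhere equality.\<close>

definition infinite_dimensional ::
    "'a measure \<Rightarrow> ('a \<Rightarrow> 'k::real_normed_field) set \<Rightarrow> bool" where
  "infinite_dimensional M X \<longleftrightarrow>
     \<not> (\<exists>B\<subseteq>X. finite B \<and> (\<forall>f\<in>X. \<exists>g\<in>pw.span B. AE t in M. f t = g t))"


subsection \<open>Operators and functionals\<close>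

text \<open>The boundedness condition makes such maps compatible with almost everywhere equality.\<close>

definition bounded_functional ::
    "'a measure \<Rightarrow> real \<Rightarrow> ('a \<Rightarrow> 'k::real_normed_field) set \<Rightarrow> (('a \<Rightarrow> 'k) \<Rightarrow> 'k) \<Rightarrow> bool" where
  "bounded_functional M p X \<phi> \<longleftrightarrow>
     (\<forall>f\<in>X. \<forall>g\<in>X. \<phi> (f + g) = \<phi> f + \<phi> g) \<and>
     (\<forall>c. \<forall>f\<in>X. \<phi> (c *\<^sub>F f) = c * \<phi> f) \<and>
     (\<exists>C. \<forall>f\<in>X. ennreal (norm (\<phi> f)) \<le> ennreal C * Lnorm M (ennreal p) f)"

definition bounded_operator ::
    "'a measure \<Rightarrow> real \<Rightarrow> (('a \<Rightarrow> 'k::real_normed_field) \<Rightarrow> 'a \<Rightarrow> 'k) \<Rightarrow> bool" where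
  "bounded_operator M p P \<longleftrightarrow>
     (\<forall>f\<in>Lp M p. P f \<in> Lp M p) \<and>
     (\<forall>f\<in>Lp M p. \<forall>g\<in>Lp M p. AE t in M. P (f + g) t = P f t + P g t) \<and>
     (\<forall>c. \<forall>f\<in>Lp M p. AE t in M. P (c *\<^sub>F f) t = c * P f t) \<and>
     (\<exists>C. \<forall>f\<in>Lp M p. Lnorm M (ennreal p) (P f) \<le> ennreal C * Lnorm M (ennreal p) f)"

definition complemented ::
    "'a measure \<Rightarrow> real \<Rightarrow> ('a \<Rightarrow> 'k::real_normed_field) set \<Rightarrow> bool" where
  "complemented M p X \<longleftrightarrow>
     (\<exists>P. bounded_operator M p P \<and>
          (\<forall>f\<in>Lp M p. AE t in M. P (P f) t = P f t) \<and>
          X = {g \<in> Lp M p. \<exists>f\<in>Lp M p. AE t in M. g t = P f t})"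


subsection \<open>Hilbert spaces\<close>

text \<open>
  \<open>cj\<close> is the conjugation of the scalar field: the identity for \<open>real\<close>, \<open>cnj\<close> for \<open>complex\<close>.
  A Hilbert space is a vector space \<open>H\<close> of functions \<open>'b \<Rightarrow> 'k\<close> (genuine functions: no measure and
  no identification is involved) with an arbitrary inner product \<open>ip\<close> on it.
\<close>

definition inner_product_on ::
    "('k \<Rightarrow> 'k) \<Rightarrow> ('b \<Rightarrow> 'k::real_normed_field) set \<Rightarrow> (('b \<Rightarrow> 'k) \<Rightarrow> ('b \<Rightarrow> 'k) \<Rightarrow> 'k) \<Rightarrow> bool" where
  "inner_product_on cj H ip \<longleftrightarrow>
     (\<forall>u\<in>H. \<forall>v\<in>H. \<forall>w\<in>H. ip (u + v) w = ip u w + ip v w) \<and>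
     (\<forall>c. \<forall>u\<in>H. \<forall>v\<in>H. ip (c *\<^sub>F u) v = c * ip u v) \<and>
     (\<forall>u\<in>H. \<forall>v\<in>H. ip v u = cj (ip u v)) \<and>
     (\<forall>u\<in>H. u \<noteq> 0 \<longrightarrow> (\<exists>r>0. ip u u = of_real r))"

definition ip_norm :: "('v \<Rightarrow> 'v \<Rightarrow> 'k::real_normed_field) \<Rightarrow> 'v \<Rightarrow> real" where
  "ip_norm ip u = sqrt (norm (ip u u))"

definition hilbert_space ::
    "('k \<Rightarrow> 'k) \<Rightarrow> ('b \<Rightarrow> 'k::real_normed_field) set \<Rightarrow> (('b \<Rightarrow> 'k) \<Rightarrow> ('b \<Rightarrow> 'k) \<Rightarrow> 'k) \<Rightarrow> bool" where
  "hilbert_space cj H ip \<longleftrightarrow>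
     pw.subspace H \<and> inner_product_on cj H ip \<and>
     Metric_space.mcomplete H (\<lambda>u v. ip_norm ip (u - v))"

text \<open>
  \<open>X\<close> is isomorphic to a Hilbert space \<open>(H, ip)\<close> via \<open>T\<close>; the two norm estimates say that \<open>T\<close> and
  its inverse are bounded, and that \<open>T\<close> identifies exactly the functions that agree almost
  everywhere.  Taking the elements of \<open>H\<close> of the same type as those of \<open>X\<close> is no restriction:
  a Hilbert space isomorphic to \<open>X\<close> can be transported to a linear complement in \<open>X\<close> of the
  subspace of functions vanishing almost everywhere.
\<close>

definition hilbertian ::
    "('k \<Rightarrow> 'k) \<Rightarrow> 'a measure \<Rightarrow> real \<Rightarrow> ('a \<Rightarrow> 'k::real_normed_field) set \<Rightarrow> bool" where
  "hilbertian cj M p X \<longleftrightarrow>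
     (\<exists>(H :: ('a \<Rightarrow> 'k) set) ip T.
        hilbert_space cj H ip \<and>
        (\<forall>f\<in>X. \<forall>g\<in>X. T (f + g) = T f + T g) \<and>
        (\<forall>c. \<forall>f\<in>X. T (c *\<^sub>F f) = c *\<^sub>F T f) \<and>
        T ` X = H \<and>
        (\<exists>C. \<forall>f\<in>X. ennreal (ip_norm ip (T f)) \<le> ennreal C * Lnorm M (ennreal p) f) \<and>
        (\<exists>C. \<forall>f\<in>X. Lnorm M (ennreal p) f \<le> ennreal C * ennreal (ip_norm ip (T f))))"


subsection \<open>Bases\<close>

definition coordinate_functionals ::
    "'a measure \<Rightarrow> real \<Rightarrow> ('a \<Rightarrow> 'k::real_normed_field) set \<Rightarrow> 'i set \<Rightarrow>
     ('i \<Rightarrow> 'a \<Rightarrow> 'k) \<Rightarrow> ('i \<Rightarrow> ('a \<Rightarrow> 'k) \<Rightarrow> 'k) \<Rightarrow> bool" where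
  "coordinate_functionals M p X J x xs \<longleftrightarrow>
     (\<forall>j\<in>J. bounded_functional M p X (xs j)) \<and>
     (\<forall>j\<in>J. \<forall>k\<in>J. xs j (x k) = (if j = k then 1 else 0))"

definition basis ::
    "'a measure \<Rightarrow> real \<Rightarrow> ('a \<Rightarrow> 'k::real_normed_field) set \<Rightarrow> 'i set \<Rightarrow> ('i \<Rightarrow> 'a \<Rightarrow> 'k) \<Rightarrow> bool" where
  "basis M p X J x \<longleftrightarrow>
     infinite_dimensional M X \<and> separable_in M p X \<and>
     (\<forall>j\<in>J. x j \<in> X) \<and> Lp_closure M p (pw.span (x ` J)) = X \<and>
     (\<exists>xs. coordinate_functionals M p X J x xs)"

text \<open>The coordinate functionals are determined on \<open>X\<close> by the basis, so it does not matter
  whether \<open>xs\<close> is quantified existentially or universally.\<close>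

definition unconditional_basis ::
    "'a measure \<Rightarrow> real \<Rightarrow> ('a \<Rightarrow> 'k::real_normed_field) set \<Rightarrow> 'i set \<Rightarrow> ('i \<Rightarrow> 'a \<Rightarrow> 'k) \<Rightarrow> bool" where
  "unconditional_basis M p X J x \<longleftrightarrow>
     basis M p X J x \<and>
     (\<exists>xs. coordinate_functionals M p X J x xs \<and>
        (\<forall>f\<in>X. \<forall>\<pi>. bij_betw \<pi> (UNIV :: nat set) J \<longrightarrow>
           (\<lambda>N. Lnorm M (ennreal p) (f - (\<Sum>n<N. xs (\<pi> n) f *\<^sub>F x (\<pi> n)))) \<longlonglongrightarrow> 0))"

definition semi_normalized ::
    "'a measure \<Rightarrow> real \<Rightarrow> 'i set \<Rightarrow> ('i \<Rightarrow> 'a \<Rightarrow> 'k::real_normed_field) \<Rightarrow> bool" where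
  "semi_normalized M p J x \<longleftrightarrow>
     0 < (INF j\<in>J. Lnorm M (ennreal p) (x j)) \<and> (SUP j\<in>J. Lnorm M (ennreal p) (x j)) < \<infinity>"


subsection \<open>Upper and lower limits of families\<close>

definition limsup_on :: "'i set \<Rightarrow> ('i \<Rightarrow> ennreal) \<Rightarrow> ennreal" where
  "limsup_on J a = (INF F\<in>{F. finite F \<and> F \<subseteq> J}. SUP j\<in>J - F. a j)"

definition liminf_on :: "'i set \<Rightarrow> ('i \<Rightarrow> ennreal) \<Rightarrow> ennreal" where
  "liminf_on J a = (SUP F\<in>{F. finite F \<and> F \<subseteq> J}. INF j\<in>J - F. a j)"

end

theory Submission
  imports Defs
begin

text \<open>
  Throughout, scalars are real or complex, \<open>\<epsilon>\<close> runs through the signs on a finite index set, and \<open>\<bbbE>\<close> is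
  the average over \<open>\<epsilon>\<close>.  If (i) or (ii) fails, then all but finitely many of the \<open>x\<^sub>j\<close> have
  \<open>L\<^sub>q\<close>-norms that are bounded, for some \<open>q > p\<close>, or bounded away from \<open>0\<close>, for some \<open>q < p\<close> in the
  case \<open>p > 2\<close>.  Together with \<open>\<parallel>x\<^sub>j\<parallel>\<^sub>p \<approx> 1\<close> this prevents the \<open>x\<^sub>j\<close> from concentrating on sets of
  small measure, and the claim is that then \<open>\<parallel>\<Sum> a\<^sub>j x\<^sub>j\<parallel>\<^sub>p \<approx> (\<Sum> |a\<^sub>j|\<^sup>2)\<^sup>1\<^sup>/\<^sup>2\<close>.  So the basis is equivalent
  to an orthonormal basis, and the space is Hilbertian (\<open>l2_basis.hilbertian_of_l2_basis\<close>).
  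
  Unconditionality bounds all sign changes by one constant
  (\<open>unconditional_sequence.sign_changes_bounded\<close>), so \<open>\<parallel>\<Sum> a\<^sub>j x\<^sub>j\<parallel>\<^sub>p\<close> may be replaced by averages of
  \<open>\<parallel>\<Sum> \<epsilon>\<^sub>j a\<^sub>j x\<^sub>j\<parallel>\<^sub>p\<close>, to which Khintchine's inequalities apply pointwise.
  
  Let \<open>p > 2\<close>.  The upper estimate is Khintchine's inequality followed by the convexity of
  \<open>u \<mapsto> u\<^sup>p\<^sup>/\<^sup>2\<close>.  For the lower one, \<open>\<parallel>\<cdot>\<parallel>\<^sub>2 \<le> C \<parallel>\<cdot>\<parallel>\<^sub>p\<close> on a finite measure space, and
  \<open>\<bbbE> \<parallel>\<Sum> \<epsilon>\<^sub>j a\<^sub>j x\<^sub>j\<parallel>\<^sub>2\<^sup>2 = \<Sum> |a\<^sub>j|\<^sup>2 \<parallel>x\<^sub>j\<parallel>\<^sub>2\<^sup>2\<close>; here \<open>\<parallel>x\<^sub>j\<parallel>\<^sub>2\<close> is bounded away from \<open>0\<close> because a function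
  that is small in \<open>L\<^sub>2\<close> and bounded in \<open>L\<^sub>s\<close> is small in \<open>L\<^sub>r\<close> for every \<open>r < s\<close>
  (\<open>finite_measure.second_moment_lower_bound\<close>).
  
  Let \<open>p < 2\<close>.  The lower estimate is Khintchine's inequality and the concavity of \<open>u \<mapsto> u\<^sup>p\<^sup>/\<^sup>2\<close>.  The upper one
  uses the projection \<open>P\<close>.  Boundedness in \<open>L\<^sub>q\<close> with \<open>q > p\<close> gives truncations \<open>f\<^sub>j\<close> of the \<open>x\<^sub>j\<close> that
  are bounded by one constant and so close to the \<open>x\<^sub>j\<close> that \<open>\<theta>\<^sub>j = x\<^sub>j\<^sup>*(P f\<^sub>j)\<close> satisfies \<open>|\<theta>\<^sub>j| \<ge> 1/2\<close>.
  With \<open>S\<^sub>\<epsilon>\<close> for the sign change and \<open>e\<^sub>j = a\<^sub>j / \<theta>\<^sub>j\<close>, orthogonality of the signs picks out the diagonal of the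
  matrix \<open>x\<^sub>k\<^sup>*(P f\<^sub>j)\<close>:
  \<open>\<bbbE> S\<^sub>\<epsilon> P (\<Sum> \<epsilon>\<^sub>j e\<^sub>j f\<^sub>j) = \<Sum> e\<^sub>j \<theta>\<^sub>j x\<^sub>j = \<Sum> a\<^sub>j x\<^sub>j\<close>.  Hence \<open>\<parallel>\<Sum> a\<^sub>j x\<^sub>j\<parallel>\<^sub>p\<close> is at most a constant times
  \<open>\<bbbE> \<parallel>\<Sum> \<epsilon>\<^sub>j e\<^sub>j f\<^sub>j\<parallel>\<^sub>p\<close>, and this is controlled in \<open>L\<^sub>2\<close>, where the \<open>f\<^sub>j\<close> are bounded.
\<close>

section \<open>The spaces \<open>L\<^sub>p\<close>\<close>

definition pnorm :: "'a measure \<Rightarrow> real \<Rightarrow> ('a \<Rightarrow> 'k::real_normed_field) \<Rightarrow> real" where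
  "pnorm M p f = (\<integral>t. norm (f t) powr p \<partial>M) powr (1 / p)"

lemma Lp_iff:
  fixes f :: "'a \<Rightarrow> 'k::{real_normed_field, euclidean_space}"
  assumes "0 < p"
  shows "f \<in> Lp M p \<longleftrightarrow> f \<in> borel_measurable M \<and> integrable M (\<lambda>t. norm (f t) powr p)"
  using assms by (auto simp: Lp_def Lnorm_def Let_def integrable_iff_bounded top.not_eq_extremum split: if_splits)

lemma Lp_measurable: "f \<in> Lp M p \<Longrightarrow> f \<in> borel_measurable M"
  by (simp add: Lp_def)

lemma Lp_integrable:
  fixes f :: "'a \<Rightarrow> 'k::{real_normed_field, euclidean_space}"
  shows "0 < p \<Longrightarrow> f \<in> Lp M p \<Longrightarrow> integrable M (\<lambda>t. norm (f t) powr p)"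
  using Lp_iff by blast

lemma Lnorm_eq_pnorm:
  fixes f :: "'a \<Rightarrow> 'k::{real_normed_field, euclidean_space}"
  assumes "0 < p" "f \<in> Lp M p"
  shows "Lnorm M (ennreal p) f = ennreal (pnorm M p f)"
proof -
  have "integrable M (\<lambda>t. norm (f t) powr p)" using assms Lp_iff by blast
  then have "(\<integral>\<^sup>+ t. ennreal (norm (f t) powr p) \<partial>M) = ennreal (\<integral>t. norm (f t) powr p \<partial>M)"
    by (intro nn_integral_eq_integral) auto
  then show ?thesis using assms(1) by (simp add: Lnorm_def Let_def pnorm_def)
qed

lemma pnorm_nonneg [simp]: "0 \<le> pnorm M p f"
  by (simp add: pnorm_def)

lemma pnorm_powr: "0 < p \<Longrightarrow> pnorm M p f powr p = (\<integral>t. norm (f t) powr p \<partial>M)"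
  by (simp add: pnorm_def powr_powr)

lemma pnorm_le_iff:
  assumes "0 < p" "0 \<le> c"
  shows "pnorm M p f \<le> c \<longleftrightarrow> (\<integral>t. norm (f t) powr p \<partial>M) \<le> c powr p"
proof -
  have "pnorm M p f \<le> c \<longleftrightarrow> pnorm M p f powr p \<le> c powr p"
    using assms by (meson powr_mono2 powr_less_mono2 pnorm_nonneg not_le order_less_imp_le)
  then show ?thesis using assms by (simp add: pnorm_powr)
qed

lemma pnorm_eq_0_iff:
  fixes f :: "'a \<Rightarrow> 'k::{real_normed_field, euclidean_space}"
  assumes "0 < p" "f \<in> Lp M p"
  shows "pnorm M p f = 0 \<longleftrightarrow> (AE t in M. f t = 0)"
proof -
  have "integrable M (\<lambda>t. norm (f t) powr p)" using assms Lp_iff by blast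
  then have "(\<integral>t. norm (f t) powr p \<partial>M) = 0 \<longleftrightarrow> (AE t in M. norm (f t) powr p = 0)"
    by (intro integral_nonneg_eq_0_iff_AE) auto
  then show ?thesis using assms by (simp add: pnorm_def)
qed

lemma powr_convex_weighted:
  fixes a b u v :: real
  assumes "1 \<le> p" "0 \<le> u" "0 \<le> v" "0 \<le> a" "0 \<le> b" "a + b = 1"
  shows "(a * u + b * v) powr p \<le> a * u powr p + b * v powr p"
proof -
  have *: "(a * u) powr p \<le> a * u powr p" if "0 \<le> a" "a \<le> 1" "0 \<le> u" for a u :: real
  proof -
    have "a powr p \<le> a powr 1" using that assms(1) by (intro powr_mono') auto
    then show ?thesis using that by (simp add: powr_mult mult_right_mono)
  qed
  show ?thesis
  proof (cases "u = 0 \<or> v = 0")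
    case True
    then show ?thesis using *[of a u] *[of b v] assms by auto
  next
    case False
    then show ?thesis
      using convex_onD[OF powr_convex[OF assms(1)], of b u v] assms by (simp add: eq_diff_eq[symmetric])
  qed
qed

text \<open>
  The weights \<open>a / (a + b)\<close> and \<open>b / (a + b)\<close> are those that normalise two functions of norms
  \<open>a\<close> and \<open>b\<close>.
\<close>

lemma powr_add_le:
  fixes a b u v :: real
  assumes "1 \<le> p" "0 \<le> u" "0 \<le> v" "0 < a" "0 < b"
  shows "(u + v) powr p \<le> (a + b) powr p * (a / (a + b) * (u powr p / a powr p) + b / (a + b) * (v powr p / b powr p))"
proof -
  have "(a / (a + b) * (u / a) + b / (a + b) * (v / b)) powr p
     \<le> a / (a + b) * (u / a) powr p + b / (a + b) * (v / b) powr p"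
    using assms by (intro powr_convex_weighted) (auto simp: add_divide_distrib[symmetric])
  moreover have "u + v = (a + b) * (a / (a + b) * (u / a) + b / (a + b) * (v / b))"
  proof -
    have "a + b \<noteq> 0" "a \<noteq> 0" "b \<noteq> 0" using assms by auto
    then show ?thesis by (simp add: distrib_left)
  qed
  moreover have "\<dots> powr p = (a + b) powr p * (a / (a + b) * (u / a) + b / (a + b) * (v / b)) powr p"
    by (rule powr_mult)
  ultimately show ?thesis using assms by (simp add: powr_divide)
qed

lemma Lp_add:
  fixes f g :: "'a \<Rightarrow> 'k::{real_normed_field, euclidean_space}"
  assumes p: "1 \<le> p" and f: "f \<in> Lp M p" and g: "g \<in> Lp M p"
  shows "f + g \<in> Lp M p"
proof -
  have 0: "0 < p" using p by simp
  have [measurable]: "f \<in> borel_measurable M" "g \<in> borel_measurable M" using f g Lp_measurable by auto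
  have "integrable M (\<lambda>t. norm ((f + g) t) powr p)"
  proof (rule Bochner_Integration.integrable_bound)
    show "integrable M (\<lambda>t. 2 powr p * (1/2 * norm (f t) powr p + 1/2 * norm (g t) powr p))"
      using Lp_integrable[OF 0 f] Lp_integrable[OF 0 g] by (intro integrable_mult_right integrable_add) auto
    show "AE t in M. norm (norm ((f + g) t) powr p) \<le> norm (2 powr p * (1/2 * norm (f t) powr p + 1/2 * norm (g t) powr p))"
    proof (rule AE_I2)
      fix t
      have "norm (f t + g t) powr p \<le> (norm (f t) + norm (g t)) powr p"
        using 0 by (intro powr_mono2) (auto intro: norm_triangle_ineq)
      also have "\<dots> \<le> 2 powr p * (1/2 * norm (f t) powr p + 1/2 * norm (g t) powr p)"
        using powr_add_le[OF p, of "norm (f t)" "norm (g t)" 1 1] by simp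
      finally show "norm (norm ((f + g) t) powr p) \<le> norm (2 powr p * (1/2 * norm (f t) powr p + 1/2 * norm (g t) powr p))"
        by simp
    qed
  qed (simp add: plus_fun_def)
  then show ?thesis unfolding Lp_iff[OF 0] by (simp add: plus_fun_def)
qed

lemma Lp_fscale:
  fixes f :: "'a \<Rightarrow> 'k::{real_normed_field, euclidean_space}"
  assumes "0 < p" "f \<in> Lp M p"
  shows "c *\<^sub>F f \<in> Lp M p"
  using assms by (auto simp: Lp_iff fscale_def norm_mult powr_mult)

lemma pnorm_fscale:
  assumes "0 < p"
  shows "pnorm M p (c *\<^sub>F f) = norm c * pnorm M p f"
  using assms by (simp add: pnorm_def fscale_def norm_mult powr_mult powr_powr)

lemma zero_Lp: "0 < p \<Longrightarrow> (0 :: 'a \<Rightarrow> 'k::{real_normed_field, euclidean_space}) \<in> Lp M p"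
  by (simp add: Lp_iff zero_fun_def)

lemma Lp_subspace:
  assumes "1 \<le> p"
  shows "pw.subspace (Lp M p :: ('a \<Rightarrow> 'k::{real_normed_field, euclidean_space}) set)"
  using assms by (intro pw.subspaceI) (auto intro: zero_Lp Lp_add Lp_fscale)

text \<open>
  Minkowski's inequality: the unit ball is convex because \<open>u \<mapsto> u\<^sup>p\<close> is.
\<close>

lemma pnorm_triangle:
  fixes f g :: "'a \<Rightarrow> 'k::{real_normed_field, euclidean_space}"
  assumes p: "1 \<le> p" and f: "f \<in> Lp M p" and g: "g \<in> Lp M p"
  shows "pnorm M p (f + g) \<le> pnorm M p f + pnorm M p g"
proof -
  have 0: "0 < p" using p by simp
  have [measurable]: "f \<in> borel_measurable M" "g \<in> borel_measurable M" using f g Lp_measurable by auto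
  have i: "integrable M (\<lambda>t. norm (f t) powr p)" "integrable M (\<lambda>t. norm (g t) powr p)"
    "integrable M (\<lambda>t. norm ((f + g) t) powr p)"
    using Lp_integrable[OF 0] f g Lp_add[OF p f g] by blast+
  \<comment> \<open>Positive upper bounds of the two norms avoid a division by zero.\<close>
  have *: "pnorm M p (f + g) \<le> a + b" if "pnorm M p f \<le> a" "pnorm M p g \<le> b" "0 < a" "0 < b" for a b
  proof -
    let ?I = "\<lambda>f. \<integral>t. norm (f t) powr p \<partial>M"
    have A: "?I f \<le> a powr p" "?I g \<le> b powr p"
      using that pnorm_le_iff[OF 0] by (metis less_imp_le)+
    have "?I (f + g) \<le> (\<integral>t. (a + b) powr p * (a / (a + b) * (norm (f t) powr p / a powr p)
        + b / (a + b) * (norm (g t) powr p / b powr p)) \<partial>M)"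
    proof (rule integral_mono)
      fix t
      have "norm ((f + g) t) powr p \<le> (norm (f t) + norm (g t)) powr p"
        using 0 by (intro powr_mono2) (auto intro: norm_triangle_ineq)
      also have "\<dots> \<le> (a + b) powr p * (a / (a + b) * (norm (f t) powr p / a powr p)
        + b / (a + b) * (norm (g t) powr p / b powr p))"
        using that p by (intro powr_add_le) auto
      finally show "norm ((f + g) t) powr p \<le> \<dots>" .
    qed (use i in \<open>auto intro!: integrable_mult_right integrable_add integrable_divide\<close>)
    also have "\<dots> = (a + b) powr p * (a / (a + b) * (?I f / a powr p) + b / (a + b) * (?I g / b powr p))"
      using i by simp
    also have "\<dots> \<le> (a + b) powr p * (a / (a + b) * 1 + b / (a + b) * 1)"
      using A that by (intro mult_left_mono add_mono) auto
    also have "\<dots> = (a + b) powr p" using that by (simp add: add_divide_distrib[symmetric])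
    finally show ?thesis using that 0 by (subst pnorm_le_iff) auto
  qed
  show ?thesis
  proof (rule field_le_epsilon)
    fix e :: real assume "0 < e"
    then have "pnorm M p (f + g) \<le> (pnorm M p f + e / 2) + (pnorm M p g + e / 2)"
      by (intro *) (auto intro: add_nonneg_pos)
    then show "pnorm M p (f + g) \<le> pnorm M p f + pnorm M p g + e" by simp
  qed
qed

lemma uminus_eq_fscale: "- f = (- 1) *\<^sub>F f"
  by (simp add: fscale_def fun_eq_iff)

lemma pnorm_minus [simp]: "pnorm M p (- f) = pnorm M p f"
  by (simp add: pnorm_def)

lemma pnorm_minus_commute: "pnorm M p (f - g) = pnorm M p (g - f)"
  by (simp add: pnorm_def norm_minus_commute)

lemma Lp_diff:
  fixes f g :: "'a \<Rightarrow> 'k::{real_normed_field, euclidean_space}"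
  assumes "1 \<le> p" "f \<in> Lp M p" "g \<in> Lp M p"
  shows "f - g \<in> Lp M p"
  using pw.subspace_diff[OF Lp_subspace] assms by blast

lemma Lp_sum:
  fixes f :: "'i \<Rightarrow> 'a \<Rightarrow> 'k::{real_normed_field, euclidean_space}"
  assumes "1 \<le> p" "\<And>i. i \<in> I \<Longrightarrow> f i \<in> Lp M p"
  shows "(\<Sum>i\<in>I. f i) \<in> Lp M p"
  using pw.subspace_sum[OF Lp_subspace] assms by blast

lemma pnorm_triangle_diff:
  fixes f g h :: "'a \<Rightarrow> 'k::{real_normed_field, euclidean_space}"
  assumes "1 \<le> p" "f \<in> Lp M p" "g \<in> Lp M p" "h \<in> Lp M p"
  shows "pnorm M p (f - h) \<le> pnorm M p (f - g) + pnorm M p (g - h)"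
  using pnorm_triangle[of p "f - g" M "g - h"] assms Lp_diff by fastforce

lemma pnorm_zero [simp]: "0 < p \<Longrightarrow> pnorm M p 0 = 0"
  by (simp add: pnorm_def zero_fun_def)

lemma pnorm_sum_le:
  fixes f :: "'i \<Rightarrow> 'a \<Rightarrow> 'k::{real_normed_field, euclidean_space}"
  assumes "1 \<le> p" "\<And>i. i \<in> I \<Longrightarrow> f i \<in> Lp M p"
  shows "pnorm M p (\<Sum>i\<in>I. f i) \<le> (\<Sum>i\<in>I. pnorm M p (f i))"
  using assms(2)
proof (induction I rule: infinite_finite_induct)
  case (insert i I)
  then have "pnorm M p (f i + (\<Sum>i\<in>I. f i)) \<le> pnorm M p (f i) + pnorm M p (\<Sum>i\<in>I. f i)"
    using assms(1) by (intro pnorm_triangle Lp_sum) auto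
  moreover have "pnorm M p (\<Sum>i\<in>I. f i) \<le> (\<Sum>i\<in>I. pnorm M p (f i))" using insert by auto
  ultimately show ?case unfolding sum.insert[OF insert(1,2)] by linarith
qed (use assms(1) in auto)

text \<open>
  By Fatou's lemma, balls of \<open>L\<^sub>p\<close> are closed under convergence almost everywhere.
\<close>

lemma pnorm_AE_limit:
  fixes f :: "nat \<Rightarrow> 'a \<Rightarrow> 'k::{real_normed_field, euclidean_space}"
  assumes p: "0 < p" and f: "\<And>n. f n \<in> Lp M p" and [measurable]: "g \<in> borel_measurable M"
    and lim: "AE t in M. (\<lambda>n. f n t) \<longlonglongrightarrow> g t"
    and le: "eventually (\<lambda>n. pnorm M p (f n) \<le> c) sequentially"
  shows "g \<in> Lp M p \<and> pnorm M p g \<le> c"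
proof -
  have [measurable]: "f n \<in> borel_measurable M" for n using f by (rule Lp_measurable)
  have c: "0 \<le> c" using eventually_happens'[OF sequentially_bot le] order_trans[OF pnorm_nonneg] by blast
  have "AE t in M. ennreal (norm (g t) powr p) = liminf (\<lambda>n. ennreal (norm (f n t) powr p))"
    using lim
  proof eventually_elim
    case (elim t)
    have "(\<lambda>n. ennreal (norm (f n t) powr p)) \<longlonglongrightarrow> ennreal (norm (g t) powr p)"
      by (rule tendsto_ennrealI, rule tendsto_powr2[OF tendsto_norm[OF elim] tendsto_const]) (use p in auto)
    then show ?case by (rule lim_imp_Liminf[OF sequentially_bot, symmetric])
  qed
  then have "(\<integral>\<^sup>+t. ennreal (norm (g t) powr p) \<partial>M) = (\<integral>\<^sup>+t. liminf (\<lambda>n. ennreal (norm (f n t) powr p)) \<partial>M)"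
    by (rule nn_integral_cong_AE)
  also have "\<dots> \<le> liminf (\<lambda>n. \<integral>\<^sup>+t. ennreal (norm (f n t) powr p) \<partial>M)"
    by (rule nn_integral_liminf) measurable
  also have "\<dots> \<le> ennreal (c powr p)"
  proof (rule Liminf_le)
    show "\<forall>\<^sub>F n in sequentially. (\<integral>\<^sup>+t. ennreal (norm (f n t) powr p) \<partial>M) \<le> ennreal (c powr p)"
      using le
    proof eventually_elim
      case (elim n)
      have "(\<integral>\<^sup>+t. ennreal (norm (f n t) powr p) \<partial>M) = ennreal (\<integral>t. norm (f n t) powr p \<partial>M)"
        using f Lp_iff[OF p] by (intro nn_integral_eq_integral) auto
      then show ?case using elim c p by (simp add: pnorm_le_iff)
    qed
  qed simp
  finally have le: "(\<integral>\<^sup>+t. ennreal (norm (g t) powr p) \<partial>M) \<le> ennreal (c powr p)" .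
  have int: "integrable M (\<lambda>t. norm (g t) powr p)"
    using le_less_trans[OF le] by (intro integrableI_bounded) auto
  then have "(\<integral>\<^sup>+t. ennreal (norm (g t) powr p) \<partial>M) = ennreal (\<integral>t. norm (g t) powr p \<partial>M)"
    by (intro nn_integral_eq_integral) auto
  then show ?thesis using le int p c by (simp add: Lp_iff pnorm_le_iff)
qed

text \<open>
  The weights \<open>2\<^sup>k\<close> leave the sum of the integrals of \<open>|2\<^sup>k g\<^sub>k|\<^sup>p\<close> finite, so almost everywhere
  \<open>2\<^sup>k |g\<^sub>k|\<close> is bounded in \<open>k\<close>.  This gives a geometric majorant without any manipulation of sums of
  functions under the norm.
\<close>

lemma AE_summable_of_pnorm_le_geometric:
  fixes g :: "nat \<Rightarrow> 'a \<Rightarrow> 'k::{real_normed_field, euclidean_space}"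
  assumes p: "1 \<le> p" and g: "\<And>k. g k \<in> Lp M p" "\<And>k. pnorm M p (g k) \<le> (1/4) ^ k"
  shows "AE t in M. summable (\<lambda>k. g k t)"
proof -
  have p0: "0 < p" using p by simp
  have [measurable]: "g n \<in> borel_measurable M" for n using g(1) by (rule Lp_measurable)
  have I: "(\<integral>\<^sup>+t. ennreal ((2 ^ k * norm (g k t)) powr p) \<partial>M) \<le> ennreal ((1/2) ^ k)" for k
  proof -
    have "(\<integral>\<^sup>+t. ennreal ((2 ^ k * norm (g k t)) powr p) \<partial>M)
       = ennreal (\<integral>t. (2 ^ k * norm (g k t)) powr p \<partial>M)"
      using g(1)[of k] Lp_iff[OF p0] by (intro nn_integral_eq_integral) (auto simp: powr_mult)
    also have "(\<integral>t. (2 ^ k * norm (g k t)) powr p \<partial>M) = (2 ^ k * pnorm M p (g k)) powr p"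
      by (simp add: powr_mult pnorm_powr p0)
    also have "\<dots> \<le> ((1/2) ^ k) powr p"
    proof (rule powr_mono2)
      have "2 ^ k * pnorm M p (g k) \<le> 2 ^ k * (1/4) ^ k" using g(2)[of k] by simp
      also have "\<dots> = (1/2) ^ k" by (simp add: power_mult_distrib[symmetric])
      finally show "2 ^ k * pnorm M p (g k) \<le> (1/2) ^ k" .
    qed (use p0 in auto)
    also have "\<dots> \<le> ((1/2) ^ k) powr 1" using p by (intro powr_mono') (auto simp: power_le_one)
    finally show ?thesis by (simp add: ennreal_leI)
  qed
  have "(\<integral>\<^sup>+t. (\<Sum>k. ennreal ((2 ^ k * norm (g k t)) powr p)) \<partial>M)
      = (\<Sum>k. \<integral>\<^sup>+t. ennreal ((2 ^ k * norm (g k t)) powr p) \<partial>M)"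
    by (rule nn_integral_suminf) measurable
  also have "\<dots> \<le> (\<Sum>k. ennreal ((1/2) ^ k))" by (intro suminf_le I summableI)
  also have "\<dots> < \<infinity>" by (subst suminf_ennreal2) (auto simp: summable_geometric)
  finally have "AE t in M. (\<Sum>k. ennreal ((2 ^ k * norm (g k t)) powr p)) \<noteq> \<infinity>"
    by (intro nn_integral_PInf_AE) (auto simp: less_top)
  then show ?thesis
  proof eventually_elim
    case (elim t)
    define u where "u k = (2 ^ k * norm (g k t)) powr p" for k
    define C where "C = enn2real (\<Sum>k. ennreal (u k))"
    have C: "(\<Sum>k. ennreal (u k)) = ennreal C" "0 \<le> C"
      using elim by (auto simp: C_def u_def less_top)
    have bound: "norm (g k t) \<le> C powr (1/p) * (1/2) ^ k" for k
    proof -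
      have "(\<Sum>k\<in>{k}. ennreal (u k)) \<le> (\<Sum>k. ennreal (u k))"
        by (rule sum_le_suminf) (auto intro: summableI)
      then have "ennreal (u k) \<le> ennreal C" unfolding C by simp
      then have "(2 ^ k * norm (g k t)) powr p \<le> C" using C(2) by (simp add: u_def)
      then have "((2 ^ k * norm (g k t)) powr p) powr (1/p) \<le> C powr (1/p)"
        using p0 by (intro powr_mono2) auto
      then have "2 ^ k * norm (g k t) \<le> C powr (1/p)" using p0 by (simp add: powr_powr)
      then show ?thesis by (simp add: power_one_over mult.commute pos_le_divide_eq)
    qed
    have "summable (\<lambda>k. C powr (1/p) * (1/2 :: real) ^ k)"
      by (intro summable_mult summable_geometric) simp
    then show ?case
      by (rule summable_comparison_test'[where N = 0]) (rule bound)
  qed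
qed

text \<open>
  The Riesz-Fischer theorem.  A subsequence with fast decreasing increments converges almost
  everywhere, and Fatou's lemma turns the Cauchy condition into convergence in norm.
\<close>

theorem Lp_complete:
  fixes f :: "nat \<Rightarrow> 'a \<Rightarrow> 'k::{real_normed_field, euclidean_space}"
  assumes p: "1 \<le> p" and f: "\<And>n. f n \<in> Lp M p"
    and Cauchy: "\<And>e. 0 < e \<Longrightarrow> \<exists>n0. \<forall>m\<ge>n0. \<forall>n\<ge>n0. pnorm M p (f m - f n) < e"
  shows "\<exists>g\<in>Lp M p. (\<lambda>n. pnorm M p (f n - g)) \<longlonglongrightarrow> 0"
proof -
  have p0: "0 < p" using p by simp
  have [measurable]: "f n \<in> borel_measurable M" for n using f by (rule Lp_measurable)
  have "\<forall>k. \<exists>n0. \<forall>m\<ge>n0. \<forall>n\<ge>n0. pnorm M p (f m - f n) < (1/4) ^ k" using Cauchy by simp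
  then obtain s where s: "\<And>k m n. m \<ge> s k \<Longrightarrow> n \<ge> s k \<Longrightarrow> pnorm M p (f m - f n) < (1/4) ^ k"
    by metis
  define r where "r k = Max (s ` {..k}) + k" for k
  have rs: "s k \<le> r k" for k unfolding r_def by (simp add: trans_le_add1)
  have rmono: "s k \<le> r (Suc k)" for k
    unfolding r_def by (intro trans_le_add1 Max_ge) auto
  define g where "g k = f (r (Suc k)) - f (r k)" for k
  have "AE t in M. summable (\<lambda>k. g k t)"
    unfolding g_def by (rule AE_summable_of_pnorm_le_geometric[OF p]) (intro Lp_diff f p less_imp_le[OF s] rs rmono)+
  then have conv: "AE t in M. convergent (\<lambda>k. f (r k) t)"
  proof eventually_elim
    case (elim t)
    have "(\<Sum>k<n. g k t) = f (r n) t - f (r 0) t" for n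
      unfolding g_def using sum_lessThan_telescope[of "\<lambda>n. f (r n) t"] by simp
    then have "convergent (\<lambda>n. f (r n) t - f (r 0) t)" using elim by (simp add: summable_iff_convergent)
    then have "convergent (\<lambda>n. (f (r n) t - f (r 0) t) + f (r 0) t)"
      by (intro convergent_add convergent_const)
    then show ?case by simp
  qed
  define h where "h t = lim (\<lambda>k. f (r k) t)" for t
  have [measurable]: "h \<in> borel_measurable M" unfolding h_def by measurable
  have lim: "AE t in M. (\<lambda>k. f (r k) t) \<longlonglongrightarrow> h t"
    using conv unfolding h_def by (simp add: convergent_LIMSEQ_iff)
  have rinf: "filterlim r at_top sequentially"
    unfolding r_def by (intro filterlim_at_top_mono[OF filterlim_ident]) auto
  have tail: "f n - h \<in> Lp M p \<and> pnorm M p (f n - h) \<le> e"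
    if n0: "\<And>m. m \<ge> n0 \<Longrightarrow> pnorm M p (f n - f m) < e" for n n0 e
  proof (rule pnorm_AE_limit[where f = "\<lambda>k. f n - f (r k)"])
    show "AE t in M. (\<lambda>k. (f n - f (r k)) t) \<longlonglongrightarrow> (f n - h) t"
      using lim by eventually_elim (auto intro: tendsto_intros)
    have "\<forall>\<^sub>F k in sequentially. r k \<ge> n0" using rinf by (simp add: filterlim_at_top)
    then show "\<forall>\<^sub>F k in sequentially. pnorm M p (f n - f (r k)) \<le> e"
      by eventually_elim (use n0 in \<open>auto intro: less_imp_le\<close>)
    show "f n - h \<in> borel_measurable M" unfolding fun_diff_def by measurable
  qed (use p0 Lp_diff[OF p f f] in auto)
  obtain n1 where "\<And>m n. m \<ge> n1 \<Longrightarrow> n \<ge> n1 \<Longrightarrow> pnorm M p (f m - f n) < 1" using Cauchy[of 1] by auto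
  then have "f n1 - h \<in> Lp M p" using tail[of n1 n1 1] by auto
  with p f[of n1] have "f n1 - (f n1 - h) \<in> Lp M p" by (rule Lp_diff)
  moreover have "f n1 - (f n1 - h) = h" by (simp add: fun_eq_iff)
  ultimately have "h \<in> Lp M p" by metis
  moreover have "(\<lambda>n. pnorm M p (f n - h)) \<longlonglongrightarrow> 0"
  proof (rule LIMSEQ_I)
    fix e :: real assume e: "0 < e"
    then obtain n0 where n0: "\<And>m n. m \<ge> n0 \<Longrightarrow> n \<ge> n0 \<Longrightarrow> pnorm M p (f m - f n) < e / 2"
      using Cauchy[of "e/2"] by auto
    have "norm (pnorm M p (f n - h) - 0) < e" if "n \<ge> n0" for n
      using tail[of n0 n "e/2"] n0 that e by auto
    then show "\<exists>no. \<forall>n\<ge>no. norm (pnorm M p (f n - h) - 0) < e" by blast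
  qed
  ultimately show ?thesis by blast
qed

section \<open>Rademacher averages\<close>

text \<open>
  A choice of signs on a finite set \<open>F\<close> is encoded by the set \<open>A \<subseteq> F\<close> of the indices with sign \<open>+\<close>, and
  averages over signs are written as sums over \<open>Pow F\<close>, without the factor \<open>2\<^sup>-\<^sup>|\<^sup>F\<^sup>|\<close>.
\<close>

definition rsign :: "'i set \<Rightarrow> 'i \<Rightarrow> real" where
  "rsign A j = (if j \<in> A then 1 else - 1)"

lemma rsign_square [simp]: "rsign A j * rsign A j = 1"
  by (simp add: rsign_def)

lemma sum_rsign_mult:
  assumes F: "finite F" and jk: "j \<in> F" "k \<in> F"
  shows "(\<Sum>A\<in>Pow F. rsign A j * rsign A k) = (if j = k then 2 ^ card F else 0)"
proof (cases "j = k")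
  case True
  then show ?thesis using F by (simp add: card_Pow)
next
  case False
  \<comment> \<open>Switching the sign at \<open>j\<close> changes the sign of the product.\<close>
  define T where "T A = (if j \<in> A then A - {j} else insert j A)" for A
  have "(\<Sum>A\<in>Pow F. rsign A j * rsign A k) = (\<Sum>A\<in>Pow F. - (rsign A j * rsign A k))"
    by (rule sum.reindex_bij_witness[of _ T T]) (use jk False in \<open>auto simp: T_def rsign_def\<close>)
  then show ?thesis using False by (simp add: sum_negf)
qed

lemma rademacher_second_moment:
  fixes a :: "'i \<Rightarrow> 'v::real_inner"
  assumes F: "finite F"
  shows "(\<Sum>A\<in>Pow F. (norm (\<Sum>j\<in>F. rsign A j *\<^sub>R a j))\<^sup>2) = 2 ^ card F * (\<Sum>j\<in>F. (norm (a j))\<^sup>2)"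
proof -
  have "(\<Sum>A\<in>Pow F. (norm (\<Sum>j\<in>F. rsign A j *\<^sub>R a j))\<^sup>2)
      = (\<Sum>A\<in>Pow F. \<Sum>j\<in>F. \<Sum>k\<in>F. (rsign A j * rsign A k) * (a j \<bullet> a k))"
    by (simp add: power2_norm_eq_inner inner_sum_left inner_sum_right sum_distrib_left inner_commute mult_ac)
  also have "\<dots> = (\<Sum>j\<in>F. \<Sum>A\<in>Pow F. \<Sum>k\<in>F. (rsign A j * rsign A k) * (a j \<bullet> a k))"
    by (rule sum.swap)
  also have "\<dots> = (\<Sum>j\<in>F. \<Sum>k\<in>F. \<Sum>A\<in>Pow F. (rsign A j * rsign A k) * (a j \<bullet> a k))"
    by (intro sum.cong refl sum.swap)
  also have "\<dots> = (\<Sum>j\<in>F. \<Sum>k\<in>F. (if j = k then 2 ^ card F else 0) * (a j \<bullet> a k))"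
    by (intro sum.cong refl) (simp add: sum_distrib_right[symmetric] sum_rsign_mult[OF F])
  also have "\<dots> = (\<Sum>j\<in>F. 2 ^ card F * (a j \<bullet> a j))"
    using F by (intro sum.cong refl) (simp add: if_distrib[of "\<lambda>x. x * _"] cong: if_cong)
  finally show ?thesis by (simp add: power2_norm_eq_inner sum_distrib_left)
qed

lemma exp_plus_exp_minus_le: "exp x + exp (- x) \<le> 2 * exp (x\<^sup>2)" for x :: real
proof -
  have *: "exp x + exp (- x) \<le> 2 * exp (x\<^sup>2)" if "0 \<le> x" for x :: real
  proof (cases "x \<le> 1")
    case True
    have "exp x \<le> 1 + x + x\<^sup>2" using exp_bound[OF that True] .
    moreover have "exp (- x) \<le> 1 - x + x\<^sup>2"
    proof -
      have "1 \<le> (1 - x + x\<^sup>2) * (1 + x)"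
        using that by (simp add: algebra_simps power2_eq_square)
      also have "\<dots> \<le> (1 - x + x\<^sup>2) * exp x"
      proof (rule mult_left_mono)
        show "0 \<le> 1 - x + x\<^sup>2" using True by (simp add: add_nonneg_nonneg)
      qed (simp add: exp_ge_add_one_self)
      finally show ?thesis by (simp add: exp_minus field_simps)
    qed
    moreover have "1 + x\<^sup>2 \<le> exp (x\<^sup>2)" by (rule exp_ge_add_one_self)
    ultimately show ?thesis by linarith
  next
    case False
    then have "exp x \<le> exp (x\<^sup>2)" "exp (- x) \<le> exp (x\<^sup>2)"
      by (auto simp: power2_eq_square intro: order_trans[of _ 0])
    then show ?thesis by linarith
  qed
  show ?thesis using *[of x] *[of "- x"] by (cases "0 \<le> x") auto
qed

lemma rademacher_exp_moment:
  assumes F: "finite F"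
  shows "(\<Sum>A\<in>Pow F. exp (\<Sum>j\<in>F. rsign A j * b j)) \<le> 2 ^ card F * exp (\<Sum>j\<in>F. (b j)\<^sup>2)"
proof -
  have "exp (\<Sum>j\<in>F. rsign A j * b j) = (\<Prod>j\<in>A. exp (b j)) * (\<Prod>j\<in>F - A. exp (- b j))" if "A \<in> Pow F" for A
  proof -
    have "exp (\<Sum>j\<in>F. rsign A j * b j) = (\<Prod>j\<in>F. exp (rsign A j * b j))"
      using F by (rule exp_sum)
    also have "\<dots> = (\<Prod>j\<in>F - A. exp (rsign A j * b j)) * (\<Prod>j\<in>A. exp (rsign A j * b j))"
      using that F by (intro prod.subset_diff) auto
    also have "\<dots> = (\<Prod>j\<in>F - A. exp (- b j)) * (\<Prod>j\<in>A. exp (b j))"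
      by (intro arg_cong2[where f = "(*)"] prod.cong) (auto simp: rsign_def)
    finally show ?thesis by (simp add: mult.commute)
  qed
  then have "(\<Sum>A\<in>Pow F. exp (\<Sum>j\<in>F. rsign A j * b j))
      = (\<Sum>A\<in>Pow F. (\<Prod>j\<in>A. exp (b j)) * (\<Prod>j\<in>F - A. exp (- b j)))"
    by (intro sum.cong) auto
  also have "\<dots> = (\<Prod>j\<in>F. exp (b j) + exp (- b j))"
    using F by (rule prod_add[symmetric])
  also have "\<dots> \<le> (\<Prod>j\<in>F. 2 * exp ((b j)\<^sup>2))"
    by (intro prod_mono) (auto simp: exp_plus_exp_minus_le add_nonneg_nonneg)
  also have "\<dots> = 2 ^ card F * exp (\<Sum>j\<in>F. (b j)\<^sup>2)"
    using F by (simp add: prod.distrib exp_sum)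
  finally show ?thesis .
qed

text \<open>
  Reduces moments of a vector to exponential moments of its coordinates: the largest coordinate
  is at least \<open>norm s / DIM\<close>, and \<open>u\<^sup>r \<le> exp (r u)\<close>.
\<close>

lemma norm_powr_le_exp_sum:
  fixes s :: "'v::euclidean_space"
  assumes "0 \<le> r"
  defines "d \<equiv> r * real DIM('v)"
  shows "norm s powr r \<le> (\<Sum>b\<in>Basis. exp (d * (s \<bullet> b)) + exp (- d * (s \<bullet> b)))"
proof -
  define m where "m = Max ((\<lambda>b. \<bar>s \<bullet> b\<bar>) ` Basis)"
  have "m \<in> (\<lambda>b. \<bar>s \<bullet> b\<bar>) ` (Basis :: 'v set)" unfolding m_def by (intro Max_in) auto
  then obtain b0 :: 'v where b0: "b0 \<in> Basis" "m = \<bar>s \<bullet> b0\<bar>" by auto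
  have "norm s \<le> (\<Sum>b\<in>Basis. \<bar>s \<bullet> b\<bar>)" by (rule norm_le_l1)
  also have "\<dots> \<le> (\<Sum>b\<in>(Basis :: 'v set). m)" unfolding m_def by (intro sum_mono Max_ge) auto
  finally have le: "norm s \<le> real DIM('v) * m" by simp
  have "norm s powr r \<le> exp (norm s) powr r"
  proof (rule powr_mono2)
    show "norm s \<le> exp (norm s)" using exp_ge_add_one_self[of "norm s"] by linarith
  qed (use assms(1) in auto)
  also have "\<dots> = exp (r * norm s)" by (simp add: powr_def)
  also have "\<dots> \<le> exp (d * \<bar>s \<bullet> b0\<bar>)"
    using mult_left_mono[OF le assms(1)] b0 by (simp add: d_def mult_ac)
  also have "\<dots> \<le> exp (d * (s \<bullet> b0)) + exp (- d * (s \<bullet> b0))"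
    by (cases "0 \<le> s \<bullet> b0") auto
  also have "\<dots> \<le> (\<Sum>b\<in>Basis. exp (d * (s \<bullet> b)) + exp (- d * (s \<bullet> b)))"
    using member_le_sum[OF b0(1), of "\<lambda>b. exp (d * (s \<bullet> b)) + exp (- d * (s \<bullet> b))"]
    by (auto intro: add_nonneg_nonneg)
  finally show ?thesis .
qed

lemma rademacher_normalise:
  fixes a :: "'i \<Rightarrow> 'v::real_normed_vector"
  assumes "(\<Sum>j\<in>F. (norm (a j))\<^sup>2) \<noteq> 0"
  obtains b :: "'i \<Rightarrow> 'v" where "(\<Sum>j\<in>F. (norm (b j))\<^sup>2) = 1"
    and "(\<Sum>A\<in>Pow F. norm (\<Sum>j\<in>F. rsign A j *\<^sub>R a j) powr r)
      = (\<Sum>j\<in>F. (norm (a j))\<^sup>2) powr (r / 2) * (\<Sum>A\<in>Pow F. norm (\<Sum>j\<in>F. rsign A j *\<^sub>R b j) powr r)"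
proof -
  define s where "s = sqrt (\<Sum>j\<in>F. (norm (a j))\<^sup>2)"
  have pos: "0 < (\<Sum>j\<in>F. (norm (a j))\<^sup>2)" using assms by (simp add: sum_nonneg order_less_le)
  then have s: "0 < s" "s\<^sup>2 = (\<Sum>j\<in>F. (norm (a j))\<^sup>2)" by (auto simp: s_def)
  have sr: "s powr r = (\<Sum>j\<in>F. (norm (a j))\<^sup>2) powr (r / 2)"
    using pos by (simp add: s_def powr_half_sqrt[symmetric] powr_powr)
  have "(\<Sum>j\<in>F. (norm (a j /\<^sub>R s))\<^sup>2) = (\<Sum>j\<in>F. (norm (a j))\<^sup>2) / s\<^sup>2"
    by (simp add: power_mult_distrib power_inverse divide_inverse sum_distrib_left mult.commute)
  also have "\<dots> = 1" using s pos by simp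
  finally have one: "(\<Sum>j\<in>F. (norm (a j /\<^sub>R s))\<^sup>2) = 1" .
  have "(\<Sum>j\<in>F. rsign A j *\<^sub>R a j) = s *\<^sub>R (\<Sum>j\<in>F. rsign A j *\<^sub>R (a j /\<^sub>R s))" for A
    unfolding scaleR_sum_right by (intro sum.cong refl) (use s(1) in simp)
  then have "(\<Sum>A\<in>Pow F. norm (\<Sum>j\<in>F. rsign A j *\<^sub>R a j) powr r)
      = s powr r * (\<Sum>A\<in>Pow F. norm (\<Sum>j\<in>F. rsign A j *\<^sub>R (a j /\<^sub>R s)) powr r)"
    using s(1) by (simp add: powr_mult sum_distrib_left)
  with one show thesis unfolding sr by (rule that)
qed

text \<open>
  Rademacher sums are subgaussian: by independence
  the exponential moment is a product, and each factor is at most \<open>exp (b\<^sub>j\<^sup>2)\<close>.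
\<close>

theorem khintchine_upper:
  fixes r :: real
  assumes r: "0 \<le> r"
  shows "\<exists>C>0. \<forall>F (a :: 'i \<Rightarrow> 'v::euclidean_space). finite F \<longrightarrow>
    (\<Sum>A\<in>Pow F. norm (\<Sum>j\<in>F. rsign A j *\<^sub>R a j) powr r)
      \<le> C * 2 ^ card F * (\<Sum>j\<in>F. (norm (a j))\<^sup>2) powr (r / 2)"
proof -
  define d where "d = r * real DIM('v)"
  define C where "C = 2 * real DIM('v) * exp (d\<^sup>2)"
  have unit: "(\<Sum>A\<in>Pow F. norm (\<Sum>j\<in>F. rsign A j *\<^sub>R a j) powr r) \<le> C * 2 ^ card F"
    if F: "finite F" and a: "(\<Sum>j\<in>F. (norm (a j))\<^sup>2) = 1" for F and a :: "'i \<Rightarrow> 'v"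
  proof -
    have E: "(\<Sum>A\<in>Pow F. exp (e * ((\<Sum>j\<in>F. rsign A j *\<^sub>R a j) \<bullet> b))) \<le> 2 ^ card F * exp (d\<^sup>2)"
      if b: "b \<in> Basis" and e: "e\<^sup>2 = d\<^sup>2" for b e
    proof -
      have "(\<Sum>A\<in>Pow F. exp (e * ((\<Sum>j\<in>F. rsign A j *\<^sub>R a j) \<bullet> b)))
          = (\<Sum>A\<in>Pow F. exp (\<Sum>j\<in>F. rsign A j * (e * (a j \<bullet> b))))"
        by (simp add: inner_sum_left sum_distrib_left mult_ac)
      also have "\<dots> \<le> 2 ^ card F * exp (\<Sum>j\<in>F. (e * (a j \<bullet> b))\<^sup>2)"
        by (rule rademacher_exp_moment[OF F])
      also have "(\<Sum>j\<in>F. (e * (a j \<bullet> b))\<^sup>2) = d\<^sup>2 * (\<Sum>j\<in>F. (a j \<bullet> b)\<^sup>2)"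
        by (simp add: power_mult_distrib e sum_distrib_left)
      also have "\<dots> \<le> d\<^sup>2 * (\<Sum>j\<in>F. (norm (a j))\<^sup>2)"
        using Basis_le_norm[OF b] by (intro mult_left_mono sum_mono) (auto simp: abs_le_square_iff[symmetric])
      finally show ?thesis using a by simp
    qed
    have "(\<Sum>A\<in>Pow F. norm (\<Sum>j\<in>F. rsign A j *\<^sub>R a j) powr r)
      \<le> (\<Sum>A\<in>Pow F. \<Sum>b\<in>Basis. exp (d * ((\<Sum>j\<in>F. rsign A j *\<^sub>R a j) \<bullet> b)) + exp (- d * ((\<Sum>j\<in>F. rsign A j *\<^sub>R a j) \<bullet> b)))"
      unfolding d_def by (intro sum_mono norm_powr_le_exp_sum[OF r])
    also have "\<dots> = (\<Sum>b\<in>Basis. (\<Sum>A\<in>Pow F. exp (d * ((\<Sum>j\<in>F. rsign A j *\<^sub>R a j) \<bullet> b)))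
        + (\<Sum>A\<in>Pow F. exp (- d * ((\<Sum>j\<in>F. rsign A j *\<^sub>R a j) \<bullet> b))))"
      by (subst sum.swap) (simp add: sum.distrib)
    also have "\<dots> \<le> (\<Sum>b\<in>(Basis :: 'v set). 2 ^ card F * exp (d\<^sup>2) + 2 ^ card F * exp (d\<^sup>2))"
      by (intro sum_mono add_mono E) auto
    also have "\<dots> = C * 2 ^ card F" by (simp add: C_def)
    finally show ?thesis .
  qed
  have "(\<Sum>A\<in>Pow F. norm (\<Sum>j\<in>F. rsign A j *\<^sub>R a j) powr r) \<le> C * 2 ^ card F * (\<Sum>j\<in>F. (norm (a j))\<^sup>2) powr (r / 2)"
    if F: "finite F" for F and a :: "'i \<Rightarrow> 'v"
  proof (cases "(\<Sum>j\<in>F. (norm (a j))\<^sup>2) = 0")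
    case True
    then have "\<forall>j\<in>F. a j = 0" using F by (simp add: sum_nonneg_eq_0_iff)
    then show ?thesis using True by simp
  next
    case False
    obtain b :: "'i \<Rightarrow> 'v" where b: "(\<Sum>j\<in>F. (norm (b j))\<^sup>2) = 1"
      "(\<Sum>A\<in>Pow F. norm (\<Sum>j\<in>F. rsign A j *\<^sub>R a j) powr r)
      = (\<Sum>j\<in>F. (norm (a j))\<^sup>2) powr (r / 2) * (\<Sum>A\<in>Pow F. norm (\<Sum>j\<in>F. rsign A j *\<^sub>R b j) powr r)"
      by (rule rademacher_normalise[OF False])
    show ?thesis
      unfolding b(2) mult.commute[of "C * 2 ^ card F"] by (intro mult_left_mono unit F b(1)) simp
  qed
  moreover have "0 < C" by (simp add: C_def)
  ultimately show ?thesis by blast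
qed

lemma square_le_interpolate:
  fixes s K r :: real
  assumes "0 \<le> s" "0 < K" "r \<le> 2"
  shows "s\<^sup>2 \<le> K powr (2 - r) * s powr r + s powr 4 / K\<^sup>2"
proof (cases "s = 0")
  case False
  then have s: "0 < s" using assms by simp
  show ?thesis
  proof (cases "s \<le> K")
    case True
    have "s\<^sup>2 = s powr (2 - r) * s powr r" using s by (simp add: powr_add[symmetric])
    also have "\<dots> \<le> K powr (2 - r) * s powr r"
      using True s assms by (intro mult_right_mono powr_mono2) auto
    finally show ?thesis by (simp add: add_increasing2)
  next
    case False
    then have "s\<^sup>2 * K\<^sup>2 \<le> s\<^sup>2 * s\<^sup>2" using assms by (intro mult_left_mono power_mono) auto
    also have "\<dots> = s powr 4" using s by (simp add: power_add[symmetric])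
    finally have "s\<^sup>2 \<le> s powr 4 / K\<^sup>2" using assms by (simp add: pos_le_divide_eq)
    then show ?thesis by (simp add: add_increasing)
  qed
qed auto

text \<open>
  The lower bound follows from the known second moment and the bounded fourth moment: values above \<open>K\<close> contribute at most half of the second moment.
\<close>

theorem khintchine_lower:
  fixes r :: real
  assumes r: "r \<le> 2"
  shows "\<exists>c>0. \<forall>F (a :: 'i \<Rightarrow> 'v::euclidean_space). finite F \<longrightarrow>
    c * 2 ^ card F * (\<Sum>j\<in>F. (norm (a j))\<^sup>2) powr (r / 2)
      \<le> (\<Sum>A\<in>Pow F. norm (\<Sum>j\<in>F. rsign A j *\<^sub>R a j) powr r)"
proof -
  obtain C where C: "0 < C" "\<And>F a. finite F \<Longrightarrow>
      (\<Sum>A\<in>Pow F. norm (\<Sum>j\<in>F. rsign A j *\<^sub>R (a j :: 'v)) powr 4)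
      \<le> C * 2 ^ card F * (\<Sum>j\<in>(F :: 'i set). (norm (a j))\<^sup>2) powr (4 / 2)"
    using khintchine_upper[of 4, where 'i = 'i and 'v = 'v] by auto
  define K where "K = sqrt (2 * C)"
  have K: "0 < K" "K\<^sup>2 = 2 * C" using C by (auto simp: K_def)
  define c where "c = 1 / (2 * K powr (2 - r))"
  have unit: "c * 2 ^ card F \<le> (\<Sum>A\<in>Pow F. norm (\<Sum>j\<in>F. rsign A j *\<^sub>R a j) powr r)"
    if F: "finite F" and a: "(\<Sum>j\<in>F. (norm (a j))\<^sup>2) = 1" for F and a :: "'i \<Rightarrow> 'v"
  proof -
    let ?S = "\<lambda>A. \<Sum>j\<in>F. rsign A j *\<^sub>R a j"
    have "2 ^ card F = (\<Sum>A\<in>Pow F. (norm (?S A))\<^sup>2)"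
      using rademacher_second_moment[OF F, of a] a by simp
    also have "\<dots> \<le> (\<Sum>A\<in>Pow F. K powr (2 - r) * norm (?S A) powr r + norm (?S A) powr 4 / K\<^sup>2)"
      using K r by (intro sum_mono square_le_interpolate) auto
    also have "\<dots> = K powr (2 - r) * (\<Sum>A\<in>Pow F. norm (?S A) powr r) + (\<Sum>A\<in>Pow F. norm (?S A) powr 4) / K\<^sup>2"
      by (simp add: sum.distrib sum_distrib_left sum_divide_distrib)
    also have "(\<Sum>A\<in>Pow F. norm (?S A) powr 4) / K\<^sup>2 \<le> C * 2 ^ card F / K\<^sup>2"
      using C(2)[OF F, of a] a by (intro divide_right_mono) auto
    also have "\<dots> = 2 ^ card F / 2" using K C by simp
    finally have "2 ^ card F / 2 \<le> K powr (2 - r) * (\<Sum>A\<in>Pow F. norm (?S A) powr r)" by simp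
    then show ?thesis using K by (simp add: c_def field_simps)
  qed
  have "c * 2 ^ card F * (\<Sum>j\<in>F. (norm (a j))\<^sup>2) powr (r / 2) \<le> (\<Sum>A\<in>Pow F. norm (\<Sum>j\<in>F. rsign A j *\<^sub>R a j) powr r)"
    if F: "finite F" for F and a :: "'i \<Rightarrow> 'v"
  proof (cases "(\<Sum>j\<in>F. (norm (a j))\<^sup>2) = 0")
    case True
    then have "\<forall>j\<in>F. a j = 0" using F by (simp add: sum_nonneg_eq_0_iff)
    then show ?thesis using True by simp
  next
    case False
    obtain b :: "'i \<Rightarrow> 'v" where b: "(\<Sum>j\<in>F. (norm (b j))\<^sup>2) = 1"
      "(\<Sum>A\<in>Pow F. norm (\<Sum>j\<in>F. rsign A j *\<^sub>R a j) powr r)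
      = (\<Sum>j\<in>F. (norm (a j))\<^sup>2) powr (r / 2) * (\<Sum>A\<in>Pow F. norm (\<Sum>j\<in>F. rsign A j *\<^sub>R b j) powr r)"
      by (rule rademacher_normalise[OF False])
    show ?thesis
      unfolding b(2) mult.commute[of "c * 2 ^ card F"] by (intro mult_left_mono unit F b(1)) simp
  qed
  moreover have "0 < c" using K by (simp add: c_def)
  ultimately show ?thesis by blast
qed

section \<open>Uniform boundedness\<close>

lemma closed_subspace_limit:
  fixes f :: "nat \<Rightarrow> 'a \<Rightarrow> 'k::{real_normed_field, euclidean_space}"
  assumes p: "1 \<le> p" and X: "closed_subspace M p X" and f: "\<And>n. f n \<in> X" and g: "g \<in> Lp M p"
    and lim: "(\<lambda>n. pnorm M p (f n - g)) \<longlonglongrightarrow> 0"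
  shows "g \<in> X"
proof -
  have XL: "X \<subseteq> Lp M p" and cl: "Lp_closure M p X = X" using X by (auto simp: closed_subspace_def)
  have "\<exists>h\<in>X. Lnorm M (ennreal p) (g - h) < e" if e: "e > 0" for e
  proof -
    have "(\<lambda>n. ennreal (pnorm M p (f n - g))) \<longlonglongrightarrow> ennreal 0" using lim by (rule tendsto_ennrealI)
    then have "\<forall>\<^sub>F n in sequentially. ennreal (pnorm M p (f n - g)) < e"
      using e by (auto elim: order_tendstoD)
    then obtain n where "ennreal (pnorm M p (f n - g)) < e"
      using eventually_happens'[OF sequentially_bot] by blast
    moreover have "Lnorm M (ennreal p) (g - f n) = ennreal (pnorm M p (f n - g))"
      using p Lp_diff[OF p g] f XL by (subst Lnorm_eq_pnorm) (auto simp: pnorm_minus_commute)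
    ultimately show ?thesis using f by metis
  qed
  then have "g \<in> Lp_closure M p X" using g by (simp add: Lp_closure_def)
  then show ?thesis using cl by simp
qed

lemma closed_subspace_complete:
  fixes f :: "nat \<Rightarrow> 'a \<Rightarrow> 'k::{real_normed_field, euclidean_space}"
  assumes p: "1 \<le> p" and X: "closed_subspace M p X" and f: "\<And>n. f n \<in> X"
    and Cauchy: "\<And>e. 0 < e \<Longrightarrow> \<exists>n0. \<forall>m\<ge>n0. \<forall>n\<ge>n0. pnorm M p (f m - f n) < e"
  shows "\<exists>g\<in>X. (\<lambda>n. pnorm M p (f n - g)) \<longlonglongrightarrow> 0"
proof -
  have "X \<subseteq> Lp M p" using X by (auto simp: closed_subspace_def)
  then have "f n \<in> Lp M p" for n using f by blast
  then obtain g where "g \<in> Lp M p" "(\<lambda>n. pnorm M p (f n - g)) \<longlonglongrightarrow> 0"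
    using Lp_complete[OF p _ Cauchy] by blast
  then show ?thesis using closed_subspace_limit[of p M X f g] p X f by blast
qed

text \<open>
  The uniform boundedness principle for seminorms on a closed subspace, by Sokal's gliding hump.
  If the norms \<open>c\<^sub>i\<close> of the \<open>Q\<^sub>i\<close> are unbounded, add vectors of norm at most \<open>3\<^sup>-\<^sup>n\<close> one after the other,
  the \<open>n\<close>-th almost norming for some \<open>Q\<^sub>i\<close> with \<open>c\<^sub>i > 4\<^sup>n\<close>, with signs chosen so that the value of this \<open>Q\<^sub>i\<close>
  does not get lost.  The later terms have total norm at most \<open>3\<^sup>-\<^sup>n / 2\<close> and remove only a part of it.
\<close>

theorem uniform_boundedness:
  fixes X :: "('a \<Rightarrow> 'k::{real_normed_field, euclidean_space}) set"
    and Q :: "'i \<Rightarrow> ('a \<Rightarrow> 'k) \<Rightarrow> real"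
  assumes p: "1 \<le> p" and X: "closed_subspace M p X"
    and add: "\<And>i f g. f \<in> X \<Longrightarrow> g \<in> X \<Longrightarrow> Q i (f + g) \<le> Q i f + Q i g"
    and scale: "\<And>i c f. f \<in> X \<Longrightarrow> Q i (c *\<^sub>F f) = norm c * Q i f"
    and bdd: "\<And>i. \<exists>C. \<forall>f\<in>X. Q i f \<le> C * pnorm M p f"
    and pointwise: "\<And>f. f \<in> X \<Longrightarrow> \<exists>B. \<forall>i. Q i f \<le> B"
  shows "\<exists>K. \<forall>i. \<forall>f\<in>X. Q i f \<le> K * pnorm M p f"
proof (rule ccontr)
  assume "\<not> ?thesis"
  then have unbdd: "\<exists>i. \<exists>f\<in>X. Q i f > K * pnorm M p f" for K by (meson not_le)
  have p0: "0 < p" using p by simp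
  have XL: "X \<subseteq> Lp M p" and sub: "pw.subspace X" using X by (auto simp: closed_subspace_def)
  have X0: "0 \<in> X" using sub pw.subspace_0 by blast
  define S where "S i = Q i ` {f \<in> X. pnorm M p f \<le> 1}" for i
  define c where "c i = Sup (S i)" for i
  have S0: "S i \<noteq> {}" for i unfolding S_def using X0 p0 by force
  have Sbdd: "bdd_above (S i)" for i
  proof -
    obtain C where C: "\<And>f. f \<in> X \<Longrightarrow> Q i f \<le> C * pnorm M p f" using bdd by blast
    have "Q i f \<le> \<bar>C\<bar>" if "f \<in> X" "pnorm M p f \<le> 1" for f
    proof -
      have "Q i f \<le> \<bar>C\<bar> * pnorm M p f"
        by (rule order_trans[OF C[OF that(1)] mult_right_mono]) auto
      also have "\<dots> \<le> \<bar>C\<bar> * 1" using that by (intro mult_left_mono) auto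
      finally show ?thesis by simp
    qed
    then show ?thesis unfolding S_def by (intro bdd_aboveI[of _ "\<bar>C\<bar>"]) auto
  qed
  have null: "Q i f \<le> 0" if "f \<in> X" "pnorm M p f = 0" for i f
    using bdd[of i] that by fastforce
  have Qc: "Q i f \<le> c i * pnorm M p f" if f: "f \<in> X" for i f
  proof (cases "pnorm M p f = 0")
    case True
    then show ?thesis using null[OF f] by simp
  next
    case False
    then have n: "0 < pnorm M p f" by (simp add: order_less_le)
    let ?f = "(of_real (1 / pnorm M p f) :: 'k) *\<^sub>F f"
    have "?f \<in> X" using sub f by (rule pw.subspace_scale)
    moreover have "pnorm M p ?f = 1"
      unfolding pnorm_fscale[OF p0] norm_of_real using n by simp
    ultimately have "Q i ?f \<in> S i" by (auto simp: S_def)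
    then have "Q i ?f \<le> c i" unfolding c_def by (rule cSup_upper[OF _ Sbdd])
    moreover have "Q i ?f = Q i f / pnorm M p f"
      unfolding scale[OF f] norm_of_real using n by simp
    ultimately show ?thesis using n by (simp add: pos_divide_le_eq)
  qed
  have "\<exists>i g. 4 ^ n < c i \<and> g \<in> X \<and> pnorm M p g \<le> (1/3) ^ n \<and> 2/3 * c i * (1/3) ^ n < Q i g" for n
  proof -
    obtain i f where f: "f \<in> X" "Q i f > 4 ^ n * pnorm M p f" using unbdd by blast
    have "4 ^ n * pnorm M p f < c i * pnorm M p f" using f Qc[OF f(1), of i] by linarith
    then have ci: "4 ^ n < c i" by (simp add: mult_less_cancel_right)
    moreover have "0 < c i" using ci zero_less_power[of "4::real" n] by linarith
    ultimately have "2/3 * c i < Sup (S i)" by (simp add: c_def)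
    then obtain g where g: "g \<in> X" "pnorm M p g \<le> 1" "2/3 * c i < Q i g"
      using less_cSup_iff[OF S0 Sbdd, of "2/3 * c i" i] unfolding S_def by blast
    let ?g = "(of_real ((1/3) ^ n) :: 'k) *\<^sub>F g"
    have nn: "norm (of_real ((1/3) ^ n) :: 'k) = (1/3) ^ n" unfolding norm_of_real by simp
    have "?g \<in> X" using sub g(1) by (rule pw.subspace_scale)
    moreover have "pnorm M p ?g \<le> (1/3) ^ n"
      unfolding pnorm_fscale[OF p0] nn using mult_left_mono[OF g(2), of "(1/3)^n"] by simp
    moreover have "2/3 * c i * (1/3) ^ n < Q i ?g"
      unfolding scale[OF g(1)] nn using g(3) by simp
    ultimately show ?thesis using ci by blast
  qed
  then obtain i g where ci: "\<And>n. 4 ^ n < c (i n)" and gX: "\<And>n. g n \<in> X"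
    and gn: "\<And>n. pnorm M p (g n) \<le> (1/3) ^ n" and Qg: "\<And>n. 2/3 * c (i n) * (1/3) ^ n < Q (i n) (g n)"
    by metis
  define h where "h = rec_nat 0 (\<lambda>n u. if Q (i n) (g n) \<le> Q (i n) (u + g n) then u + g n else u - g n)"
  have h0: "h 0 = 0" and hS: "h (Suc n) = (if Q (i n) (g n) \<le> Q (i n) (h n + g n) then h n + g n else h n - g n)" for n
    by (simp_all add: h_def)
  have hX: "h n \<in> X" for n
  proof (induction n)
    case 0
    show ?case unfolding h0 by (rule X0)
  next
    case (Suc n)
    show ?case unfolding hS
      by (cases "Q (i n) (g n) \<le> Q (i n) (h n + g n)", simp_all only: if_True if_False)
        (rule pw.subspace_add[OF sub Suc gX] pw.subspace_diff[OF sub Suc gX])+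
  qed
  have Qminus: "Q j (- f) = Q j f" if "f \<in> X" for j f
    using scale[OF that, of j "- 1"] unfolding uminus_eq_fscale by (simp only: norm_minus_cancel norm_one mult_1)
  \<comment> \<open>One of \<open>u + v\<close> and \<open>u - v\<close> is at least as large as \<open>v\<close>, since \<open>2v\<close> is their difference.\<close>
  have Qh: "Q (i n) (g n) \<le> Q (i n) (h (Suc n))" for n
  proof (cases "Q (i n) (g n) \<le> Q (i n) (h n + g n)")
    case False
    have m: "h n + g n \<in> X" "h n - g n \<in> X" "- (h n - g n) \<in> X"
      using hX gX by (auto intro: pw.subspace_add[OF sub] pw.subspace_diff[OF sub] pw.subspace_neg[OF sub])
    have "2 * Q (i n) (g n) = Q (i n) ((2 :: 'k) *\<^sub>F g n)" using scale[OF gX] by simp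
    also have "(2 :: 'k) *\<^sub>F g n = (h n + g n) + (- (h n - g n))"
      by (simp add: fscale_def fun_eq_iff)
    also have "Q (i n) \<dots> \<le> Q (i n) (h n + g n) + Q (i n) (- (h n - g n))"
      using m by (intro add)
    also have "Q (i n) (- (h n - g n)) = Q (i n) (h n - g n)" using m by (intro Qminus)
    finally have "Q (i n) (g n) \<le> Q (i n) (h n - g n)" using False by linarith
    then show ?thesis using False by (simp add: hS)
  qed (simp add: hS)
  have step: "pnorm M p (h (Suc n) - h n) \<le> (1/3) ^ n" for n
  proof -
    have "h (Suc n) - h n = g n \<or> h (Suc n) - h n = - g n" by (auto simp: hS fun_eq_iff)
    then show ?thesis using gn[of n] pnorm_minus[of M p "g n"] by metis
  qed
  have hL: "h n \<in> Lp M p" for n using hX XL by blast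
  have tail: "pnorm M p (h n - h (n + k)) \<le> 3/2 * (1/3) ^ n - 3/2 * (1/3) ^ (n + k)" for n k
  proof (induction k)
    case (Suc k)
    have "pnorm M p (h n - h (n + Suc k)) \<le> pnorm M p (h n - h (n + k)) + pnorm M p (h (n + k) - h (n + Suc k))"
      by (rule pnorm_triangle_diff[OF p hL hL hL])
    also have "pnorm M p (h (n + k) - h (n + Suc k)) \<le> (1/3) ^ (n + k)"
      using step[of "n + k"] unfolding pnorm_minus_commute[of M p "h (n + k)"] by simp
    moreover have "(1/3 :: real) ^ (n + Suc k) = 1/3 * (1/3) ^ (n + k)" by simp
    ultimately show ?case using Suc by linarith
  qed (simp only: add_0_right diff_self pnorm_zero[OF p0] order_refl)
  have tail': "pnorm M p (h n - h m) \<le> 3/2 * (1/3) ^ n" if "n \<le> m" for n m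
  proof -
    have "pnorm M p (h n - h m) \<le> 3/2 * (1/3) ^ n - 3/2 * (1/3) ^ m"
      using tail[of n "m - n"] that by simp
    moreover have "0 \<le> (1/3 :: real) ^ m" by simp
    ultimately show ?thesis by linarith
  qed
  have "\<exists>n0. \<forall>m\<ge>n0. \<forall>n\<ge>n0. pnorm M p (h m - h n) < e" if e: "0 < e" for e
  proof -
    obtain n0 where n0: "(1/3 :: real) ^ n0 < e / 3" using real_arch_pow_inv[of "e/3" "1/3"] e by auto
    have "pnorm M p (h m - h n) < e" if "m \<ge> n0" "n \<ge> n0" for m n
    proof -
      have "pnorm M p (h m - h n) \<le> pnorm M p (h m - h n0) + pnorm M p (h n0 - h n)"
        by (rule pnorm_triangle_diff[OF p hL hL hL])
      also have "\<dots> \<le> 3/2 * (1/3) ^ n0 + 3/2 * (1/3) ^ n0"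
        using tail'[OF that(1)] tail'[OF that(2)] by (simp add: pnorm_minus_commute)
      finally show ?thesis using n0 by simp
    qed
    then show ?thesis by blast
  qed
  then have "\<exists>w\<in>X. (\<lambda>n. pnorm M p (h n - w)) \<longlonglongrightarrow> 0"
    by (rule closed_subspace_complete[of p M X h, OF p X hX])
  then obtain w where w: "w \<in> X" "(\<lambda>n. pnorm M p (h n - w)) \<longlonglongrightarrow> 0" ..
  have wL: "w \<in> Lp M p" using w XL by blast
  have near: "pnorm M p (h n - w) \<le> 3/2 * (1/3) ^ n" for n
  proof (rule tendsto_lowerbound)
    show "(\<lambda>m. 3/2 * (1/3) ^ n + pnorm M p (h m - w)) \<longlonglongrightarrow> 3/2 * (1/3) ^ n"
      using tendsto_add[OF tendsto_const w(2)] by simp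
    show "\<forall>\<^sub>F m in sequentially. pnorm M p (h n - w) \<le> 3/2 * (1/3) ^ n + pnorm M p (h m - w)"
    proof (rule eventually_sequentiallyI[of n])
      fix m assume "n \<le> m"
      then show "pnorm M p (h n - w) \<le> 3/2 * (1/3) ^ n + pnorm M p (h m - w)"
        using tail'[of n m] pnorm_triangle_diff[OF p hL[of n] hL[of m] wL] by linarith
    qed
  qed simp
  have big: "1/6 * (4/3) ^ n \<le> Q (i n) w" for n
  proof -
    have m: "h (Suc n) - w \<in> X" using hX w by (intro pw.subspace_diff[OF sub])
    have "h (Suc n) = w + (h (Suc n) - w)" by simp
    then have "Q (i n) (h (Suc n)) \<le> Q (i n) w + Q (i n) (h (Suc n) - w)"
      using add[OF w(1) m] by metis
    moreover have "Q (i n) (h (Suc n) - w) \<le> c (i n) * (1/2 * (1/3) ^ n)"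
    proof -
      have "0 \<le> c (i n)" using ci[of n] zero_less_power[of "4::real" n] by linarith
      moreover have "pnorm M p (h (Suc n) - w) \<le> 1/2 * (1/3) ^ n" using near[of "Suc n"] unfolding power_Suc by linarith
      ultimately show ?thesis using Qc[OF m, of "i n"] by (meson mult_left_mono order_trans)
    qed
    moreover have "2/3 * c (i n) * (1/3) ^ n = 2/3 * (c (i n) * (1/3) ^ n)"
      "c (i n) * (1/2 * (1/3) ^ n) = 1/2 * (c (i n) * (1/3) ^ n)" by simp_all
    ultimately have "1/6 * (c (i n) * (1/3) ^ n) \<le> Q (i n) w" using Qg[of n] Qh[of n] by linarith
    moreover have "(4/3 :: real) ^ n = 4 ^ n * (1/3) ^ n" by (simp add: power_mult_distrib[symmetric])
    moreover have "4 ^ n * (1/3) ^ n \<le> c (i n) * (1/3) ^ n" using ci[of n] by (intro mult_right_mono) auto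
    ultimately show ?thesis by linarith
  qed
  obtain B where B: "\<And>j. Q j w \<le> B" using pointwise[OF w(1)] by blast
  obtain n where "6 * B < (4/3) ^ n" using real_arch_pow[of "4/3" "6 * B"] by auto
  then show False using big[of n] B[of "i n"] by simp
qed

text \<open>
  On each block \<open>{m k..<m (Suc k)}\<close> the permutation enumerates \<open>F k\<close> first, so that the sum over
  \<open>F k\<close> becomes a difference of two partial sums of the rearranged series.
\<close>

lemma block_permutation:
  fixes F :: "nat \<Rightarrow> nat set" and m :: "nat \<Rightarrow> nat"
  assumes m: "strict_mono m" "m 0 = 0" and F: "\<And>k. F k \<subseteq> {m k..<m (Suc k)}"
  shows "\<exists>\<pi>. bij \<pi> \<and> (\<forall>k. \<pi> ` {m k..<m k + card (F k)} = F k)"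
proof -
  have fin: "finite (F k)" for k using F finite_subset by blast
  have "\<exists>b. bij_betw b {m k..<m (Suc k)} {m k..<m (Suc k)} \<and> b ` {m k..<m k + card (F k)} = F k" for k
  proof -
    let ?I = "{m k..<m (Suc k)}" and ?L = "{m k..<m k + card (F k)}"
    have "card (F k) \<le> card ?I" by (intro card_mono F) simp
    then have le: "m k + card (F k) \<le> m (Suc k)"
      using strict_monoD[OF m(1), of k "Suc k"] by simp
    obtain b1 where b1: "bij_betw b1 ?L (F k)"
      using finite_same_card_bij[of ?L "F k"] fin by auto
    have "card (?I - ?L) = card (?I - F k)"
      using F fin le by (subst (1 2) card_Diff_subset) auto
    then obtain b2 where b2: "bij_betw b2 (?I - ?L) (?I - F k)"
      using finite_same_card_bij[of "?I - ?L" "?I - F k"] by auto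
    let ?b = "\<lambda>n. if n \<in> ?L then b1 n else b2 n"
    have "bij_betw ?b ?L (F k)" using b1 by (subst bij_betw_cong[of ?L ?b b1]) auto
    moreover have "bij_betw ?b (?I - ?L) (?I - F k)" using b2 by (subst bij_betw_cong[of _ ?b b2]) auto
    ultimately have "bij_betw ?b (?L \<union> (?I - ?L)) (F k \<union> (?I - F k))"
      by (rule bij_betw_combine) auto
    moreover have "?L \<union> (?I - ?L) = ?I" using le by auto
    moreover have "F k \<union> (?I - F k) = ?I" using F by auto
    ultimately have "bij_betw ?b ?I ?I" by simp
    moreover have "?b ` ?L = F k" using \<open>bij_betw ?b ?L (F k)\<close> by (simp add: bij_betw_def)
    ultimately show ?thesis by blast
  qed
  then obtain b where b: "\<And>k. bij_betw (b k) {m k..<m (Suc k)} {m k..<m (Suc k)}"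
    "\<And>k. b k ` {m k..<m k + card (F k)} = F k" by metis
  define \<kappa> where "\<kappa> n = (LEAST k. n < m (Suc k))" for n
  define \<pi> where "\<pi> n = b (\<kappa> n) n" for n
  have \<kappa>: "\<kappa> n = k" if "n \<in> {m k..<m (Suc k)}" for n k
    unfolding \<kappa>_def
  proof (rule Least_equality)
    fix k' assume "n < m (Suc k')"
    then have "m k < m (Suc k')" using that by auto
    then show "k \<le> k'" using m(1) by (simp add: strict_mono_less)
  qed (use that in auto)
  have blk: "bij_betw \<pi> {m k..<m (Suc k)} {m k..<m (Suc k)}" for k
    using b(1)[of k] by (subst bij_betw_cong[of _ \<pi> "b k"]) (auto simp: \<pi>_def \<kappa>)
  have init: "bij_betw \<pi> {..<m k} {..<m k}" for k
  proof (induction k)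
    case 0
    then show ?case using m(2) by (simp add: bij_betw_def)
  next
    case (Suc k)
    have "{..<m (Suc k)} = {..<m k} \<union> {m k..<m (Suc k)}"
      using m(1) by (auto simp: strict_mono_Suc_iff less_imp_le intro: less_trans)
    moreover have "bij_betw \<pi> ({..<m k} \<union> {m k..<m (Suc k)}) ({..<m k} \<union> {m k..<m (Suc k)})"
      by (rule bij_betw_combine[OF Suc blk]) auto
    ultimately show ?case by simp
  qed
  have ge: "n < m (Suc n)" for n using strict_mono_imp_increasing[OF m(1), of "Suc n"] by linarith
  have mono: "m i \<le> m j" if "i \<le> j" for i j using m(1) that by (simp add: strict_mono_less_eq)
  have "inj \<pi>"
  proof (rule injI)
    fix x y assume eq: "\<pi> x = \<pi> y"
    have "x \<in> {..<m (Suc (max x y))}" "y \<in> {..<m (Suc (max x y))}"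
      using ge[of x] ge[of y] mono[of "Suc x" "Suc (max x y)"] mono[of "Suc y" "Suc (max x y)"] by auto
    then show "x = y" using init[of "Suc (max x y)"] eq by (auto simp: bij_betw_def inj_on_def)
  qed
  moreover have "surj \<pi>"
  proof -
    have "y \<in> range \<pi>" for y
    proof -
      have "y \<in> \<pi> ` {..<m (Suc y)}" using init[of "Suc y"] ge[of y] by (auto simp: bij_betw_def)
      then show ?thesis by auto
    qed
    then show ?thesis by auto
  qed
  moreover have "\<pi> ` {m k..<m k + card (F k)} = F k" for k
  proof -
    have "card (F k) \<le> card {m k..<m (Suc k)}" by (intro card_mono F) simp
    then have "m k + card (F k) \<le> m (Suc k)"
      using strict_monoD[OF m(1), of k "Suc k"] by simp
    then have "\<pi> ` {m k..<m k + card (F k)} = b k ` {m k..<m k + card (F k)}"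
      by (intro image_cong refl) (auto simp: \<pi>_def intro!: arg_cong[of _ _ "\<lambda>k. b k _"] \<kappa>)
    then show ?thesis using b(2) by simp
  qed
  ultimately show ?thesis by (auto simp: bij_def)
qed

lemma bounded_functional_bound:
  fixes \<phi> :: "('a \<Rightarrow> 'k::{real_normed_field, euclidean_space}) \<Rightarrow> 'k"
  assumes "0 < p" "X \<subseteq> Lp M p" "bounded_functional M p X \<phi>"
  shows "\<exists>C\<ge>0. \<forall>f\<in>X. norm (\<phi> f) \<le> C * pnorm M p f"
proof -
  obtain C where C: "\<And>f. f \<in> X \<Longrightarrow> ennreal (norm (\<phi> f)) \<le> ennreal C * Lnorm M (ennreal p) f"
    using assms(3) unfolding bounded_functional_def by blast
  have "norm (\<phi> f) \<le> max C 0 * pnorm M p f" if "f \<in> X" for f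
  proof -
    have "ennreal (norm (\<phi> f)) \<le> ennreal (max C 0) * ennreal (pnorm M p f)"
      using C[OF that] Lnorm_eq_pnorm[OF assms(1), of f M] that assms(2) by (auto simp: max_def ennreal_neg)
    also have "\<dots> = ennreal (max C 0 * pnorm M p f)" by (simp add: ennreal_mult'')
    finally show ?thesis by (subst (asm) ennreal_le_iff) auto
  qed
  then show ?thesis by (intro exI[of _ "max C 0"]) auto
qed

section \<open>Unconditional sequences\<close>

text \<open>
  Indexed by the natural numbers, an unconditional basis is tested on the permutations of one
  series; the convergence of the expansions contains the density of the span.
\<close>

locale unconditional_sequence =
  fixes M :: "'a measure" and p :: real and X :: "('a \<Rightarrow> 'k::{real_normed_field, euclidean_space}) set"
    and x :: "nat \<Rightarrow> 'a \<Rightarrow> 'k" and xs :: "nat \<Rightarrow> ('a \<Rightarrow> 'k) \<Rightarrow> 'k"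
  assumes p: "1 < p" and X: "closed_subspace M p X" and xX: "\<And>j. x j \<in> X"
    and xs: "\<And>j. bounded_functional M p X (xs j)"
    and biorthogonal: "\<And>j k. xs j (x k) = (if j = k then 1 else 0)"
    and converges: "\<And>f \<pi>. f \<in> X \<Longrightarrow> bij \<pi> \<Longrightarrow>
      (\<lambda>N. pnorm M p (f - (\<Sum>n<N. xs (\<pi> n) f *\<^sub>F x (\<pi> n)))) \<longlonglongrightarrow> 0"
begin

lemma p1: "1 \<le> p" and p0: "0 < p" using p by auto
lemma XL: "X \<subseteq> Lp M p" and subspace: "pw.subspace X" using X by (auto simp: closed_subspace_def)
lemma XLp: "f \<in> X \<Longrightarrow> f \<in> Lp M p" using XL by blast

lemma xL: "x j \<in> Lp M p" by (rule XLp[OF xX])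

lemma xs_add: "f \<in> X \<Longrightarrow> g \<in> X \<Longrightarrow> xs j (f + g) = xs j f + xs j g"
  and xs_scale: "f \<in> X \<Longrightarrow> xs j (c *\<^sub>F f) = c * xs j f"
  using xs[of j] by (auto simp: bounded_functional_def)

lemma xs_sum: "(\<And>i. i \<in> I \<Longrightarrow> f i \<in> X) \<Longrightarrow> xs j (\<Sum>i\<in>I. f i) = (\<Sum>i\<in>I. xs j (f i))"
proof (induction I rule: infinite_finite_induct)
  case (insert i I)
  have "xs j (\<Sum>i\<in>insert i I. f i) = xs j (f i + (\<Sum>i\<in>I. f i))" by (simp only: sum.insert[OF insert(1,2)])
  also have "\<dots> = xs j (f i) + xs j (\<Sum>i\<in>I. f i)"
    using insert(4) by (intro xs_add pw.subspace_sum[OF subspace]) auto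
  also have "xs j (\<Sum>i\<in>I. f i) = (\<Sum>i\<in>I. xs j (f i))" using insert by blast
  also have "xs j (f i) + (\<Sum>i\<in>I. xs j (f i)) = (\<Sum>i\<in>insert i I. xs j (f i))"
    using insert(1,2) by simp
  finally show ?case .
qed (use xs_scale[OF xX, of j 0] in \<open>auto simp: fscale_def zero_fun_def[symmetric]\<close>)

lemma xs_bound: "\<exists>C\<ge>0. \<forall>f\<in>X. norm (xs j f) \<le> C * pnorm M p f"
  by (rule bounded_functional_bound[OF p0 XL xs])

lemma combination_X: "(\<Sum>j\<in>F. c j *\<^sub>F x j) \<in> X"
  using xX by (intro pw.subspace_sum[OF subspace] pw.subspace_scale[OF subspace])

lemma xs_combination:
  assumes "finite F"
  shows "xs k (\<Sum>j\<in>F. c j *\<^sub>F x j) = (if k \<in> F then c k else 0)"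
proof -
  have "xs k (\<Sum>j\<in>F. c j *\<^sub>F x j) = (\<Sum>j\<in>F. xs k (c j *\<^sub>F x j))"
    by (intro xs_sum pw.subspace_scale[OF subspace] xX)
  also have "\<dots> = (\<Sum>j\<in>F. if j = k then c j else 0)"
    by (intro sum.cong refl) (simp add: xs_scale[OF xX] biorthogonal)
  finally show ?thesis using assms by simp
qed

text \<open>
  If the sums over finite sets were unbounded, there would be finite sets with sums of norm at least
  \<open>1\<close> arbitrarily far out; a rearrangement that lists infinitely many of them as blocks diverges.
\<close>

lemma partial_sums_pointwise_bounded:
  assumes f: "f \<in> X"
  shows "\<exists>B. \<forall>F. pnorm M p (\<Sum>j\<in>F. xs j f *\<^sub>F x j) \<le> B"
proof (rule ccontr)
  assume "\<not> ?thesis"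
  then have unbdd: "\<exists>F. pnorm M p (\<Sum>j\<in>F. xs j f *\<^sub>F x j) > B" for B by (meson not_le)
  define z where "z j = xs j f *\<^sub>F x j" for j
  have zL: "z j \<in> Lp M p" for j unfolding z_def by (intro Lp_fscale p0 xL)
  have zsL: "(\<Sum>j\<in>F. z j) \<in> Lp M p" for F by (intro Lp_sum p1 zL)
  have "\<exists>G u. n < u \<and> G \<subseteq> {n..<u} \<and> 1 \<le> pnorm M p (\<Sum>j\<in>G. z j)" for n
  proof -
    define B where "B = (\<Sum>j<n. pnorm M p (z j)) + 1"
    obtain F where F: "B < pnorm M p (\<Sum>j\<in>F. z j)" using unbdd unfolding z_def by blast
    have "0 \<le> B" by (auto simp: B_def intro!: add_nonneg_nonneg sum_nonneg)
    then have fin: "finite F" using F p0 by (cases "finite F") auto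
    have "(\<Sum>j\<in>F. z j) = (\<Sum>j\<in>F \<inter> {..<n}. z j) + (\<Sum>j\<in>F - {..<n}. z j)"
      using fin by (rule sum.Int_Diff)
    then have "pnorm M p (\<Sum>j\<in>F. z j) \<le> pnorm M p (\<Sum>j\<in>F \<inter> {..<n}. z j) + pnorm M p (\<Sum>j\<in>F - {..<n}. z j)"
      using pnorm_triangle[OF p1 zsL zsL] by metis
    also have "pnorm M p (\<Sum>j\<in>F \<inter> {..<n}. z j) \<le> (\<Sum>j\<in>F \<inter> {..<n}. pnorm M p (z j))"
      by (intro pnorm_sum_le p1 zL)
    also have "\<dots> \<le> (\<Sum>j<n. pnorm M p (z j))" by (intro sum_mono2) auto
    finally have "1 \<le> pnorm M p (\<Sum>j\<in>F - {..<n}. z j)" using F by (simp add: B_def)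
    moreover obtain u where "\<forall>j\<in>F. j < u" using fin finite_nat_set_iff_bounded by blast
    then have "F - {..<n} \<subseteq> {n..<max u (Suc n)}" by auto
    ultimately show ?thesis by (intro exI[of _ "F - {..<n}"] exI[of _ "max u (Suc n)"]) auto
  qed
  then obtain G u where u: "\<And>n. n < u n" and G: "\<And>n. G n \<subseteq> {n..<u n}" "\<And>n. 1 \<le> pnorm M p (\<Sum>j\<in>G n. z j)"
    by metis
  define m where "m k = (u ^^ k) 0" for k
  have mS: "m (Suc k) = u (m k)" for k by (simp add: m_def)
  have "strict_mono m" by (rule strict_monoI_Suc) (simp add: mS u)
  moreover have "m 0 = 0" by (simp add: m_def)
  moreover have "G (m k) \<subseteq> {m k..<m (Suc k)}" for k using G(1) by (simp add: mS)
  ultimately obtain \<pi> where \<pi>: "bij \<pi>" "\<And>k. \<pi> ` {m k..<m k + card (G (m k))} = G (m k)"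
    using block_permutation[of m "\<lambda>k. G (m k)"] by blast
  define s where "s N = (\<Sum>n<N. z (\<pi> n))" for N
  have sL: "s N \<in> Lp M p" for N unfolding s_def by (intro Lp_sum p1 zL)
  have jump: "1 \<le> pnorm M p (s (m k + card (G (m k))) - s (m k))" for k
  proof -
    have "s (m k + card (G (m k))) = s (m k) + (\<Sum>n\<in>{m k..<m k + card (G (m k))}. z (\<pi> n))"
      unfolding s_def lessThan_atLeast0 by (rule sum.atLeastLessThan_concat[symmetric]) auto
    moreover have "(\<Sum>n\<in>{m k..<m k + card (G (m k))}. z (\<pi> n)) = (\<Sum>j\<in>G (m k). z j)"
      using sum.reindex[of \<pi> "{m k..<m k + card (G (m k))}" z] \<pi>(2) inj_on_subset[OF bij_is_inj[OF \<pi>(1)]] by auto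
    ultimately have "s (m k + card (G (m k))) - s (m k) = (\<Sum>j\<in>G (m k). z j)" by simp
    then show ?thesis using G(2) by simp
  qed
  have "(\<lambda>N. pnorm M p (f - s N)) \<longlonglongrightarrow> 0"
    using converges[OF f \<pi>(1)] unfolding s_def z_def .
  then have "\<forall>\<^sub>F N in sequentially. pnorm M p (f - s N) < 1/2" by (rule order_tendstoD) simp
  then obtain N where N: "\<And>n. n \<ge> N \<Longrightarrow> pnorm M p (f - s n) < 1/2" by (auto simp: eventually_sequentially)
  have "m N \<ge> N" by (rule strict_mono_imp_increasing[OF \<open>strict_mono m\<close>])
  then have "pnorm M p (f - s (m N)) < 1/2" "pnorm M p (f - s (m N + card (G (m N)))) < 1/2" by (intro N; linarith)+
  then show False
    using jump[of N] pnorm_triangle_diff[OF p1 sL XLp[OF f] sL, of "m N + card (G (m N))" "m N"]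
    by (simp add: pnorm_minus_commute)
qed

theorem partial_sums_bounded: "\<exists>K>0. \<forall>F. \<forall>f\<in>X. pnorm M p (\<Sum>j\<in>F. xs j f *\<^sub>F x j) \<le> K * pnorm M p f"
proof -
  let ?S = "\<lambda>F f. \<Sum>j\<in>F. xs j f *\<^sub>F x j"
  have "\<exists>K. \<forall>F. \<forall>f\<in>X. pnorm M p (?S F f) \<le> K * pnorm M p f"
  proof (rule uniform_boundedness[OF p1 X])
    fix F f g assume fg: "f \<in> X" "g \<in> X"
    have "?S F (f + g) = ?S F f + ?S F g"
      using fg by (simp add: xs_add pw.scale_left_distrib sum.distrib)
    show "pnorm M p (?S F (f + g)) \<le> pnorm M p (?S F f) + pnorm M p (?S F g)"
      unfolding \<open>?S F (f + g) = ?S F f + ?S F g\<close> by (intro pnorm_triangle p1 XLp combination_X)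
  next
    fix F c f assume f: "f \<in> X"
    have "?S F (c *\<^sub>F f) = c *\<^sub>F ?S F f"
      unfolding pw.scale_sum_right using f by (intro sum.cong refl) (simp add: xs_scale)
    then show "pnorm M p (?S F (c *\<^sub>F f)) = norm c * pnorm M p (?S F f)" by (simp add: pnorm_fscale p0)
  next
    fix F
    obtain C where C: "\<And>j. 0 \<le> C j" "\<And>j f. f \<in> X \<Longrightarrow> norm (xs j f) \<le> C j * pnorm M p f"
      using xs_bound by metis
    have "pnorm M p (?S F f) \<le> (\<Sum>j\<in>F. C j * pnorm M p (x j)) * pnorm M p f" if f: "f \<in> X" for f
    proof -
      have "pnorm M p (?S F f) \<le> (\<Sum>j\<in>F. pnorm M p (xs j f *\<^sub>F x j))"
        by (intro pnorm_sum_le p1 Lp_fscale p0 xL)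
      also have "\<dots> \<le> (\<Sum>j\<in>F. C j * pnorm M p f * pnorm M p (x j))"
        unfolding pnorm_fscale[OF p0] using C(2)[OF f] by (intro sum_mono mult_right_mono) auto
      also have "\<dots> = (\<Sum>j\<in>F. C j * pnorm M p (x j)) * pnorm M p f"
        unfolding sum_distrib_right by (simp add: mult_ac)
      finally show ?thesis .
    qed
    then show "\<exists>C. \<forall>f\<in>X. pnorm M p (?S F f) \<le> C * pnorm M p f" by blast
  qed (rule partial_sums_pointwise_bounded)
  then obtain K where K: "\<And>F f. f \<in> X \<Longrightarrow> pnorm M p (?S F f) \<le> K * pnorm M p f" by blast
  have "pnorm M p (?S F f) \<le> max K 1 * pnorm M p f" if "f \<in> X" for F f
    by (rule order_trans[OF K[OF that] mult_right_mono]) auto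
  moreover have "0 < max K 1" by simp
  ultimately show ?thesis by blast
qed

text \<open>
  A change of signs is a difference of two partial sums.
\<close>

theorem sign_changes_bounded:
  "\<exists>K>0. \<forall>A F. \<forall>f\<in>X. finite F \<longrightarrow>
    pnorm M p (\<Sum>j\<in>F. (of_real (rsign A j) * xs j f) *\<^sub>F x j) \<le> K * pnorm M p f"
proof -
  obtain K where K: "0 < K" "\<And>F f. f \<in> X \<Longrightarrow> pnorm M p (\<Sum>j\<in>F. xs j f *\<^sub>F x j) \<le> K * pnorm M p f"
    using partial_sums_bounded by blast
  have "pnorm M p (\<Sum>j\<in>F. (of_real (rsign A j) * xs j f) *\<^sub>F x j) \<le> 2 * K * pnorm M p f"
    if f: "f \<in> X" and F: "finite F" for A F f
  proof -
    let ?z = "\<lambda>j. xs j f *\<^sub>F x j"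
    have "(\<Sum>j\<in>F. (of_real (rsign A j) * xs j f) *\<^sub>F x j)
        = (\<Sum>j\<in>F \<inter> A. (of_real (rsign A j) * xs j f) *\<^sub>F x j) + (\<Sum>j\<in>F - A. (of_real (rsign A j) * xs j f) *\<^sub>F x j)"
      using F by (rule sum.Int_Diff)
    also have "\<dots> = (\<Sum>j\<in>F \<inter> A. ?z j) + (\<Sum>j\<in>F - A. - ?z j)"
      by (intro arg_cong2[where f = "(+)"] sum.cong refl) (auto simp: rsign_def fscale_def fun_eq_iff)
    also have "\<dots> = (\<Sum>j\<in>F \<inter> A. ?z j) + - (\<Sum>j\<in>F - A. ?z j)" by (simp only: sum_negf)
    finally have eq: "(\<Sum>j\<in>F. (of_real (rsign A j) * xs j f) *\<^sub>F x j)
        = (\<Sum>j\<in>F \<inter> A. ?z j) + - (\<Sum>j\<in>F - A. ?z j)" .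
    have "pnorm M p (\<Sum>j\<in>F. (of_real (rsign A j) * xs j f) *\<^sub>F x j)
        \<le> pnorm M p (\<Sum>j\<in>F \<inter> A. ?z j) + pnorm M p (- (\<Sum>j\<in>F - A. ?z j))"
      unfolding eq by (intro pnorm_triangle p1 XLp combination_X pw.subspace_neg[OF subspace])
    also have "\<dots> \<le> K * pnorm M p f + K * pnorm M p f"
      unfolding pnorm_minus by (intro add_mono K f)
    finally show ?thesis by simp
  qed
  moreover have "0 < 2 * K" using K(1) by simp
  ultimately show ?thesis by blast
qed

end

section \<open>Signed sums of functions\<close>

lemma jensen_powr:
  fixes w y :: "'i \<Rightarrow> real"
  assumes "finite F" "1 \<le> r" "\<And>j. j \<in> F \<Longrightarrow> 0 \<le> w j" "\<And>j. j \<in> F \<Longrightarrow> 0 \<le> y j" "(\<Sum>j\<in>F. w j) = 1"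
  shows "(\<Sum>j\<in>F. w j * y j) powr r \<le> (\<Sum>j\<in>F. w j * y j powr r)"
proof -
  have "convex_on {0..} (\<lambda>x::real. x powr r)"
    by (rule convex_onI) (use assms(2) in \<open>auto intro!: powr_convex_weighted\<close>)
  moreover have "F \<noteq> {}" using assms(5) by auto
  ultimately show ?thesis
    using convex_on_sum[of F "{0..}" "\<lambda>x. x powr r" w y] assms by auto
qed

lemma square_powr_half: "0 \<le> v \<Longrightarrow> v\<^sup>2 powr (p / 2) = v powr p" for v p :: real
  using powr_powr[of v 2 "p / 2"] by simp

lemma weighted_jensen_upper:
  fixes u v :: "'i \<Rightarrow> real"
  assumes F: "finite F" and p: "2 \<le> p" and v: "\<And>j. j \<in> F \<Longrightarrow> 0 \<le> v j"
    and s: "s = (\<Sum>j\<in>F. (u j)\<^sup>2)" "0 < s"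
  shows "(\<Sum>j\<in>F. (u j * v j)\<^sup>2) powr (p / 2) \<le> s powr (p / 2 - 1) * (\<Sum>j\<in>F. (u j)\<^sup>2 * v j powr p)"
proof -
  define w where "w j = (u j)\<^sup>2 / s" for j
  have w: "0 \<le> w j" for j using s(2) by (simp add: w_def)
  have w1: "(\<Sum>j\<in>F. w j) = 1" using s by (simp add: w_def sum_divide_distrib[symmetric])
  have "(\<Sum>j\<in>F. (u j * v j)\<^sup>2) = s * (\<Sum>j\<in>F. w j * (v j)\<^sup>2)"
    using s(2) by (simp add: w_def sum_distrib_left power_mult_distrib)
  then have "(\<Sum>j\<in>F. (u j * v j)\<^sup>2) powr (p / 2) = s powr (p / 2) * (\<Sum>j\<in>F. w j * (v j)\<^sup>2) powr (p / 2)"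
    by (simp add: powr_mult)
  also have "\<dots> \<le> s powr (p / 2) * (\<Sum>j\<in>F. w j * ((v j)\<^sup>2) powr (p / 2))"
    using p w w1 F by (intro mult_left_mono jensen_powr) auto
  also have "\<dots> = s powr (p / 2) * (\<Sum>j\<in>F. w j * v j powr p)"
    using v by (intro arg_cong[of _ _ "\<lambda>x. _ * x"] sum.cong refl) (simp add: square_powr_half)
  also have "\<dots> = s powr (p / 2 - 1) * (\<Sum>j\<in>F. (u j)\<^sup>2 * v j powr p)"
    using s(2) by (simp add: w_def sum_distrib_left powr_diff)
  finally show ?thesis .
qed

lemma weighted_jensen_lower:
  fixes u v :: "'i \<Rightarrow> real"
  assumes F: "finite F" and p: "0 < p" "p \<le> 2" and v: "\<And>j. j \<in> F \<Longrightarrow> 0 \<le> v j"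
    and s: "s = (\<Sum>j\<in>F. (u j)\<^sup>2)" "0 < s"
  shows "s powr (p / 2 - 1) * (\<Sum>j\<in>F. (u j)\<^sup>2 * v j powr p) \<le> (\<Sum>j\<in>F. (u j * v j)\<^sup>2) powr (p / 2)"
proof -
  define w where "w j = (u j)\<^sup>2 / s" for j
  have w: "0 \<le> w j" for j using s(2) by (simp add: w_def)
  have w1: "(\<Sum>j\<in>F. w j) = 1" using s by (simp add: w_def sum_divide_distrib[symmetric])
  have nn: "0 \<le> (\<Sum>j\<in>F. w j * v j powr p)" using w by (intro sum_nonneg) auto
  have eq: "(\<Sum>j\<in>F. (u j * v j)\<^sup>2) = s * (\<Sum>j\<in>F. w j * (v j)\<^sup>2)"
    using s(2) by (simp add: w_def sum_distrib_left power_mult_distrib)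
  have "(\<Sum>j\<in>F. w j * v j powr p) powr (2 / p) \<le> (\<Sum>j\<in>F. w j * (v j powr p) powr (2 / p))"
    using p w w1 F by (intro jensen_powr) auto
  also have "\<dots> = (\<Sum>j\<in>F. w j * (v j)\<^sup>2)"
    using v p by (intro sum.cong refl) (simp add: powr_powr)
  finally have "((\<Sum>j\<in>F. w j * v j powr p) powr (2 / p)) powr (p / 2) \<le> (\<Sum>j\<in>F. w j * (v j)\<^sup>2) powr (p / 2)"
    using p by (intro powr_mono2) auto
  then have "s powr (p / 2) * (\<Sum>j\<in>F. w j * v j powr p) \<le> s powr (p / 2) * (\<Sum>j\<in>F. w j * (v j)\<^sup>2) powr (p / 2)"
    using p nn by (intro mult_left_mono) (auto simp: powr_powr)
  also have "\<dots> = (\<Sum>j\<in>F. (u j * v j)\<^sup>2) powr (p / 2)" unfolding eq by (simp add: powr_mult)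
  also have "s powr (p / 2) * (\<Sum>j\<in>F. w j * v j powr p) = s powr (p / 2 - 1) * (\<Sum>j\<in>F. (u j)\<^sup>2 * v j powr p)"
    using s(2) by (simp add: w_def sum_distrib_left powr_diff)
  finally show ?thesis .
qed

definition signed_sum :: "'i set \<Rightarrow> ('i \<Rightarrow> 'k::real_normed_field) \<Rightarrow> ('i \<Rightarrow> 'a \<Rightarrow> 'k) \<Rightarrow> 'i set \<Rightarrow> 'a \<Rightarrow> 'k" where
  "signed_sum F a x A = (\<Sum>j\<in>F. (of_real (rsign A j) * a j) *\<^sub>F x j)"

lemma sum_apply: "(\<Sum>j\<in>F. f j) t = (\<Sum>j\<in>F. f j t)" for f :: "'i \<Rightarrow> 'a \<Rightarrow> 'k::comm_monoid_add"
  by (induction F rule: infinite_finite_induct) auto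

lemma signed_sum_apply: "signed_sum F a x A t = (\<Sum>j\<in>F. rsign A j *\<^sub>R (a j * x j t))"
  unfolding signed_sum_def sum_apply by (simp add: fscale_def scaleR_conv_of_real mult.assoc)

lemma signed_sum_Lp:
  fixes x :: "'i \<Rightarrow> 'a \<Rightarrow> 'k::{real_normed_field, euclidean_space}"
  assumes "1 \<le> p" "\<And>j. j \<in> F \<Longrightarrow> x j \<in> Lp M p"
  shows "signed_sum F a x A \<in> Lp M p"
  unfolding signed_sum_def using assms by (intro Lp_sum Lp_fscale) auto

lemma signed_sum_second_moment:
  fixes x :: "'i \<Rightarrow> 'a \<Rightarrow> 'k::{real_normed_field, euclidean_space}"
  assumes F: "finite F" and x: "\<And>j. j \<in> F \<Longrightarrow> x j \<in> Lp M 2"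
  shows "(\<Sum>A\<in>Pow F. \<integral>t. norm (signed_sum F a x A t) powr 2 \<partial>M)
    = 2 ^ card F * (\<Sum>j\<in>F. (norm (a j))\<^sup>2 * (\<integral>t. norm (x j t) powr 2 \<partial>M))"
proof -
  have i: "integrable M (\<lambda>t. norm (signed_sum F a x A t) powr 2)" for A
    by (rule Lp_integrable[OF _ signed_sum_Lp]) (auto intro: x)
  have ix: "integrable M (\<lambda>t. norm (x j t) powr 2)" if "j \<in> F" for j
    by (rule Lp_integrable[OF _ x[OF that]]) simp
  have "(\<Sum>A\<in>Pow F. \<integral>t. norm (signed_sum F a x A t) powr 2 \<partial>M)
      = (\<integral>t. (\<Sum>A\<in>Pow F. norm (signed_sum F a x A t) powr 2) \<partial>M)"
    using i by (intro Bochner_Integration.integral_sum[symmetric])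
  also have "\<dots> = (\<integral>t. 2 ^ card F * (\<Sum>j\<in>F. (norm (a j))\<^sup>2 * norm (x j t) powr 2) \<partial>M)"
  proof (intro Bochner_Integration.integral_cong refl)
    fix t
    have "(\<Sum>A\<in>Pow F. norm (signed_sum F a x A t) powr 2)
        = (\<Sum>A\<in>Pow F. (norm (\<Sum>j\<in>F. rsign A j *\<^sub>R (a j * x j t)))\<^sup>2)"
      unfolding signed_sum_apply by simp
    also have "\<dots> = 2 ^ card F * (\<Sum>j\<in>F. (norm (a j * x j t))\<^sup>2)"
      by (rule rademacher_second_moment[OF F])
    finally show "(\<Sum>A\<in>Pow F. norm (signed_sum F a x A t) powr 2)
        = 2 ^ card F * (\<Sum>j\<in>F. (norm (a j))\<^sup>2 * norm (x j t) powr 2)"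
      by (simp add: norm_mult power_mult_distrib)
  qed
  also have "\<dots> = 2 ^ card F * (\<Sum>j\<in>F. (norm (a j))\<^sup>2 * (\<integral>t. norm (x j t) powr 2 \<partial>M))"
    using ix by simp
  finally show ?thesis .
qed

text \<open>
  Khintchine's inequality at each point, and then Jensen's inequality with the weights
  \<open>|a\<^sub>j|\<^sup>2 / \<Sum> |a\<^sub>i|\<^sup>2\<close>, which replaces \<open>L\<^sub>p\<close>-norms of a square function by those of the single functions.
\<close>

lemma signed_sum_upper:
  assumes p: "2 \<le> p"
  shows "\<exists>C. 0 < C \<and> (\<forall>M F a (x :: 'i \<Rightarrow> 'a \<Rightarrow> 'k::{real_normed_field, euclidean_space}) B.
    finite F \<longrightarrow> 0 \<le> B \<longrightarrow> (\<forall>j\<in>F. x j \<in> Lp M p) \<longrightarrow> (\<forall>j\<in>F. pnorm M p (x j) \<le> B) \<longrightarrow>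
    (\<Sum>A\<in>Pow F. \<integral>t. norm (signed_sum F a x A t) powr p \<partial>M)
      \<le> C * 2 ^ card F * B powr p * (\<Sum>j\<in>F. (norm (a j))\<^sup>2) powr (p / 2))"
proof -
  have p0: "0 < p" "1 \<le> p" using p by auto
  obtain C where C: "0 < C" "\<And>F (b :: 'i \<Rightarrow> 'k). finite F \<Longrightarrow>
      (\<Sum>A\<in>Pow F. norm (\<Sum>j\<in>F. rsign A j *\<^sub>R b j) powr p)
      \<le> C * 2 ^ card F * (\<Sum>j\<in>F. (norm (b j))\<^sup>2) powr (p / 2)"
    using khintchine_upper[of p, where 'i = 'i and 'v = 'k] p0 by auto
  have "(\<Sum>A\<in>Pow F. \<integral>t. norm (signed_sum F a x A t) powr p \<partial>M)
      \<le> C * 2 ^ card F * B powr p * (\<Sum>j\<in>F. (norm (a j))\<^sup>2) powr (p / 2)"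
    if F: "finite F" and B: "0 \<le> B" and x: "\<And>j. j \<in> F \<Longrightarrow> x j \<in> Lp M p" "\<And>j. j \<in> F \<Longrightarrow> pnorm M p (x j) \<le> B"
    for M and F and a and x :: "'i \<Rightarrow> 'a \<Rightarrow> 'k" and B
  proof -
    define s where "s = (\<Sum>j\<in>F. (norm (a j))\<^sup>2)"
    have i: "integrable M (\<lambda>t. norm (signed_sum F a x A t) powr p)" for A
      by (rule Lp_integrable[OF p0(1) signed_sum_Lp[OF p0(2)]]) (rule x)
    have ix: "integrable M (\<lambda>t. norm (x j t) powr p)" if "j \<in> F" for j
      by (rule Lp_integrable[OF p0(1) x(1)[OF that]])
    show ?thesis
    proof (cases "s = 0")
      case True
      then have a0: "\<forall>j\<in>F. a j = 0" using F by (simp add: s_def sum_nonneg_eq_0_iff)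
      have "norm (signed_sum F a x A t) powr p = 0" for A t unfolding signed_sum_apply using a0 by simp
      then show ?thesis using True C B unfolding s_def by simp
    next
      case False
      then have s: "0 < s" by (simp add: s_def sum_nonneg order_less_le)
      have "(\<Sum>A\<in>Pow F. \<integral>t. norm (signed_sum F a x A t) powr p \<partial>M)
          = (\<integral>t. (\<Sum>A\<in>Pow F. norm (signed_sum F a x A t) powr p) \<partial>M)"
        using i by (intro Bochner_Integration.integral_sum[symmetric])
      also have "\<dots> \<le> (\<integral>t. C * 2 ^ card F * (s powr (p / 2 - 1) * (\<Sum>j\<in>F. (norm (a j))\<^sup>2 * norm (x j t) powr p)) \<partial>M)"
      proof (rule integral_mono)
        fix t
        have "(\<Sum>A\<in>Pow F. norm (signed_sum F a x A t) powr p)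
            \<le> C * 2 ^ card F * (\<Sum>j\<in>F. (norm (a j * x j t))\<^sup>2) powr (p / 2)"
          unfolding signed_sum_apply by (rule C(2)[OF F])
        also have "\<dots> \<le> C * 2 ^ card F * (s powr (p / 2 - 1) * (\<Sum>j\<in>F. (norm (a j))\<^sup>2 * norm (x j t) powr p))"
          unfolding norm_mult using C(1) F p s by (intro mult_left_mono weighted_jensen_upper) (auto simp: s_def)
        finally show "(\<Sum>A\<in>Pow F. norm (signed_sum F a x A t) powr p) \<le> \<dots>" .
      qed (use i ix in auto)
      also have "\<dots> = C * 2 ^ card F * (s powr (p / 2 - 1) * (\<Sum>j\<in>F. (norm (a j))\<^sup>2 * (\<integral>t. norm (x j t) powr p \<partial>M)))"
        using ix by simp
      also have "\<dots> \<le> C * 2 ^ card F * (s powr (p / 2 - 1) * (\<Sum>j\<in>F. (norm (a j))\<^sup>2 * B powr p))"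
        using C(1) x(2) B by (intro mult_left_mono sum_mono) (auto simp: pnorm_le_iff[OF p0(1), symmetric])
      also have "\<dots> = C * 2 ^ card F * B powr p * s powr (p / 2)"
        using s by (simp add: sum_distrib_right[symmetric] s_def[symmetric] powr_diff)
      finally show ?thesis unfolding s_def .
    qed
  qed
  with C(1) show ?thesis by (intro exI[of _ C] conjI allI impI) simp_all
qed

lemma signed_sum_lower:
  assumes p: "1 \<le> p" "p \<le> 2"
  shows "\<exists>c. 0 < c \<and> (\<forall>M F a (x :: 'i \<Rightarrow> 'a \<Rightarrow> 'k::{real_normed_field, euclidean_space}) b.
    finite F \<longrightarrow> 0 \<le> b \<longrightarrow> (\<forall>j\<in>F. x j \<in> Lp M p) \<longrightarrow> (\<forall>j\<in>F. b \<le> pnorm M p (x j)) \<longrightarrow>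
    c * 2 ^ card F * b powr p * (\<Sum>j\<in>F. (norm (a j))\<^sup>2) powr (p / 2)
      \<le> (\<Sum>A\<in>Pow F. \<integral>t. norm (signed_sum F a x A t) powr p \<partial>M))"
proof -
  have p0: "0 < p" using p by auto
  obtain c where c: "0 < c" "\<And>F (b :: 'i \<Rightarrow> 'k). finite F \<Longrightarrow>
      c * 2 ^ card F * (\<Sum>j\<in>F. (norm (b j))\<^sup>2) powr (p / 2)
      \<le> (\<Sum>A\<in>Pow F. norm (\<Sum>j\<in>F. rsign A j *\<^sub>R b j) powr p)"
    using khintchine_lower[of p, where 'i = 'i and 'v = 'k] p by auto
  have "c * 2 ^ card F * b powr p * (\<Sum>j\<in>F. (norm (a j))\<^sup>2) powr (p / 2)
      \<le> (\<Sum>A\<in>Pow F. \<integral>t. norm (signed_sum F a x A t) powr p \<partial>M)"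
    if F: "finite F" and b: "0 \<le> b" and x: "\<And>j. j \<in> F \<Longrightarrow> x j \<in> Lp M p" "\<And>j. j \<in> F \<Longrightarrow> b \<le> pnorm M p (x j)"
    for M and F and a and x :: "'i \<Rightarrow> 'a \<Rightarrow> 'k" and b
  proof -
    define s where "s = (\<Sum>j\<in>F. (norm (a j))\<^sup>2)"
    have i: "integrable M (\<lambda>t. norm (signed_sum F a x A t) powr p)" for A
      by (rule Lp_integrable[OF p0 signed_sum_Lp[OF p(1)]]) (rule x)
    have ix: "integrable M (\<lambda>t. norm (x j t) powr p)" if "j \<in> F" for j
      by (rule Lp_integrable[OF p0 x(1)[OF that]])
    show ?thesis
    proof (cases "s = 0")
      case True
      then show ?thesis unfolding s_def by (simp add: sum_nonneg)
    next
      case False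
      then have s: "0 < s" by (simp add: s_def sum_nonneg order_less_le)
      have "c * 2 ^ card F * b powr p * s powr (p / 2)
          = c * 2 ^ card F * (s powr (p / 2 - 1) * (\<Sum>j\<in>F. (norm (a j))\<^sup>2 * b powr p))"
        using s by (simp add: sum_distrib_right[symmetric] s_def[symmetric] powr_diff)
      also have "\<dots> \<le> c * 2 ^ card F * (s powr (p / 2 - 1) * (\<Sum>j\<in>F. (norm (a j))\<^sup>2 * (\<integral>t. norm (x j t) powr p \<partial>M)))"
        using c(1) x(2) b p0 by (intro mult_left_mono sum_mono) (auto simp: pnorm_powr[symmetric] intro!: powr_mono2)
      also have "\<dots> = (\<integral>t. c * 2 ^ card F * (s powr (p / 2 - 1) * (\<Sum>j\<in>F. (norm (a j))\<^sup>2 * norm (x j t) powr p)) \<partial>M)"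
        using ix by simp
      also have "\<dots> \<le> (\<integral>t. (\<Sum>A\<in>Pow F. norm (signed_sum F a x A t) powr p) \<partial>M)"
      proof (rule integral_mono)
        fix t
        have "c * 2 ^ card F * (s powr (p / 2 - 1) * (\<Sum>j\<in>F. (norm (a j))\<^sup>2 * norm (x j t) powr p))
            \<le> c * 2 ^ card F * (\<Sum>j\<in>F. (norm (a j * x j t))\<^sup>2) powr (p / 2)"
          unfolding norm_mult using c(1) F p0 p(2) s by (intro mult_left_mono weighted_jensen_lower) (auto simp: s_def)
        also have "\<dots> \<le> (\<Sum>A\<in>Pow F. norm (signed_sum F a x A t) powr p)"
          unfolding signed_sum_apply by (rule c(2)[OF F])
        finally show "c * 2 ^ card F * (s powr (p / 2 - 1) * (\<Sum>j\<in>F. (norm (a j))\<^sup>2 * norm (x j t) powr p)) \<le> \<dots>" .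
      qed (use i ix in auto)
      also have "\<dots> = (\<Sum>A\<in>Pow F. \<integral>t. norm (signed_sum F a x A t) powr p \<partial>M)"
        using i by (intro Bochner_Integration.integral_sum)
      finally show ?thesis unfolding s_def .
    qed
  qed
  with c(1) show ?thesis by (intro exI[of _ c] conjI allI impI) simp_all
qed

section \<open>Comparison of norms over a finite measure\<close>

lemma powr_le_powr_scaled:
  fixes u l r s :: real
  assumes "0 < l" "0 \<le> u" "0 < r" "r \<le> s"
  shows "u powr r \<le> l powr r + l powr (r - s) * u powr s"
proof (cases "u \<le> l")
  case True
  then have "u powr r \<le> l powr r" using assms by (intro powr_mono2) auto
  then show ?thesis by (simp add: add_increasing2)
next
  case False
  then have "u powr r = u powr (r - s) * u powr s" using assms by (simp add: powr_add[symmetric])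
  also have "\<dots> \<le> l powr (r - s) * u powr s"
    using False assms by (intro mult_right_mono powr_mono2') auto
  finally show ?thesis by (simp add: add_increasing)
qed

lemma (in finite_measure) lower_power_integral:
  fixes f :: "'a \<Rightarrow> 'k::{real_normed_field, euclidean_space}"
  assumes r: "0 < r" "r \<le> s" and f: "f \<in> Lp M s" and l: "0 < l"
  shows "f \<in> Lp M r"
    and "(\<integral>t. norm (f t) powr r \<partial>M) \<le> l powr r * measure M (space M) + l powr (r - s) * (\<integral>t. norm (f t) powr s \<partial>M)"
proof -
  have s0: "0 < s" using r by simp
  have [measurable]: "f \<in> borel_measurable M" using f by (rule Lp_measurable)
  have i_s: "integrable M (\<lambda>t. norm (f t) powr s)" by (rule Lp_integrable[OF s0 f])
  have le: "norm (f t) powr r \<le> l powr r + l powr (r - s) * norm (f t) powr s" for t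
    using l r by (intro powr_le_powr_scaled) auto
  have ir: "integrable M (\<lambda>t. norm (f t) powr r)"
    by (rule Bochner_Integration.integrable_bound[of M "\<lambda>t. l powr r + l powr (r - s) * norm (f t) powr s"])
      (use i_s le in \<open>auto intro!: AE_I2 order_trans[OF le]\<close>)
  then show "f \<in> Lp M r" by (simp add: Lp_iff r)
  have "(\<integral>t. norm (f t) powr r \<partial>M) \<le> (\<integral>t. l powr r + l powr (r - s) * norm (f t) powr s \<partial>M)"
    using ir i_s le by (intro integral_mono) auto
  also have "\<dots> = l powr r * measure M (space M) + l powr (r - s) * (\<integral>t. norm (f t) powr s \<partial>M)"
    using i_s by simp
  finally show "(\<integral>t. norm (f t) powr r \<partial>M) \<le> \<dots>" .
qed

lemma (in finite_measure) lower_power_integral_le: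
  fixes f :: "'a \<Rightarrow> 'k::{real_normed_field, euclidean_space}"
  assumes r: "0 < r" "r \<le> s" and f: "f \<in> Lp M s" and le: "pnorm M s f \<le> l"
  shows "(\<integral>t. norm (f t) powr r \<partial>M) \<le> (measure M (space M) + 1) * l powr r"
proof (cases "l = 0")
  case True
  then have "pnorm M s f = 0" using le pnorm_nonneg[of M s f] by linarith
  then have "AE t in M. f t = 0" using pnorm_eq_0_iff[of s f M] r f by simp
  then have "AE t in M. norm (f t) powr r = 0" by eventually_elim (simp)
  then have "(\<integral>t. norm (f t) powr r \<partial>M) = 0" by (intro integral_eq_zero_AE)
  then show ?thesis using True by simp
next
  case False
  then have l: "0 < l" using le pnorm_nonneg[of M s f] by linarith
  have "(\<integral>t. norm (f t) powr r \<partial>M) \<le> l powr r * measure M (space M) + l powr (r - s) * (\<integral>t. norm (f t) powr s \<partial>M)"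
    by (rule lower_power_integral[OF r f l])
  also have "\<dots> \<le> l powr r * measure M (space M) + l powr (r - s) * l powr s"
    using le l r by (intro add_left_mono mult_left_mono) (auto simp: pnorm_le_iff)
  also have "\<dots> = (measure M (space M) + 1) * l powr r" using l by (simp add: powr_add[symmetric] algebra_simps)
  finally show ?thesis .
qed

lemma powr_le_square_interpolation:
  fixes u e k r s :: real
  assumes u: "0 \<le> u" and e: "0 < e" and k: "0 < k" and r: "0 < r" "r < s"
  shows "u powr r \<le> e powr r + k powr r / e\<^sup>2 * u powr 2 + k powr (r - s) * u powr s"
proof -
  have nn: "0 \<le> k powr r / e\<^sup>2 * u powr 2" "0 \<le> e powr r" "0 \<le> k powr (r - s) * u powr s" by auto
  consider "u \<le> e" | "e < u" "u \<le> k" | "k < u" by linarith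
  then show ?thesis
  proof cases
    case 1
    then have "u powr r \<le> e powr r" using u r by (intro powr_mono2) auto
    then show ?thesis using nn by linarith
  next
    case 2
    have "u powr r \<le> k powr r * 1" using 2 u r by (simp add: powr_mono2)
    also have "\<dots> \<le> k powr r * (u powr 2 / e\<^sup>2)"
      using 2 e u by (intro mult_left_mono) (auto simp: power_mono)
    finally have "u powr r \<le> k powr r / e\<^sup>2 * u powr 2" by simp
    then show ?thesis using nn by linarith
  next
    case 3
    then have "u powr r = u powr (r - s) * u powr s" using k by (simp add: powr_add[symmetric])
    moreover have "u powr (r - s) * u powr s \<le> k powr (r - s) * u powr s"
      using 3 k r by (intro mult_right_mono powr_mono2') auto
    ultimately show ?thesis using nn by linarith
  qed
qed

text \<open>
  Non-concentration: mass in \<open>L\<^sub>r\<close> can neither sit where \<open>f\<close> is small, because the measure is finite,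
  nor where \<open>f\<close> is large, because \<open>f\<close> is bounded in \<open>L\<^sub>s\<close>.  In between, \<open>|f|\<^sup>r\<close> is comparable to \<open>|f|\<^sup>2\<close>.
\<close>

lemma (in finite_measure) second_moment_lower_bound:
  fixes c C r s :: real
  assumes r: "0 < r" "r < s" and c: "0 < c" and C: "0 \<le> C"
  shows "\<exists>d>0. \<forall>f :: 'a \<Rightarrow> 'k::{real_normed_field, euclidean_space}.
    f \<in> Lp M s \<and> f \<in> Lp M 2 \<and> (\<integral>t. norm (f t) powr s \<partial>M) \<le> C \<and> c \<le> (\<integral>t. norm (f t) powr r \<partial>M)
    \<longrightarrow> d \<le> (\<integral>t. norm (f t) powr 2 \<partial>M)"
proof -
  define \<mu> where "\<mu> = measure M (space M)"
  have \<mu>: "0 \<le> \<mu>" by (simp add: \<mu>_def)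
  \<comment> \<open>The thresholds \<open>e\<close> and \<open>k\<close> each lose at most a quarter of the mass \<open>c\<close>.\<close>
  define e where "e = (c / (4 * (\<mu> + 1))) powr (1 / r)"
  have e: "0 < e" "e powr r * \<mu> \<le> c / 4"
  proof -
    show "0 < e" using c \<mu> by (simp add: e_def)
    have "e powr r = c / (4 * (\<mu> + 1))" using c \<mu> r by (simp add: e_def powr_powr)
    moreover have "c * \<mu> \<le> c / 4 * (4 * (\<mu> + 1))" using c by (simp add: algebra_simps)
    ultimately show "e powr r * \<mu> \<le> c / 4" using \<mu> by (simp add: pos_divide_le_eq)
  qed
  define k where "k = (c / (4 * (C + 1))) powr (1 / (r - s))"
  have k: "0 < k" "k powr (r - s) * C \<le> c / 4"
  proof -
    show "0 < k" using c C by (simp add: k_def)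
    have "k powr (r - s) = c / (4 * (C + 1))" using c C r by (simp add: k_def powr_powr)
    moreover have "c * C \<le> c / 4 * (4 * (C + 1))" using c by (simp add: algebra_simps)
    ultimately show "k powr (r - s) * C \<le> c / 4" using C by (simp add: pos_divide_le_eq)
  qed
  define D where "D = k powr r / e\<^sup>2"
  have D: "0 < D" using k e by (simp add: D_def)
  have "c / 2 / D \<le> (\<integral>t. norm (f t) powr 2 \<partial>M)"
    if f: "f \<in> Lp M s" "f \<in> Lp M 2" "(\<integral>t. norm (f t) powr s \<partial>M) \<le> C" "c \<le> (\<integral>t. norm (f t) powr r \<partial>M)"
    for f :: "'a \<Rightarrow> 'k"
  proof -
    have i: "integrable M (\<lambda>t. norm (f t) powr s)" "integrable M (\<lambda>t. norm (f t) powr 2)"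
      "integrable M (\<lambda>t. norm (f t) powr r)"
      using Lp_integrable[OF _ f(1)] Lp_integrable[OF _ f(2)] Lp_integrable[OF r(1) lower_power_integral(1)[OF r(1) _ f(1) zero_less_one]] r by auto
    have "c \<le> (\<integral>t. norm (f t) powr r \<partial>M)" by (rule f(4))
    also have "\<dots> \<le> (\<integral>t. e powr r + D * norm (f t) powr 2 + k powr (r - s) * norm (f t) powr s \<partial>M)"
      using i e k r unfolding D_def by (intro integral_mono powr_le_square_interpolation) auto
    also have "\<dots> = e powr r * \<mu> + D * (\<integral>t. norm (f t) powr 2 \<partial>M) + k powr (r - s) * (\<integral>t. norm (f t) powr s \<partial>M)"
      using i by (simp add: \<mu>_def)
    also have "k powr (r - s) * (\<integral>t. norm (f t) powr s \<partial>M) \<le> k powr (r - s) * C"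
      by (intro mult_left_mono f) auto
    finally have "c / 2 \<le> D * (\<integral>t. norm (f t) powr 2 \<partial>M)" using e(2) k(2) by linarith
    then show ?thesis using D by (simp add: field_simps)
  qed
  moreover have "0 < c / 2 / D" using c D by simp
  ultimately show ?thesis by blast
qed

section \<open>Estimates by the square-summable norm of the coefficients\<close>

lemma square_le_of_powr_le:
  fixes u D s p :: real
  assumes "0 < p" "0 \<le> u" "0 \<le> D" "0 \<le> s" "u powr p \<le> D * s powr (p / 2)"
  shows "u\<^sup>2 \<le> D powr (2 / p) * s"
proof -
  have "(u powr p) powr (2 / p) \<le> (D * s powr (p / 2)) powr (2 / p)"
    using assms by (intro powr_mono2) auto
  then show ?thesis using assms by (simp add: powr_powr powr_mult)
qed

lemma le_square_of_powr_le:
  fixes u D s p :: real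
  assumes "0 < p" "0 \<le> u" "0 \<le> D" "0 \<le> s" "s powr (p / 2) \<le> D * u powr p"
  shows "s \<le> D powr (2 / p) * u\<^sup>2"
proof -
  have "(s powr (p / 2)) powr (2 / p) \<le> (D * u powr p) powr (2 / p)"
    using assms by (intro powr_mono2) auto
  then show ?thesis using assms by (simp add: powr_powr powr_mult)
qed

context unconditional_sequence
begin

lemma signed_sum_X: "signed_sum F a x A \<in> X"
  unfolding signed_sum_def by (rule combination_X)

lemma xs_signed_sum:
  "finite F \<Longrightarrow> k \<in> F \<Longrightarrow> xs k (signed_sum F a x A) = of_real (rsign A k) * a k"
  unfolding signed_sum_def by (simp add: xs_combination)

text \<open>
  The second inequality is the first one for the signed sum itself, since changing the same signs
  twice changes nothing.
\<close>

lemma signed_sum_comparable: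
  obtains K where "0 < K"
    "\<And>A F f. f \<in> X \<Longrightarrow> finite F \<Longrightarrow> pnorm M p (signed_sum F (\<lambda>j. xs j f) x A) \<le> K * pnorm M p f"
    "\<And>A F a. finite F \<Longrightarrow> pnorm M p (\<Sum>j\<in>F. a j *\<^sub>F x j) \<le> K * pnorm M p (signed_sum F a x A)"
proof -
  obtain K where K: "0 < K" and *: "\<And>A F f. f \<in> X \<Longrightarrow> finite F \<Longrightarrow>
      pnorm M p (signed_sum F (\<lambda>j. xs j f) x A) \<le> K * pnorm M p f"
    using sign_changes_bounded unfolding signed_sum_def by blast
  have "pnorm M p (\<Sum>j\<in>F. a j *\<^sub>F x j) \<le> K * pnorm M p (signed_sum F a x A)"
    if F: "finite F" for A F a
  proof -
    have "signed_sum F (\<lambda>j. xs j (signed_sum F a x A)) x A = (\<Sum>j\<in>F. a j *\<^sub>F x j)"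
      unfolding signed_sum_def[of F "\<lambda>j. xs j (signed_sum F a x A)"]
    proof (intro sum.cong refl)
      fix j assume "j \<in> F"
      then have "of_real (rsign A j) * xs j (signed_sum F a x A) = of_real (rsign A j * rsign A j) * a j"
        by (simp only: xs_signed_sum[OF F] of_real_mult mult.assoc)
      then show "(of_real (rsign A j) * xs j (signed_sum F a x A)) *\<^sub>F x j = a j *\<^sub>F x j"
        by (simp only: rsign_square of_real_1 mult_1)
    qed
    then show ?thesis using *[OF signed_sum_X F, of F a A A] by (simp only:)
  qed
  with K * show thesis by (rule that)
qed

text \<open>
  For \<open>p \<ge> 2\<close> the space \<open>L\<^sub>p\<close> has type 2, which gives the upper estimate.  The lower one is obtained in
  \<open>L\<^sub>2\<close>, whose norm is dominated by that of \<open>L\<^sub>p\<close>.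
\<close>

theorem l2_estimates_above_2:
  assumes "finite_measure M" and p2: "2 \<le> p"
    and B: "\<And>j. pnorm M p (x j) \<le> B"
    and d: "0 < d" "\<And>j. d \<le> (\<integral>t. norm (x j t) powr 2 \<partial>M)"
  shows "\<exists>C\<ge>0. \<forall>F f. finite F \<and> f \<in> X \<longrightarrow>
    (\<Sum>j\<in>F. (norm (xs j f))\<^sup>2) \<le> C * (pnorm M p f)\<^sup>2 \<and>
    (pnorm M p (\<Sum>j\<in>F. xs j f *\<^sub>F x j))\<^sup>2 \<le> C * (\<Sum>j\<in>F. (norm (xs j f))\<^sup>2)"
proof -
  interpret finite_measure M by fact
  have B0: "0 \<le> B" using order_trans[OF pnorm_nonneg B] .
  have xL2: "x j \<in> Lp M 2" for j
    by (rule lower_power_integral(1)[OF _ p2 xL zero_less_one]) simp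
  obtain K where K: "0 < K"
    and K1: "\<And>A F f. f \<in> X \<Longrightarrow> finite F \<Longrightarrow> pnorm M p (signed_sum F (\<lambda>j. xs j f) x A) \<le> K * pnorm M p f"
    and K2: "\<And>A F a. finite F \<Longrightarrow> pnorm M p (\<Sum>j\<in>F. a j *\<^sub>F x j) \<le> K * pnorm M p (signed_sum F a x A)"
    by (rule signed_sum_comparable, rule that)
  obtain C where C: "0 < C" "\<forall>(M :: 'a measure) F a (x :: nat \<Rightarrow> 'a \<Rightarrow> 'k) B.
    finite F \<longrightarrow> 0 \<le> B \<longrightarrow> (\<forall>j\<in>F. x j \<in> Lp M p) \<longrightarrow> (\<forall>j\<in>F. pnorm M p (x j) \<le> B) \<longrightarrow>
    (\<Sum>A\<in>Pow F. \<integral>t. norm (signed_sum F a x A t) powr p \<partial>M)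
      \<le> C * 2 ^ card F * B powr p * (\<Sum>j\<in>F. (norm (a j))\<^sup>2) powr (p / 2)"
    using signed_sum_upper[OF p2] by (elim exE conjE) (rule that)
  define D where "D = K powr p * C * B powr p"
  have D: "0 \<le> D" using C(1) by (simp add: D_def)
  define \<mu> where "\<mu> = measure M (space M) + 1"
  have \<mu>: "0 < \<mu>" by (simp add: \<mu>_def add_nonneg_pos)
  have upper: "(pnorm M p (\<Sum>j\<in>F. a j *\<^sub>F x j))\<^sup>2 \<le> D powr (2 / p) * (\<Sum>j\<in>F. (norm (a j))\<^sup>2)"
    if F: "finite F" for F a
  proof (rule square_le_of_powr_le[OF p0 pnorm_nonneg D])
    let ?N = "pnorm M p (\<Sum>j\<in>F. a j *\<^sub>F x j)" and ?s = "\<Sum>j\<in>F. (norm (a j))\<^sup>2"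
    have "2 ^ card F * ?N powr p = (\<Sum>A\<in>Pow F. ?N powr p)" using F by (simp add: card_Pow)
    also have "\<dots> \<le> (\<Sum>A\<in>Pow F. K powr p * (\<integral>t. norm (signed_sum F a x A t) powr p \<partial>M))"
    proof (rule sum_mono)
      fix A
      have "?N powr p \<le> (K * pnorm M p (signed_sum F a x A)) powr p"
        using p0 K2[OF F] by (intro powr_mono2) auto
      also have "\<dots> = K powr p * (\<integral>t. norm (signed_sum F a x A t) powr p \<partial>M)"
        by (simp only: powr_mult pnorm_powr[OF p0])
      finally show "?N powr p \<le> \<dots>" .
    qed
    also have "\<dots> = K powr p * (\<Sum>A\<in>Pow F. \<integral>t. norm (signed_sum F a x A t) powr p \<partial>M)"
      by (rule sum_distrib_left[symmetric])
    also have "\<dots> \<le> K powr p * (C * 2 ^ card F * B powr p * ?s powr (p / 2))"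
      by (intro mult_left_mono C(2)[rule_format, OF F B0] xL B) auto
    finally have "2 ^ card F * ?N powr p \<le> 2 ^ card F * (D * ?s powr (p / 2))" by (simp add: D_def mult_ac)
    then show "?N powr p \<le> D * ?s powr (p / 2)" by (rule mult_left_le_imp_le) simp
  qed (auto intro: sum_nonneg)
  have lower: "(\<Sum>j\<in>F. (norm (xs j f))\<^sup>2) \<le> \<mu> * K\<^sup>2 / d * (pnorm M p f)\<^sup>2"
    if F: "finite F" and f: "f \<in> X" for F f
  proof -
    let ?s = "\<Sum>j\<in>F. (norm (xs j f))\<^sup>2" and ?N = "pnorm M p f"
    have "2 ^ card F * (?s * d) \<le> 2 ^ card F * (\<Sum>j\<in>F. (norm (xs j f))\<^sup>2 * (\<integral>t. norm (x j t) powr 2 \<partial>M))"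
      unfolding sum_distrib_right by (intro mult_left_mono sum_mono d) auto
    also have "\<dots> = (\<Sum>A\<in>Pow F. \<integral>t. norm (signed_sum F (\<lambda>j. xs j f) x A t) powr 2 \<partial>M)"
      by (rule signed_sum_second_moment[OF F xL2, symmetric])
    also have "\<dots> \<le> (\<Sum>A\<in>Pow F. \<mu> * (K * ?N) powr 2)"
      unfolding \<mu>_def
      by (intro sum_mono lower_power_integral_le[OF _ p2 XLp[OF signed_sum_X] K1[OF f F]]) simp
    also have "\<dots> = 2 ^ card F * (\<mu> * (K * ?N) powr 2)" using F by (simp add: card_Pow)
    finally have "?s * d \<le> \<mu> * (K * ?N) powr 2" by (rule mult_left_le_imp_le) simp
    also have "(K * ?N) powr 2 = K\<^sup>2 * ?N\<^sup>2" using K by (simp add: power_mult_distrib)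
    finally show ?thesis using d(1) by (simp add: field_simps)
  qed
  define C' where "C' = max (D powr (2 / p)) (\<mu> * K\<^sup>2 / d)"
  have "0 \<le> C'" unfolding C'_def by (rule max.coboundedI1) simp
  moreover have "(\<Sum>j\<in>F. (norm (xs j f))\<^sup>2) \<le> C' * (pnorm M p f)\<^sup>2" if "finite F" "f \<in> X" for F f
    by (rule order_trans[OF lower[OF that] mult_right_mono]) (auto simp: C'_def)
  moreover have "(pnorm M p (\<Sum>j\<in>F. xs j f *\<^sub>F x j))\<^sup>2 \<le> C' * (\<Sum>j\<in>F. (norm (xs j f))\<^sup>2)" if "finite F" for F f
    by (rule order_trans[OF upper[OF that] mult_right_mono]) (auto simp: C'_def intro: sum_nonneg)
  ultimately show ?thesis by (intro exI[of _ C'] conjI allI impI) auto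
qed

text \<open>
  For \<open>p \<le> 2\<close> the space \<open>L\<^sub>p\<close> has cotype 2, which gives the lower estimate.  For the upper one,
  the functionals \<open>L\<close> extend the coordinate functionals to all of \<open>L\<^sub>p\<close>, and \<open>approx\<close> says that the
  functions \<open>|x\<^sub>j|\<^sup>p\<close> are uniformly integrable.  The vector \<open>\<Sum> a\<^sub>k x\<^sub>k\<close> is recovered as the diagonal
  part of an average whose ingredients are bounded functions, for which the norm of \<open>L\<^sub>2\<close> is available.
\<close>

theorem l2_estimates_below_2:
  assumes "finite_measure M" and p2: "p \<le> 2"
    and b: "0 < b" "\<And>j. b \<le> pnorm M p (x j)"
    and approx: "\<And>\<delta>. 0 < \<delta> \<Longrightarrow> \<exists>\<kappa>. \<forall>j. \<exists>f\<in>borel_measurable M. (\<forall>t. norm (f t) \<le> \<kappa>) \<and> pnorm M p (x j - f) \<le> \<delta>"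
    and L_add: "\<And>k g h. g \<in> Lp M p \<Longrightarrow> h \<in> Lp M p \<Longrightarrow> L k (g + h) = L k g + L k h"
    and L_scale: "\<And>k c g. g \<in> Lp M p \<Longrightarrow> L k (c *\<^sub>F g) = c * L k g"
    and L_xs: "\<And>k f. f \<in> X \<Longrightarrow> L k f = xs k f"
    and K': "0 < K'" "\<And>A F g. finite F \<Longrightarrow> g \<in> Lp M p \<Longrightarrow> pnorm M p (signed_sum F (\<lambda>k. L k g) x A) \<le> K' * pnorm M p g"
  shows "\<exists>C\<ge>0. \<forall>F f. finite F \<and> f \<in> X \<longrightarrow>
    (\<Sum>j\<in>F. (norm (xs j f))\<^sup>2) \<le> C * (pnorm M p f)\<^sup>2 \<and>
    (pnorm M p (\<Sum>j\<in>F. xs j f *\<^sub>F x j))\<^sup>2 \<le> C * (\<Sum>j\<in>F. (norm (xs j f))\<^sup>2)"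
proof -
  interpret finite_measure M by fact
  define \<mu> where "\<mu> = measure M (space M)"
  have \<mu>: "0 \<le> \<mu>" by (simp add: \<mu>_def)
  obtain c where c: "0 < c" "\<forall>(M :: 'a measure) F a (x :: nat \<Rightarrow> 'a \<Rightarrow> 'k) b.
    finite F \<longrightarrow> 0 \<le> b \<longrightarrow> (\<forall>j\<in>F. x j \<in> Lp M p) \<longrightarrow> (\<forall>j\<in>F. b \<le> pnorm M p (x j)) \<longrightarrow>
    c * 2 ^ card F * b powr p * (\<Sum>j\<in>F. (norm (a j))\<^sup>2) powr (p / 2)
      \<le> (\<Sum>A\<in>Pow F. \<integral>t. norm (signed_sum F a x A t) powr p \<partial>M)"
    using signed_sum_lower[OF p1 p2] by (elim exE conjE) (rule that)
  define D where "D = K' powr p / (c * b powr p)"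
  have D: "0 \<le> D" using c(1) by (simp add: D_def)
  have lower: "(\<Sum>j\<in>F. (norm (xs j f))\<^sup>2) \<le> D powr (2 / p) * (pnorm M p f)\<^sup>2"
    if F: "finite F" and f: "f \<in> X" for F f
  proof (rule le_square_of_powr_le[OF p0 pnorm_nonneg D])
    let ?s = "\<Sum>j\<in>F. (norm (xs j f))\<^sup>2" and ?N = "pnorm M p f"
    have "c * 2 ^ card F * b powr p * ?s powr (p / 2)
        \<le> (\<Sum>A\<in>Pow F. \<integral>t. norm (signed_sum F (\<lambda>j. xs j f) x A t) powr p \<partial>M)"
      using b by (intro c(2)[rule_format, OF F] xL) auto
    also have "\<dots> \<le> (\<Sum>A\<in>Pow F. (K' * ?N) powr p)"
    proof (rule sum_mono)
      fix A
      have "pnorm M p (signed_sum F (\<lambda>j. xs j f) x A) \<le> K' * ?N"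
        using K'(2)[OF F XLp[OF f], of A] unfolding L_xs[OF f] .
      then show "(\<integral>t. norm (signed_sum F (\<lambda>j. xs j f) x A t) powr p \<partial>M) \<le> (K' * ?N) powr p"
        by (subst (asm) pnorm_le_iff[OF p0]) (use K'(1) in auto)
    qed
    also have "\<dots> = 2 ^ card F * (K' powr p * ?N powr p)" using F by (simp add: card_Pow powr_mult)
    finally have "2 ^ card F * (c * b powr p * ?s powr (p / 2)) \<le> 2 ^ card F * (K' powr p * ?N powr p)"
      by (simp add: mult_ac)
    then have "c * b powr p * ?s powr (p / 2) \<le> K' powr p * ?N powr p"
      by (rule mult_left_le_imp_le) simp
    then show "?s powr (p / 2) \<le> D * ?N powr p" using c(1) b(1) by (simp add: D_def field_simps)
  qed (auto intro: sum_nonneg)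
  \<comment> \<open>With this \<open>\<delta>\<close>, passing from \<open>x\<^sub>j\<close> to \<open>f\<^sub>j\<close> changes the value \<open>1\<close> of \<open>L\<^sub>j\<close> by at most \<open>1/2\<close>.\<close>
  define \<delta> where "\<delta> = b / (2 * K')"
  have \<delta>: "0 < \<delta>" using b K' by (simp add: \<delta>_def)
  obtain \<kappa> f where f: "\<And>j. f j \<in> borel_measurable M" "\<And>j t. norm (f j t) \<le> \<kappa>" "\<And>j. pnorm M p (x j - f j) \<le> \<delta>"
    using approx[OF \<delta>] by metis
  have fL: "f j \<in> Lp M r" if "0 < r" for j r
  proof -
    have [measurable]: "f j \<in> borel_measurable M" by (rule f)
    have "integrable M (\<lambda>t. norm (f j t) powr r)"
      using that f(2)[of j] by (intro integrable_const_bound[of _ "\<kappa> powr r"] AE_I2) (auto intro!: powr_mono2)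
    then show ?thesis using that by (simp add: Lp_iff)
  qed
  have f2: "(\<integral>t. norm (f j t) powr 2 \<partial>M) \<le> \<kappa>\<^sup>2 * \<mu>" for j
  proof -
    have "(\<integral>t. norm (f j t) powr 2 \<partial>M) \<le> (\<integral>t. \<kappa>\<^sup>2 \<partial>M)"
      using Lp_integrable[OF _ fL[of 2 j]] f(2)[of j] by (intro integral_mono) (auto intro!: power_mono)
    then show ?thesis by (simp add: \<mu>_def mult.commute)
  qed
  have L_bound: "norm (L k g) * b \<le> K' * pnorm M p g" if g: "g \<in> Lp M p" for k g
  proof -
    have "signed_sum {k} (\<lambda>k. L k g) x {k} = L k g *\<^sub>F x k" by (simp add: signed_sum_def rsign_def)
    then have "norm (L k g) * pnorm M p (x k) \<le> K' * pnorm M p g"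
      using K'(2)[OF _ g, of "{k}" "{k}"] by (simp add: pnorm_fscale[OF p0])
    moreover have "norm (L k g) * b \<le> norm (L k g) * pnorm M p (x k)" by (intro mult_left_mono b) auto
    ultimately show ?thesis by linarith
  qed
  have L_sum: "L k (\<Sum>j\<in>F. g j) = (\<Sum>j\<in>F. L k (g j))" if "finite F" "\<And>j. g j \<in> Lp M p" for k F and g :: "nat \<Rightarrow> 'a \<Rightarrow> 'k"
    using that(1)
  proof (induction F rule: finite_induct)
    case empty
    have "L k (0 *\<^sub>F x 0) = 0" using L_scale[OF xL, of k 0] by simp
    then show ?case by (simp only: pw.scale_zero_left sum.empty)
  next
    case (insert j F)
    have "L k (\<Sum>j\<in>insert j F. g j) = L k (g j + (\<Sum>j\<in>F. g j))" by (simp only: sum.insert[OF insert(1,2)])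
    also have "\<dots> = L k (g j) + L k (\<Sum>j\<in>F. g j)" by (intro L_add Lp_sum p1 that)
    also have "\<dots> = (\<Sum>j\<in>insert j F. L k (g j))" unfolding insert(3) using insert(1,2) by simp
    finally show ?case .
  qed
  define \<theta> where "\<theta> j = L j (f j)" for j
  have \<theta>: "1/2 \<le> norm (\<theta> j)" for j
  proof -
    have "x j = (x j - f j) + f j" by (simp add: fun_eq_iff)
    then have "L j (x j) = L j (x j - f j) + L j (f j)"
      using L_add[OF Lp_diff[OF p1 xL fL[OF p0]] fL[OF p0]] by metis
    then have "1 = L j (x j - f j) + \<theta> j" using L_xs[OF xX] by (simp add: biorthogonal \<theta>_def)
    then have "1 \<le> norm (L j (x j - f j)) + norm (\<theta> j)" using norm_triangle_ineq by (metis norm_one)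
    moreover have "norm (L j (x j - f j)) * b \<le> K' * \<delta>"
      using L_bound[OF Lp_diff[OF p1 xL fL[OF p0]]] mult_left_mono[OF f(3), of K' j] K'(1)
      by (meson less_imp_le order_trans)
    then have "norm (L j (x j - f j)) * b \<le> 1/2 * b" using K'(1) by (simp add: \<delta>_def)
    then have "norm (L j (x j - f j)) \<le> 1/2" using b(1) by (rule mult_right_le_imp_le)
    ultimately show ?thesis by linarith
  qed
  define E where "E = K' * (1 + \<mu> + 4 * \<kappa>\<^sup>2 * \<mu>)"
  have upper: "(pnorm M p (\<Sum>j\<in>F. a j *\<^sub>F x j))\<^sup>2 \<le> E\<^sup>2 * (\<Sum>j\<in>F. (norm (a j))\<^sup>2)"
    if F: "finite F" for F a
  proof (cases "(\<Sum>j\<in>F. (norm (a j))\<^sup>2) = 0")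
    case True
    then have "\<And>j. j \<in> F \<Longrightarrow> a j = 0" using F by (simp add: sum_nonneg_eq_0_iff)
    then have "(\<Sum>j\<in>F. a j *\<^sub>F x j) = (\<Sum>j\<in>F. 0)"
      by (intro sum.cong refl) (simp only: pw.scale_zero_left)
    then have "pnorm M p (\<Sum>j\<in>F. a j *\<^sub>F x j) = 0" by (simp only: sum.neutral_const pnorm_zero[OF p0])
    then show ?thesis using True by simp
  next
    case False
    define s where "s = sqrt (\<Sum>j\<in>F. (norm (a j))\<^sup>2)"
    have "0 < (\<Sum>j\<in>F. (norm (a j))\<^sup>2)" using False by (simp add: sum_nonneg order_less_le)
    then have s: "0 < s" "s\<^sup>2 = (\<Sum>j\<in>F. (norm (a j))\<^sup>2)" by (auto simp: s_def)
    define e where "e j = a j / \<theta> j" for j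
    define h where "h A = signed_sum F e f A" for A
    have hL: "h A \<in> Lp M r" if "1 \<le> r" for A r
      unfolding h_def using that by (intro signed_sum_Lp fL) auto
    have "(\<Sum>A\<in>Pow F. \<integral>t. norm (h A t) powr 2 \<partial>M) = 2 ^ card F * (\<Sum>j\<in>F. (norm (e j))\<^sup>2 * (\<integral>t. norm (f j t) powr 2 \<partial>M))"
      unfolding h_def by (rule signed_sum_second_moment[OF F fL]) simp
    also have "\<dots> \<le> 2 ^ card F * (\<Sum>j\<in>F. 4 * (norm (a j))\<^sup>2 * (\<kappa>\<^sup>2 * \<mu>))"
    proof (intro mult_left_mono sum_mono mult_mono f2)
      fix j
      have "norm (e j) = norm (a j) / norm (\<theta> j)" by (simp add: e_def norm_divide)
      also have "\<dots> \<le> norm (a j) / (1/2)" by (intro divide_left_mono \<theta>) (use \<theta>[of j] in auto)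
      finally have "(norm (e j))\<^sup>2 \<le> (2 * norm (a j))\<^sup>2" by (intro power_mono) auto
      then show "(norm (e j))\<^sup>2 \<le> 4 * (norm (a j))\<^sup>2" by (simp add: power_mult_distrib)
    qed (auto intro: integral_nonneg)
    also have "\<dots> = 2 ^ card F * (4 * s\<^sup>2 * (\<kappa>\<^sup>2 * \<mu>))"
      unfolding s(2) by (simp add: sum_distrib_left sum_distrib_right mult_ac)
    finally have h2: "(\<Sum>A\<in>Pow F. \<integral>t. norm (h A t) powr 2 \<partial>M) \<le> 2 ^ card F * (4 * s\<^sup>2 * (\<kappa>\<^sup>2 * \<mu>))" .
    \<comment> \<open>From \<open>u \<le> 1 + u\<^sup>p\<close> and \<open>u\<^sup>p \<le> 1 + u\<^sup>2\<close>, rescaled by \<open>s\<close>: the right-hand side is linear in the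
      second moment, so that it can be averaged.\<close>
    have hp: "pnorm M p (h A) \<le> s * (1 + \<mu>) + (\<integral>t. norm (h A t) powr 2 \<partial>M) / s" for A
    proof -
      have "pnorm M p (h A) \<le> s + s powr (1 - p) * pnorm M p (h A) powr p"
        using powr_le_powr_scaled[OF s(1) pnorm_nonneg[of M p "h A"], of 1 p] p s(1) by simp
      also have "s powr (1 - p) * pnorm M p (h A) powr p
          \<le> s powr (1 - p) * (s powr p * \<mu> + s powr (p - 2) * (\<integral>t. norm (h A t) powr 2 \<partial>M))"
        unfolding pnorm_powr[OF p0] \<mu>_def
        by (intro mult_left_mono lower_power_integral[OF p0 p2 hL s(1)]) auto
      also have "\<dots> = s * \<mu> + (\<integral>t. norm (h A t) powr 2 \<partial>M) / s"
      proof -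
        have "s powr (1 - p) * s powr p = s" using s(1) by (simp add: powr_add[symmetric])
        moreover have "s powr (1 - p) * s powr (p - 2) = 1 / s"
          using s(1) by (simp add: powr_add[symmetric] powr_minus divide_inverse)
        ultimately show ?thesis by (simp add: distrib_left mult.assoc[symmetric])
      qed
      finally show ?thesis by (simp add: distrib_left)
    qed
    have Lh: "L k (h A) = (\<Sum>j\<in>F. rsign A j *\<^sub>R (e j * L k (f j)))" for k A
    proof -
      have "L k (h A) = (\<Sum>j\<in>F. L k ((of_real (rsign A j) * e j) *\<^sub>F f j))"
        unfolding h_def signed_sum_def by (intro L_sum F Lp_fscale fL p0)
      then show ?thesis using L_scale[OF fL[OF p0]] by (simp add: scaleR_conv_of_real mult.assoc)
    qed
    \<comment> \<open>The off-diagonal terms carry \<open>\<epsilon>\<^sub>k \<epsilon>\<^sub>j\<close> with \<open>k \<noteq> j\<close> and cancel in the sum over all signs.\<close>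
    have diagonal: "(\<Sum>A\<in>Pow F. signed_sum F (\<lambda>k. L k (h A)) x A) = 2 ^ card F *\<^sub>F (\<Sum>k\<in>F. a k *\<^sub>F x k)"
    proof (rule ext)
      fix t
      have "(\<Sum>A\<in>Pow F. signed_sum F (\<lambda>k. L k (h A)) x A) t
          = (\<Sum>A\<in>Pow F. \<Sum>k\<in>F. \<Sum>j\<in>F. (rsign A k * rsign A j) *\<^sub>R (e j * L k (f j) * x k t))"
        unfolding sum_apply signed_sum_apply Lh
        by (simp add: sum_distrib_right scaleR_sum_right)
      also have "\<dots> = (\<Sum>k\<in>F. \<Sum>A\<in>Pow F. \<Sum>j\<in>F. (rsign A k * rsign A j) *\<^sub>R (e j * L k (f j) * x k t))"
        by (rule sum.swap)
      also have "\<dots> = (\<Sum>k\<in>F. \<Sum>j\<in>F. \<Sum>A\<in>Pow F. (rsign A k * rsign A j) *\<^sub>R (e j * L k (f j) * x k t))"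
        by (intro sum.cong refl sum.swap)
      also have "\<dots> = (\<Sum>k\<in>F. \<Sum>j\<in>F. if k = j then 2 ^ card F *\<^sub>R (e j * L k (f j) * x k t) else 0)"
        unfolding scaleR_sum_left[symmetric] by (intro sum.cong refl) (simp add: sum_rsign_mult[OF F])
      also have "\<dots> = (\<Sum>k\<in>F. 2 ^ card F *\<^sub>R (a k * x k t))"
      proof (intro sum.cong refl)
        fix k assume "k \<in> F"
        have "\<theta> k \<noteq> 0" using \<theta>[of k] by auto
        then show "(\<Sum>j\<in>F. if k = j then 2 ^ card F *\<^sub>R (e j * L k (f j) * x k t) else 0) = 2 ^ card F *\<^sub>R (a k * x k t)"
          using F \<open>k \<in> F\<close> by (simp add: e_def \<theta>_def)
      qed
      also have "\<dots> = (2 ^ card F *\<^sub>F (\<Sum>k\<in>F. a k *\<^sub>F x k)) t"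
        unfolding fscale_def sum_apply by (simp add: sum_distrib_left scaleR_conv_of_real)
      finally show "(\<Sum>A\<in>Pow F. signed_sum F (\<lambda>k. L k (h A)) x A) t = (2 ^ card F *\<^sub>F (\<Sum>k\<in>F. a k *\<^sub>F x k)) t" .
    qed
    have "2 ^ card F * pnorm M p (\<Sum>k\<in>F. a k *\<^sub>F x k) = pnorm M p (\<Sum>A\<in>Pow F. signed_sum F (\<lambda>k. L k (h A)) x A)"
      unfolding diagonal pnorm_fscale[OF p0] by (simp add: norm_power)
    also have "\<dots> \<le> (\<Sum>A\<in>Pow F. pnorm M p (signed_sum F (\<lambda>k. L k (h A)) x A))"
      by (intro pnorm_sum_le p1 signed_sum_Lp xL)
    also have "\<dots> \<le> (\<Sum>A\<in>Pow F. K' * pnorm M p (h A))"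
      by (intro sum_mono K'(2) F hL p1)
    also have "\<dots> \<le> (\<Sum>A\<in>Pow F. K' * (s * (1 + \<mu>) + (\<integral>t. norm (h A t) powr 2 \<partial>M) / s))"
      using K'(1) by (intro sum_mono mult_left_mono hp) auto
    also have "\<dots> = K' * (2 ^ card F * (s * (1 + \<mu>)) + (\<Sum>A\<in>Pow F. \<integral>t. norm (h A t) powr 2 \<partial>M) / s)"
      using F by (simp add: sum_distrib_left[symmetric] sum.distrib sum_divide_distrib[symmetric] card_Pow)
    also have "\<dots> \<le> K' * (2 ^ card F * (s * (1 + \<mu>)) + 2 ^ card F * (4 * s\<^sup>2 * (\<kappa>\<^sup>2 * \<mu>)) / s)"
      using K'(1) s(1) h2 by (intro mult_left_mono add_left_mono divide_right_mono) auto
    also have "\<dots> = 2 ^ card F * (E * s)"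
      using s(1) by (simp add: E_def power2_eq_square algebra_simps)
    finally have "pnorm M p (\<Sum>k\<in>F. a k *\<^sub>F x k) \<le> E * s" by (rule mult_left_le_imp_le) simp
    then have "(pnorm M p (\<Sum>k\<in>F. a k *\<^sub>F x k))\<^sup>2 \<le> (E * s)\<^sup>2" by (intro power_mono) auto
    then show ?thesis by (simp only: power_mult_distrib s(2))
  qed
  define C' where "C' = max (D powr (2 / p)) (E\<^sup>2)"
  have "0 \<le> C'" unfolding C'_def by (rule max.coboundedI1) simp
  moreover have "(\<Sum>j\<in>F. (norm (xs j f))\<^sup>2) \<le> C' * (pnorm M p f)\<^sup>2" if "finite F" "f \<in> X" for F f
    by (rule order_trans[OF lower[OF that] mult_right_mono]) (auto simp: C'_def)
  moreover have "(pnorm M p (\<Sum>j\<in>F. xs j f *\<^sub>F x j))\<^sup>2 \<le> C' * (\<Sum>j\<in>F. (norm (xs j f))\<^sup>2)" if "finite F" for F f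
    by (rule order_trans[OF upper[OF that] mult_right_mono]) (auto simp: C'_def intro: sum_nonneg)
  ultimately show ?thesis by (intro exI[of _ C'] conjI allI impI) auto
qed

end

section \<open>Spaces with an orthogonal basis up to isomorphism\<close>

text \<open>
  The common properties of the identity of the reals and the conjugation of the complex numbers.
\<close>

locale scalar_conjugation =
  fixes cj :: "'k::{real_normed_field, euclidean_space} \<Rightarrow> 'k"
  assumes linear: "bounded_linear cj"
    and mult: "cj (a * b) = cj a * cj b"
    and involution: "cj (cj a) = a"
    and square: "a * cj a = of_real ((norm a)\<^sup>2)"
begin

lemma norm_cj: "norm (cj a) = norm a"
proof (cases "a = 0")
  case True
  then show ?thesis using bounded_linear.linear[OF linear] by (simp add: linear_0)
next
  case False
  have "norm a * norm (cj a) = (norm a)\<^sup>2"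
    using arg_cong[OF square[of a], of norm] by (simp add: norm_mult norm_power)
  then show ?thesis using False by (simp add: power2_eq_square)
qed

lemma cj_minus: "cj (- a) = - cj a"
  using bounded_linear.linear[OF linear] by (rule linear_neg)

end

context unconditional_sequence
begin

definition coeff_norm :: "('a \<Rightarrow> 'k) \<Rightarrow> real" where
  "coeff_norm f = sqrt (\<Sum>\<^sub>\<infinity>n. (norm (xs n f))\<^sup>2)"

end

locale l2_basis = unconditional_sequence M p X x xs
  for M :: "'a measure" and p and X :: "('a \<Rightarrow> 'k::{real_normed_field, euclidean_space}) set" and x and xs +
  fixes C :: real
  assumes C: "0 \<le> C"
    and coeff_le: "\<And>F f. finite F \<Longrightarrow> f \<in> X \<Longrightarrow> (\<Sum>j\<in>F. (norm (xs j f))\<^sup>2) \<le> C * (pnorm M p f)\<^sup>2"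
    and partial_le: "\<And>F f. finite F \<Longrightarrow> f \<in> X \<Longrightarrow>
      (pnorm M p (\<Sum>j\<in>F. xs j f *\<^sub>F x j))\<^sup>2 \<le> C * (\<Sum>j\<in>F. (norm (xs j f))\<^sup>2)"
begin

lemma coeff_summable: "f \<in> X \<Longrightarrow> (\<lambda>n. (norm (xs n f))\<^sup>2) summable_on UNIV"
  by (rule nonneg_bdd_above_summable_on) (auto intro!: bdd_aboveI2[where M = "C * (pnorm M p f)\<^sup>2"] coeff_le)

lemma coeff_norm_nonneg: "0 \<le> coeff_norm f"
  unfolding coeff_norm_def by (simp add: infsum_nonneg)

lemma coeff_norm_square: "(coeff_norm f)\<^sup>2 = (\<Sum>\<^sub>\<infinity>n. (norm (xs n f))\<^sup>2)"
  unfolding coeff_norm_def by (simp add: infsum_nonneg)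

lemma coeff_norm_le_pnorm:
  assumes f: "f \<in> X"
  shows "coeff_norm f \<le> sqrt C * pnorm M p f"
proof -
  have "(\<Sum>\<^sub>\<infinity>n. (norm (xs n f))\<^sup>2) \<le> C * (pnorm M p f)\<^sup>2"
    by (rule infsum_le_finite_sums[OF coeff_summable[OF f]]) (rule coeff_le[OF _ f])
  then have "coeff_norm f \<le> sqrt (C * (pnorm M p f)\<^sup>2)" unfolding coeff_norm_def by (rule real_sqrt_le_mono)
  then show ?thesis using pnorm_nonneg[of M p f] by (simp add: real_sqrt_mult)
qed

lemma finite_coeff_le: "f \<in> X \<Longrightarrow> finite F \<Longrightarrow> L2_set (\<lambda>n. norm (xs n f)) F \<le> coeff_norm f"
  unfolding L2_set_def coeff_norm_def
  by (intro real_sqrt_le_mono finite_sum_le_infsum coeff_summable) auto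

lemma pnorm_le_coeff_norm:
  assumes f: "f \<in> X"
  shows "pnorm M p f \<le> sqrt C * coeff_norm f"
proof (rule tendsto_lowerbound)
  let ?S = "\<lambda>N. \<Sum>n<N. xs n f *\<^sub>F x n"
  show "(\<lambda>N. pnorm M p (f - ?S N) + sqrt C * coeff_norm f) \<longlonglongrightarrow> sqrt C * coeff_norm f"
    using tendsto_add[OF converges[OF f bij_id] tendsto_const, of "sqrt C * coeff_norm f"] by simp
  show "\<forall>\<^sub>F N in sequentially. pnorm M p f \<le> pnorm M p (f - ?S N) + sqrt C * coeff_norm f"
  proof (rule always_eventually, rule allI)
    fix N
    have "(pnorm M p (?S N))\<^sup>2 \<le> C * (L2_set (\<lambda>n. norm (xs n f)) {..<N})\<^sup>2"
      using partial_le[OF _ f, of "{..<N}"] by (simp add: L2_set_def sum_nonneg)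
    also have "\<dots> \<le> C * (coeff_norm f)\<^sup>2"
      using finite_coeff_le[OF f, of "{..<N}"] C by (intro mult_left_mono power_mono) (auto intro: L2_set_nonneg)
    also have "\<dots> = (sqrt C * coeff_norm f)\<^sup>2" using C by (simp add: power_mult_distrib)
    finally have "pnorm M p (?S N) \<le> sqrt C * coeff_norm f"
      by (rule power2_le_imp_le) (use C in \<open>simp add: coeff_norm_nonneg\<close>)
    moreover have "pnorm M p f \<le> pnorm M p (f - ?S N) + pnorm M p (?S N)"
    proof -
      have "f = (f - ?S N) + ?S N" by (simp only: diff_add_cancel)
      moreover have "pnorm M p ((f - ?S N) + ?S N) \<le> pnorm M p (f - ?S N) + pnorm M p (?S N)"
        by (intro pnorm_triangle p1 Lp_diff XLp f combination_X)
      ultimately show ?thesis by metis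
    qed
    ultimately show "pnorm M p f \<le> pnorm M p (f - ?S N) + sqrt C * coeff_norm f" by linarith
  qed
qed simp

lemma coeff_norm_triangle:
  assumes f: "f \<in> X" and g: "g \<in> X"
  shows "coeff_norm (f + g) \<le> coeff_norm f + coeff_norm g"
proof -
  have fg: "f + g \<in> X" using subspace f g by (rule pw.subspace_add)
  have "(\<Sum>n\<in>F. (norm (xs n (f + g)))\<^sup>2) \<le> (coeff_norm f + coeff_norm g)\<^sup>2" if F: "finite F" for F
  proof -
    have "L2_set (\<lambda>n. norm (xs n (f + g))) F \<le> L2_set (\<lambda>n. norm (xs n f) + norm (xs n g)) F"
      by (rule L2_set_mono) (simp_all add: xs_add[OF f g] norm_triangle_ineq)
    also have "\<dots> \<le> L2_set (\<lambda>n. norm (xs n f)) F + L2_set (\<lambda>n. norm (xs n g)) F"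
      by (rule L2_set_triangle_ineq)
    also have "\<dots> \<le> coeff_norm f + coeff_norm g" using F by (intro add_mono finite_coeff_le f g)
    finally have "(L2_set (\<lambda>n. norm (xs n (f + g))) F)\<^sup>2 \<le> (coeff_norm f + coeff_norm g)\<^sup>2"
      by (intro power_mono L2_set_nonneg)
    then show ?thesis by (simp add: L2_set_def sum_nonneg)
  qed
  then have "(coeff_norm (f + g))\<^sup>2 \<le> (coeff_norm f + coeff_norm g)\<^sup>2"
    unfolding coeff_norm_square[of "f + g"] by (intro infsum_le_finite_sums coeff_summable fg) simp
  then show ?thesis by (rule power2_le_imp_le) (simp add: coeff_norm_nonneg)
qed

text \<open>
  The Hilbert space consists of the coefficient sequences, carried to functions on the underlying
  set along an injection \<open>\<iota>\<close> of the natural numbers.  Only the sequences that come from \<open>X\<close> are taken: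
  completeness is then inherited from \<open>X\<close>, and no series has to be summed.
\<close>

theorem hilbertian_of_l2_basis:
  fixes cj :: "'k \<Rightarrow> 'k"
  assumes cj: "scalar_conjugation cj" and inf: "infinite (UNIV :: 'a set)"
  shows "hilbertian cj M p X"
proof -
  interpret cj: scalar_conjugation cj by fact
  obtain \<iota> :: "nat \<Rightarrow> 'a" where \<iota>: "inj \<iota>" using infinite_countable_subset[OF inf] by blast
  define T where "T f = (\<lambda>t. if t \<in> range \<iota> then xs (inv \<iota> t) f else 0)" for f
  define ip where "ip u v = (\<Sum>\<^sub>\<infinity>n. u (\<iota> n) * cj (v (\<iota> n)))" for u v :: "'a \<Rightarrow> 'k"
  define H where "H = T ` X"
  define d where "d u v = ip_norm ip (u - v)" for u v
  have T\<iota>: "T f (\<iota> n) = xs n f" for f n by (simp add: T_def inv_f_f[OF \<iota>])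
  have T_add: "T (f + g) = T f + T g" if "f \<in> X" "g \<in> X" for f g
    using that by (auto simp: T_def xs_add)
  have T_scale: "T (c *\<^sub>F f) = c *\<^sub>F T f" if "f \<in> X" for c f
  proof (rule ext)
    fix t
    have "T (c *\<^sub>F f) t = c * T f t" using that by (simp add: T_def xs_scale)
    then show "T (c *\<^sub>F f) t = (c *\<^sub>F T f) t" by (simp add: fscale_def)
  qed
  have T_diff: "T (f - g) = T f - T g" if f: "f \<in> X" and g: "g \<in> X" for f g
  proof -
    have "T ((f - g) + g) = T (f - g) + T g" by (intro T_add pw.subspace_diff[OF subspace] f g)
    then show ?thesis by (simp only: diff_add_cancel eq_diff_eq)
  qed
  have H_sub: "pw.subspace H"
  proof (rule pw.subspaceI)
    have "T 0 = T (0 *\<^sub>F 0)" by (simp only: pw.scale_zero_left)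
    also have "\<dots> = 0 *\<^sub>F T 0" by (intro T_scale pw.subspace_0[OF subspace])
    also have "\<dots> = 0" by (simp only: pw.scale_zero_left)
    finally show "0 \<in> H" unfolding H_def using pw.subspace_0[OF subspace] by (metis imageI)
  next
    fix u v assume "u \<in> H" "v \<in> H"
    then show "u + v \<in> H" unfolding H_def
      using T_add pw.subspace_add[OF subspace] by (smt (verit) image_iff)
  next
    fix c u assume "u \<in> H"
    then show "c *\<^sub>F u \<in> H" unfolding H_def
      using T_scale pw.subspace_scale[OF subspace] by (smt (verit) image_iff)
  qed
  have ip_T: "ip (T f) (T g) = (\<Sum>\<^sub>\<infinity>n. xs n f * cj (xs n g))" for f g
    unfolding ip_def T\<iota> ..
  have summable: "(\<lambda>n. xs n f * cj (xs n g)) summable_on UNIV" if "f \<in> X" "g \<in> X" for f g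
  proof (rule abs_summable_summable, rule summable_on_comparison_test)
    show "(\<lambda>n. (norm (xs n f))\<^sup>2 + (norm (xs n g))\<^sup>2) summable_on UNIV"
      by (intro summable_on_add coeff_summable that)
    fix n
    have "2 * (norm (xs n f) * norm (xs n g)) \<le> (norm (xs n f))\<^sup>2 + (norm (xs n g))\<^sup>2"
      using sum_squares_bound[of "norm (xs n f)" "norm (xs n g)"] by (simp add: mult.assoc)
    moreover have "0 \<le> norm (xs n f) * norm (xs n g)" by simp
    ultimately have "norm (xs n f) * norm (xs n g) \<le> (norm (xs n f))\<^sup>2 + (norm (xs n g))\<^sup>2" by linarith
    then show "norm (xs n f * cj (xs n g)) \<le> (norm (xs n f))\<^sup>2 + (norm (xs n g))\<^sup>2"
      by (simp add: norm_mult cj.norm_cj)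
  qed simp
  have ip_self: "ip (T f) (T f) = of_real ((coeff_norm f)\<^sup>2)" if f: "f \<in> X" for f
  proof -
    have "((\<lambda>n. of_real ((norm (xs n f))\<^sup>2) :: 'k) has_sum of_real (\<Sum>\<^sub>\<infinity>n. (norm (xs n f))\<^sup>2)) UNIV"
      by (rule has_sum_bounded_linear[OF bounded_linear_of_real has_sum_infsum[OF coeff_summable[OF f]]])
    then show ?thesis unfolding ip_T cj.square coeff_norm_square by (rule infsumI)
  qed
  have ip_norm_T: "ip_norm ip (T f) = coeff_norm f" if f: "f \<in> X" for f
    unfolding ip_norm_def ip_self[OF f] norm_of_real by (simp add: coeff_norm_nonneg)
  have d_T: "d (T f) (T g) = coeff_norm (f - g)" if "f \<in> X" "g \<in> X" for f g
    unfolding d_def T_diff[OF that, symmetric] by (rule ip_norm_T[OF pw.subspace_diff[OF subspace that]])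
  have coeff_norm_pos: "0 < coeff_norm f" if f: "f \<in> X" and ne: "T f \<noteq> 0" for f
  proof -
    obtain n where n: "xs n f \<noteq> 0" using ne by (auto simp: T_def fun_eq_iff split: if_splits)
    have "norm (xs n f) \<le> coeff_norm f" using finite_coeff_le[OF f, of "{n}"] by (simp add: L2_set_def)
    then show ?thesis using n by (meson zero_less_norm_iff less_le_trans)
  qed
  have coeff_norm_0: "coeff_norm f = 0" if "T f = 0" for f
  proof -
    have "xs n f = 0" for n using fun_cong[OF that, of "\<iota> n"] unfolding T\<iota> by simp
    then show ?thesis by (simp add: coeff_norm_def)
  qed
  have inner: "inner_product_on cj H ip"
    unfolding inner_product_on_def
  proof (intro conjI ballI allI impI)
    fix u v w assume "u \<in> H" "v \<in> H" "w \<in> H"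
    then obtain f g h where fgh: "f \<in> X" "g \<in> X" "h \<in> X" "u = T f" "v = T g" "w = T h" by (auto simp: H_def)
    have "ip (T f + T g) (T h) = (\<Sum>\<^sub>\<infinity>n. xs n f * cj (xs n h) + xs n g * cj (xs n h))"
      unfolding ip_def by (simp add: T\<iota> distrib_right)
    also have "\<dots> = ip (T f) (T h) + ip (T g) (T h)"
      unfolding ip_T by (intro infsum_add summable fgh)
    finally show "ip (u + v) w = ip u w + ip v w" unfolding fgh .
  next
    fix c u v
    have "ip (c *\<^sub>F u) v = (\<Sum>\<^sub>\<infinity>n. c * (u (\<iota> n) * cj (v (\<iota> n))))"
      unfolding ip_def by (simp add: fscale_def mult.assoc)
    then show "ip (c *\<^sub>F u) v = c * ip u v" unfolding ip_def by (simp add: infsum_cmult_right')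
  next
    fix u v assume "u \<in> H" "v \<in> H"
    then obtain f g where fg: "f \<in> X" "g \<in> X" "u = T f" "v = T g" by (auto simp: H_def)
    have "((\<lambda>n. cj (xs n f * cj (xs n g))) has_sum cj (ip (T f) (T g))) UNIV"
      unfolding ip_T by (intro has_sum_bounded_linear[OF cj.linear] has_sum_infsum summable fg)
    then have "ip (T g) (T f) = cj (ip (T f) (T g))"
      unfolding ip_T cj.mult cj.involution by (intro infsumI) (simp add: mult.commute)
    then show "ip v u = cj (ip u v)" unfolding fg .
  next
    fix u assume "u \<in> H" "u \<noteq> 0"
    then obtain f where f: "f \<in> X" "u = T f" "T f \<noteq> 0" by (auto simp: H_def)
    then show "\<exists>r>0. ip u u = of_real r"
      using ip_self[OF f(1)] coeff_norm_pos[OF f(1) f(3)] by (intro exI[of _ "(coeff_norm f)\<^sup>2"]) simp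
  qed
  have metric: "Metric_space H d"
  proof
    fix u v show "0 \<le> d u v" by (simp add: d_def ip_norm_def)
    have "ip (u - v) (u - v) = ip (v - u) (v - u)"
      unfolding ip_def
    proof (rule infsum_cong)
      fix n
      have "(u - v) (\<iota> n) = - (v - u) (\<iota> n)" by simp
      then show "(u - v) (\<iota> n) * cj ((u - v) (\<iota> n)) = (v - u) (\<iota> n) * cj ((v - u) (\<iota> n))"
        by (simp only: cj.cj_minus minus_mult_minus)
    qed
    then show "d u v = d v u" by (simp only: d_def ip_norm_def)
  next
    fix u v assume "u \<in> H" "v \<in> H"
    then obtain f g where fg: "f \<in> X" "g \<in> X" "u = T f" "v = T g" by (auto simp: H_def)
    have fgX: "f - g \<in> X" by (intro pw.subspace_diff[OF subspace] fg)
    have "coeff_norm (f - g) = 0 \<longleftrightarrow> T (f - g) = 0"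
      using coeff_norm_pos[OF fgX] coeff_norm_0 by (metis less_irrefl)
    then show "d u v = 0 \<longleftrightarrow> u = v" unfolding fg d_T[OF fg(1,2)] T_diff[OF fg(1,2)] by (simp only: right_minus_eq)
  next
    fix u v w assume "u \<in> H" "v \<in> H" "w \<in> H"
    then obtain f g h where fgh: "f \<in> X" "g \<in> X" "h \<in> X" "u = T f" "v = T g" "w = T h" by (auto simp: H_def)
    have "f - h = (f - g) + (g - h)" by (simp add: fun_eq_iff)
    then have "coeff_norm (f - h) \<le> coeff_norm (f - g) + coeff_norm (g - h)"
      using coeff_norm_triangle[OF pw.subspace_diff[OF subspace fgh(1,2)] pw.subspace_diff[OF subspace fgh(2,3)]] by (simp only:)
    then show "d u w \<le> d u v + d v w" unfolding fgh using fgh(1-3) by (simp only: d_T)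
  qed
  have "Metric_space.mcomplete H d"
    unfolding Metric_space.mcomplete_def[OF metric]
  proof (intro allI impI)
    fix \<sigma> assume \<sigma>: "Metric_space.MCauchy H d \<sigma>"
    then have "range \<sigma> \<subseteq> H" unfolding Metric_space.MCauchy_def[OF metric] by blast
    then have "\<forall>n. \<exists>f\<in>X. \<sigma> n = T f" unfolding H_def by blast
    then obtain \<phi> where \<phi>: "\<And>n. \<phi> n \<in> X" "\<And>n. \<sigma> n = T (\<phi> n)" by metis
    have "\<exists>n0. \<forall>m\<ge>n0. \<forall>n\<ge>n0. pnorm M p (\<phi> m - \<phi> n) < e" if e: "0 < e" for e
    proof -
      have "0 < e / (sqrt C + 1)" using e C by (intro divide_pos_pos add_nonneg_pos) auto
      then obtain n0 where n0: "\<And>m n. m \<ge> n0 \<Longrightarrow> n \<ge> n0 \<Longrightarrow> d (\<sigma> m) (\<sigma> n) < e / (sqrt C + 1)"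
        using \<sigma> unfolding Metric_space.MCauchy_def[OF metric] by meson
      have "pnorm M p (\<phi> m - \<phi> n) < e" if "m \<ge> n0" "n \<ge> n0" for m n
      proof -
        have "pnorm M p (\<phi> m - \<phi> n) \<le> sqrt C * coeff_norm (\<phi> m - \<phi> n)"
          by (intro pnorm_le_coeff_norm pw.subspace_diff[OF subspace] \<phi>)
        also have "\<dots> = sqrt C * d (\<sigma> m) (\<sigma> n)" unfolding \<phi>(2) d_T[OF \<phi>(1) \<phi>(1)] ..
        also have "\<dots> \<le> sqrt C * (e / (sqrt C + 1))"
          using C by (intro mult_left_mono less_imp_le[OF n0[OF that]]) simp
        also have "\<dots> < e"
        proof -
          have "0 < sqrt C + 1" using C by (simp add: add_nonneg_pos)
          moreover have "sqrt C * e < e * (sqrt C + 1)" using e by (simp add: algebra_simps)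
          ultimately show ?thesis by (simp add: pos_divide_less_eq)
        qed
        finally show ?thesis .
      qed
      then show ?thesis by blast
    qed
    then have "\<exists>g\<in>X. (\<lambda>n. pnorm M p (\<phi> n - g)) \<longlonglongrightarrow> 0"
      by (rule closed_subspace_complete[of p M X \<phi>, OF p1 X \<phi>(1)])
    then obtain g where g: "g \<in> X" "(\<lambda>n. pnorm M p (\<phi> n - g)) \<longlonglongrightarrow> 0" ..
    have "limitin (Metric_space.mtopology H d) \<sigma> (T g) sequentially"
      unfolding Metric_space.limit_metric_sequentially[OF metric]
    proof (intro conjI allI impI)
      show "T g \<in> H" using g by (simp add: H_def)
      fix e :: real assume e: "0 < e"
      have "(\<lambda>n. sqrt C * pnorm M p (\<phi> n - g)) \<longlonglongrightarrow> sqrt C * 0" by (intro tendsto_mult_left g)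
      then have "\<forall>\<^sub>F n in sequentially. sqrt C * pnorm M p (\<phi> n - g) < e"
        using e by (auto elim: order_tendstoD)
      then obtain N where N: "\<And>n. n \<ge> N \<Longrightarrow> sqrt C * pnorm M p (\<phi> n - g) < e" by (auto simp: eventually_sequentially)
      have "\<sigma> n \<in> H \<and> d (\<sigma> n) (T g) < e" if "n \<ge> N" for n
      proof
        show "\<sigma> n \<in> H" unfolding \<phi>(2) H_def using \<phi>(1) by (rule imageI)
        have "d (\<sigma> n) (T g) = coeff_norm (\<phi> n - g)" unfolding \<phi>(2) by (rule d_T[OF \<phi>(1) g(1)])
        also have "\<dots> \<le> sqrt C * pnorm M p (\<phi> n - g)"
          by (intro coeff_norm_le_pnorm pw.subspace_diff[OF subspace] \<phi> g)
        finally show "d (\<sigma> n) (T g) < e" using N[OF that] by linarith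
      qed
      then show "\<exists>N. \<forall>n\<ge>N. \<sigma> n \<in> H \<and> d (\<sigma> n) (T g) < e" by blast
    qed
    then show "\<exists>l. limitin (Metric_space.mtopology H d) \<sigma> l sequentially" by blast
  qed
  then have hilbert: "hilbert_space cj H ip"
    unfolding hilbert_space_def d_def[abs_def] using H_sub inner by blast
  have up: "ennreal (ip_norm ip (T f)) \<le> ennreal (sqrt C) * Lnorm M (ennreal p) f" if f: "f \<in> X" for f
    unfolding Lnorm_eq_pnorm[OF p0 XLp[OF f]] ip_norm_T[OF f]
    using coeff_norm_le_pnorm[OF f] C by (simp add: ennreal_mult''[symmetric] ennreal_leI)
  have low: "Lnorm M (ennreal p) f \<le> ennreal (sqrt C) * ennreal (ip_norm ip (T f))" if f: "f \<in> X" for f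
    unfolding Lnorm_eq_pnorm[OF p0 XLp[OF f]] ip_norm_T[OF f]
    using pnorm_le_coeff_norm[OF f] C coeff_norm_nonneg[of f] by (simp add: ennreal_mult''[symmetric] ennreal_leI)
  show ?thesis
    unfolding hilbertian_def
  proof (intro exI conjI)
    show "hilbert_space cj H ip" by (rule hilbert)
    show "\<forall>f\<in>X. \<forall>g\<in>X. T (f + g) = T f + T g" using T_add by blast
    show "\<forall>c. \<forall>f\<in>X. T (c *\<^sub>F f) = c *\<^sub>F T f" using T_scale by blast
    show "T ` X = H" by (simp add: H_def)
    show "\<forall>f\<in>X. ennreal (ip_norm ip (T f)) \<le> ennreal (sqrt C) * Lnorm M (ennreal p) f" using up by blast
    show "\<forall>f\<in>X. Lnorm M (ennreal p) f \<le> ennreal (sqrt C) * ennreal (ip_norm ip (T f))" using low by blast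
  qed
qed

end

section \<open>Truncations\<close>

definition truncation :: "real \<Rightarrow> ('a \<Rightarrow> 'k::real_normed_field) \<Rightarrow> 'a \<Rightarrow> 'k" where
  "truncation \<kappa> f = (\<lambda>t. if norm (f t) \<le> \<kappa> then f t else 0)"

lemma truncation_measurable:
  fixes f :: "'a \<Rightarrow> 'k::{real_normed_field, euclidean_space}"
  assumes [measurable]: "f \<in> borel_measurable M"
  shows "truncation \<kappa> f \<in> borel_measurable M"
  unfolding truncation_def by measurable

lemma norm_truncation_le: "0 \<le> \<kappa> \<Longrightarrow> norm (truncation \<kappa> f t) \<le> \<kappa>"
  by (simp add: truncation_def)

lemma truncation_error_uniform:
  fixes f :: "'a \<Rightarrow> 'k::{real_normed_field, euclidean_space}"
  assumes p: "0 < p" "p < q" and \<kappa>: "0 < \<kappa>" and f: "f \<in> Lp M p" "f \<in> Lp M q"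
  shows "(\<integral>t. norm ((f - truncation \<kappa> f) t) powr p \<partial>M) \<le> \<kappa> powr (p - q) * (\<integral>t. norm (f t) powr q \<partial>M)"
proof -
  have [measurable]: "f \<in> borel_measurable M" using f(1) by (rule Lp_measurable)
  have i: "integrable M (\<lambda>t. norm (f t) powr p)" "integrable M (\<lambda>t. norm (f t) powr q)"
    using Lp_integrable[OF _ f(1)] Lp_integrable[OF _ f(2)] p by auto
  have le: "norm ((f - truncation \<kappa> f) t) powr p \<le> norm (f t) powr p" for t
    by (simp add: truncation_def)
  have i': "integrable M (\<lambda>t. norm ((f - truncation \<kappa> f) t) powr p)"
  proof (rule Bochner_Integration.integrable_bound[OF i(1)])
    have [measurable]: "truncation \<kappa> f \<in> borel_measurable M" by (rule truncation_measurable) fact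
    show "(\<lambda>t. norm ((f - truncation \<kappa> f) t) powr p) \<in> borel_measurable M" by simp
  qed (use le in auto)
  have "(\<integral>t. norm ((f - truncation \<kappa> f) t) powr p \<partial>M) \<le> (\<integral>t. \<kappa> powr (p - q) * norm (f t) powr q \<partial>M)"
  proof (rule integral_mono[OF i'])
    fix t
    show "norm ((f - truncation \<kappa> f) t) powr p \<le> \<kappa> powr (p - q) * norm (f t) powr q"
    proof (cases "norm (f t) \<le> \<kappa>")
      case True
      then show ?thesis by (simp add: truncation_def)
    next
      case False
      then have "norm (f t) powr p = norm (f t) powr (p - q) * norm (f t) powr q"
        using \<kappa> by (simp add: powr_add[symmetric])
      also have "\<dots> \<le> \<kappa> powr (p - q) * norm (f t) powr q"
        using False \<kappa> p by (intro mult_right_mono powr_mono2') auto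
      finally show ?thesis using False by (simp add: truncation_def)
    qed
  qed (use i in auto)
  then show ?thesis by simp
qed

lemma truncation_error_tendsto_0:
  fixes f :: "'a \<Rightarrow> 'k::{real_normed_field, euclidean_space}"
  assumes p: "0 < p" and f: "f \<in> Lp M p"
  shows "(\<lambda>n. \<integral>t. norm ((f - truncation (real n) f) t) powr p \<partial>M) \<longlonglongrightarrow> 0"
proof -
  have [measurable]: "f \<in> borel_measurable M" using f by (rule Lp_measurable)
  have [measurable]: "truncation \<kappa> f \<in> borel_measurable M" for \<kappa> by (rule truncation_measurable) fact
  have "(\<lambda>n. \<integral>t. norm ((f - truncation (real n) f) t) powr p \<partial>M) \<longlonglongrightarrow> (\<integral>t. 0 \<partial>M)"
  proof (rule integral_dominated_convergence[where w = "\<lambda>t. norm (f t) powr p"])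
    show "integrable M (\<lambda>t. norm (f t) powr p)" by (rule Lp_integrable[OF p f])
    show "AE t in M. (\<lambda>n. norm ((f - truncation (real n) f) t) powr p) \<longlonglongrightarrow> 0"
    proof (rule AE_I2)
      fix t
      obtain N :: nat where "norm (f t) \<le> N" using real_arch_simple by blast
      then have "\<forall>\<^sub>F n in sequentially. norm ((f - truncation (real n) f) t) powr p = 0"
        by (intro eventually_sequentiallyI[of N]) (auto simp: truncation_def)
      then show "(\<lambda>n. norm ((f - truncation (real n) f) t) powr p) \<longlonglongrightarrow> 0"
        by (rule tendsto_eventually)
    qed
  qed (auto simp: truncation_def)
  then show ?thesis by simp
qed

lemma (in finite_measure) Lnorm_le_imp_Lp:
  fixes f :: "'a \<Rightarrow> 'k::{real_normed_field, euclidean_space}"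
  assumes f: "f \<in> borel_measurable M" and r: "0 < r" "q = ennreal r \<or> q = \<infinity>"
    and le: "Lnorm M q f \<le> ennreal c" "0 \<le> c"
  shows "f \<in> Lp M r \<and> (\<integral>t. norm (f t) powr r \<partial>M) \<le> c powr r * (measure M (space M) + 1)"
  using r(2)
proof
  assume q: "q = ennreal r"
  have fL: "f \<in> Lp M r" using f le q by (auto simp: Lp_def le_less_trans)
  then have "pnorm M r f \<le> c" using Lnorm_eq_pnorm[OF r(1) fL] le q by simp
  then have "(\<integral>t. norm (f t) powr r \<partial>M) \<le> c powr r" using r le by (simp add: pnorm_le_iff)
  also have "\<dots> \<le> c powr r * (measure M (space M) + 1)" by (simp add: algebra_simps)
  finally show ?thesis using fL by simp
next
  assume q: "q = \<infinity>"
  have "AE t in M. ennreal (norm (f t)) \<le> esssup M (\<lambda>t. ennreal (norm (f t)))" by (rule esssup_AE)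
  then have bd: "AE t in M. norm (f t) \<le> c"
  proof eventually_elim
    case (elim t)
    then have "ennreal (norm (f t)) \<le> ennreal c" using le(1) q by (auto simp: Lnorm_def)
    then show ?case using le(2) by simp
  qed
  then have bd': "AE t in M. norm (f t) powr r \<le> c powr r"
    by eventually_elim (use r in \<open>auto intro: powr_mono2\<close>)
  have i: "integrable M (\<lambda>t. norm (f t) powr r)"
    using bd' f by (intro integrable_const_bound[of _ "c powr r"]) auto
  then have fL: "f \<in> Lp M r" using f r by (simp add: Lp_iff)
  have "(\<integral>t. norm (f t) powr r \<partial>M) \<le> (\<integral>t. c powr r \<partial>M)"
    using i bd' by (intro integral_mono_AE) auto
  also have "\<dots> \<le> c powr r * (measure M (space M) + 1)" by (simp add: algebra_simps)
  finally show ?thesis using fL by simp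
qed

section \<open>Bases and projections\<close>

lemma infinite_dimensional_imp_infinite_domain:
  fixes X :: "('a \<Rightarrow> 'k::real_normed_field) set"
  assumes "infinite_dimensional M X"
  shows "infinite (UNIV :: 'a set)"
proof
  assume fin: "finite (UNIV :: 'a set)"
  define E :: "('a \<Rightarrow> 'k) set" where "E = range (\<lambda>a t. if t = a then 1 else 0)"
  have E: "finite E" unfolding E_def using fin by (rule finite_imageI)
  have span: "f \<in> pw.span E" for f :: "'a \<Rightarrow> 'k"
  proof -
    have "(\<Sum>a\<in>UNIV. f a *\<^sub>F (\<lambda>t. if t = a then 1 else 0)) \<in> pw.span E"
      by (intro pw.span_sum pw.span_scale pw.span_base) (auto simp: E_def)
    moreover have "(\<Sum>a\<in>UNIV. f a *\<^sub>F (\<lambda>t. if t = a then 1 else 0)) = f"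
    proof (rule ext)
      fix t
      have "(\<Sum>a\<in>UNIV. f a *\<^sub>F (\<lambda>t. if t = a then 1 else 0)) t = (\<Sum>a\<in>UNIV. if t = a then f a else 0)"
        unfolding sum_apply fscale_def by (intro sum.cong refl) simp
      then show "(\<Sum>a\<in>UNIV. f a *\<^sub>F (\<lambda>t. if t = a then 1 else 0)) t = f t" using fin by simp
    qed
    ultimately show ?thesis by simp
  qed
  obtain B where B: "B \<subseteq> X" "pw.independent B" "X \<subseteq> pw.span B"
    by (rule pw.maximal_independent_subset)
  have "finite B" using pw.independent_span_bound[OF E B(2)] span by blast
  then show False using assms B unfolding infinite_dimensional_def by blast
qed

locale biorthogonal_system =
  fixes M :: "'a measure" and p :: real and X :: "('a \<Rightarrow> 'k::{real_normed_field, euclidean_space}) set"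
    and J :: "'i set" and x :: "'i \<Rightarrow> 'a \<Rightarrow> 'k" and xs :: "'i \<Rightarrow> ('a \<Rightarrow> 'k) \<Rightarrow> 'k"
  assumes p: "1 < p" and X: "closed_subspace M p X" and xX: "\<And>j. j \<in> J \<Longrightarrow> x j \<in> X"
    and functionals: "coordinate_functionals M p X J x xs"
begin

lemma p1: "1 \<le> p" and p0: "0 < p" using p by auto
lemma XL: "X \<subseteq> Lp M p" and subspace: "pw.subspace X" using X by (auto simp: closed_subspace_def)
lemma XLp: "f \<in> X \<Longrightarrow> f \<in> Lp M p" using XL by blast
lemma xL: "j \<in> J \<Longrightarrow> x j \<in> Lp M p" by (rule XLp[OF xX])

lemma xs_functional: "j \<in> J \<Longrightarrow> bounded_functional M p X (xs j)"
  and xs_x: "j \<in> J \<Longrightarrow> k \<in> J \<Longrightarrow> xs j (x k) = (if j = k then 1 else 0)"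
  using functionals by (auto simp: coordinate_functionals_def)

lemma xs_add: "j \<in> J \<Longrightarrow> f \<in> X \<Longrightarrow> g \<in> X \<Longrightarrow> xs j (f + g) = xs j f + xs j g"
  and xs_scale: "j \<in> J \<Longrightarrow> f \<in> X \<Longrightarrow> xs j (c *\<^sub>F f) = c * xs j f"
  using xs_functional[of j] by (auto simp: bounded_functional_def)

lemma xs_diff:
  assumes "j \<in> J" "f \<in> X" "g \<in> X"
  shows "xs j (f - g) = xs j f - xs j g"
proof -
  have "xs j ((f - g) + g) = xs j (f - g) + xs j g"
    by (intro xs_add assms pw.subspace_diff[OF subspace])
  then show ?thesis by (simp only: diff_add_cancel eq_diff_eq)
qed

lemma xs_bound: "j \<in> J \<Longrightarrow> \<exists>C>0. \<forall>f\<in>X. norm (xs j f) \<le> C * pnorm M p f"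
proof -
  assume "j \<in> J"
  then obtain C where C: "0 \<le> C" "\<And>f. f \<in> X \<Longrightarrow> norm (xs j f) \<le> C * pnorm M p f"
    using bounded_functional_bound[OF p0 XL xs_functional] by blast
  have "norm (xs j f) \<le> (C + 1) * pnorm M p f" if "f \<in> X" for f
    using C(2)[OF that] pnorm_nonneg[of M p f] unfolding distrib_right by linarith
  moreover have "0 < C + 1" using C(1) by simp
  ultimately show ?thesis by blast
qed

text \<open>
  The element \<open>x\<^sub>j\<close> has distance at least \<open>1 / C\<^sub>k\<close> from \<open>x\<^sub>k\<close>, where \<open>C\<^sub>k\<close> bounds the \<open>k\<close>-th functional.
  So points of a countable dense set that are close enough to the \<open>x\<^sub>j\<close> differ for different \<open>j\<close>.
\<close>

lemma countable_index:
  assumes sep: "separable_in M p X"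
  shows "countable J"
proof -
  obtain D where D: "D \<subseteq> X" "countable D" "X \<subseteq> Lp_closure M p D" using sep by (auto simp: separable_in_def)
  obtain C where C: "\<And>j. j \<in> J \<Longrightarrow> 0 < C j" "\<And>j f. j \<in> J \<Longrightarrow> f \<in> X \<Longrightarrow> norm (xs j f) \<le> C j * pnorm M p f"
    using xs_bound by metis
  have "\<exists>d\<in>D. pnorm M p (x j - d) < 1 / (2 * C j)" if j: "j \<in> J" for j
  proof -
    have "x j \<in> Lp_closure M p D" using D(3) xX[OF j] by blast
    moreover have "0 < ennreal (1 / (2 * C j))" using C(1)[OF j] by simp
    ultimately obtain d where d: "d \<in> D" "Lnorm M (ennreal p) (x j - d) < ennreal (1 / (2 * C j))"
      unfolding Lp_closure_def by blast
    have "x j - d \<in> Lp M p" using d(1) D(1) by (intro Lp_diff p1 xL j XLp) auto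
    then have "pnorm M p (x j - d) < 1 / (2 * C j)"
      using d(2) by (simp add: Lnorm_eq_pnorm[OF p0] ennreal_less_iff)
    then show ?thesis using d(1) by blast
  qed
  then obtain d where d: "\<And>j. j \<in> J \<Longrightarrow> d j \<in> D" "\<And>j. j \<in> J \<Longrightarrow> pnorm M p (x j - d j) < 1 / (2 * C j)" by metis
  have apart: False if jk: "j \<in> J" "k \<in> J" "j \<noteq> k" "d j = d k" "C k \<le> C j" for j k
  proof -
    have dL: "d j \<in> Lp M p" using d(1)[OF jk(1)] D(1) XL by blast
    have "pnorm M p (x j - x k) \<le> pnorm M p (x j - d j) + pnorm M p (d j - x k)"
      by (intro pnorm_triangle_diff p1 xL jk dL)
    also have "pnorm M p (d j - x k) = pnorm M p (x k - d k)" unfolding jk(4) by (rule pnorm_minus_commute)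
    also have "pnorm M p (x j - d j) + pnorm M p (x k - d k) < 1 / (2 * C j) + 1 / (2 * C k)"
      by (intro add_strict_mono d jk)
    also have "\<dots> \<le> 1 / (2 * C k) + 1 / (2 * C k)"
      using C(1)[OF jk(1)] C(1)[OF jk(2)] jk(5) by (intro add_right_mono divide_left_mono) auto
    also have "\<dots> = 1 / C k" by simp
    finally have "pnorm M p (x j - x k) < 1 / C k" .
    then have "C k * pnorm M p (x j - x k) < 1" using C(1)[OF jk(2)] by (simp add: field_simps)
    moreover have "norm (xs k (x j - x k)) = 1"
      using jk by (simp add: xs_diff xX xs_x)
    moreover have "norm (xs k (x j - x k)) \<le> C k * pnorm M p (x j - x k)"
      by (intro C jk pw.subspace_diff[OF subspace] xX)
    ultimately show False by linarith
  qed
  have "inj_on d J"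
  proof (rule inj_onI, rule ccontr)
    fix j k assume "j \<in> J" "k \<in> J" "d j = d k" "j \<noteq> k"
    then show False using apart[of j k] apart[of k j] by (metis linear)
  qed
  moreover have "countable (d ` J)" using d(1) D(2) by (meson countable_subset image_subsetI)
  ultimately show ?thesis by (rule countable_image_inj_on[rotated])
qed

text \<open>
  Over a finite index set the remainder \<open>R\<close> of the expansion is bounded and vanishes on the span,
  hence it vanishes almost everywhere on its closure.
\<close>

lemma infinite_index:
  assumes dense: "Lp_closure M p (pw.span (x ` J)) = X" and inf: "infinite_dimensional M X"
  shows "infinite J"
proof
  assume J: "finite J"
  define R where "R f = f - (\<Sum>j\<in>J. xs j f *\<^sub>F x j)" for f
  have combination: "(\<Sum>j\<in>J. c j *\<^sub>F x j) \<in> X" for c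
    by (intro pw.subspace_sum[OF subspace] pw.subspace_scale[OF subspace] xX)
  have R_X: "R f \<in> X" if "f \<in> X" for f
    unfolding R_def using that by (intro pw.subspace_diff[OF subspace] combination)
  have R_diff: "R (f - g) = R f - R g" if "f \<in> X" "g \<in> X" for f g
  proof -
    have "(\<Sum>j\<in>J. xs j (f - g) *\<^sub>F x j) = (\<Sum>j\<in>J. xs j f *\<^sub>F x j) - (\<Sum>j\<in>J. xs j g *\<^sub>F x j)"
      unfolding sum_subtractf[symmetric]
      by (intro sum.cong refl) (simp only: xs_diff[OF _ that] pw.scale_left_diff_distrib)
    then show ?thesis unfolding R_def by (simp only:) (simp add: fun_eq_iff)
  qed
  have R_span: "g \<in> X \<and> R g = 0" if "g \<in> pw.span (x ` J)" for g
    using that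
  proof (induction rule: pw.span_induct_alt)
    case base
    have "(\<Sum>j\<in>J. xs j 0 *\<^sub>F x j) = (\<Sum>j\<in>J. 0)"
    proof (intro sum.cong refl)
      fix j assume j: "j \<in> J"
      have "xs j (0 *\<^sub>F 0) = 0 * xs j 0" by (intro xs_scale j pw.subspace_0[OF subspace])
      then show "xs j 0 *\<^sub>F x j = 0" by (simp only: pw.scale_zero_left mult_zero_left)
    qed
    then have "R 0 = 0" unfolding R_def by (simp only: sum.neutral_const diff_self)
    then show ?case using pw.subspace_0[OF subspace] by blast
  next
    case (step c u g)
    then obtain k where k: "k \<in> J" "u = x k" by blast
    have X: "c *\<^sub>F u \<in> X" "g \<in> X" "c *\<^sub>F u + g \<in> X"
      using step k xX pw.subspace_scale[OF subspace] pw.subspace_add[OF subspace] by auto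
    have "(\<Sum>j\<in>J. xs j (c *\<^sub>F u + g) *\<^sub>F x j) = (\<Sum>j\<in>J. xs j (c *\<^sub>F u) *\<^sub>F x j) + (\<Sum>j\<in>J. xs j g *\<^sub>F x j)"
      unfolding sum.distrib[symmetric]
      by (intro sum.cong refl) (simp only: xs_add[OF _ X(1,2)] pw.scale_left_distrib)
    moreover have "(\<Sum>j\<in>J. xs j (c *\<^sub>F u) *\<^sub>F x j) = (\<Sum>j\<in>J. if j = k then c *\<^sub>F x k else 0)"
    proof (intro sum.cong refl)
      fix j assume j: "j \<in> J"
      have "xs j (c *\<^sub>F u) = c * (if j = k then 1 else 0)"
        using j k by (simp add: xs_scale xX xs_x)
      then show "xs j (c *\<^sub>F u) *\<^sub>F x j = (if j = k then c *\<^sub>F x k else 0)"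
        by (cases "j = k") (simp_all only: if_True if_False mult_1_right mult_zero_right pw.scale_zero_left refl)
    qed
    moreover have "(\<Sum>j\<in>J. if j = k then c *\<^sub>F x k else 0) = c *\<^sub>F u" unfolding k(2) using J k(1) by simp
    ultimately have "(\<Sum>j\<in>J. xs j (c *\<^sub>F u + g) *\<^sub>F x j) = c *\<^sub>F u + g"
      using step unfolding R_def by (simp only: right_minus_eq)
    then show ?case using X(3) unfolding R_def by (simp only: diff_self)
  qed
  obtain C where C: "\<And>j. j \<in> J \<Longrightarrow> 0 < C j" "\<And>j f. j \<in> J \<Longrightarrow> f \<in> X \<Longrightarrow> norm (xs j f) \<le> C j * pnorm M p f"
    using xs_bound by metis
  define K where "K = 1 + (\<Sum>j\<in>J. C j * pnorm M p (x j))"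
  have K: "0 < K" unfolding K_def using C(1) by (intro add_pos_nonneg sum_nonneg mult_nonneg_nonneg) (auto intro: less_imp_le)
  have R_bound: "pnorm M p (R f) \<le> K * pnorm M p f" if f: "f \<in> X" for f
  proof -
    have "R f = f + - (\<Sum>j\<in>J. xs j f *\<^sub>F x j)" unfolding R_def by (simp only: diff_conv_add_uminus)
    then have "pnorm M p (R f) \<le> pnorm M p f + pnorm M p (- (\<Sum>j\<in>J. xs j f *\<^sub>F x j))"
      by (simp only:) (intro pnorm_triangle p1 XLp f pw.subspace_neg[OF subspace] combination)
    also have "pnorm M p (- (\<Sum>j\<in>J. xs j f *\<^sub>F x j)) \<le> (\<Sum>j\<in>J. pnorm M p (xs j f *\<^sub>F x j))"
      unfolding pnorm_minus by (intro pnorm_sum_le p1 Lp_fscale p0 xL)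
    also have "\<dots> \<le> (\<Sum>j\<in>J. C j * pnorm M p f * pnorm M p (x j))"
      unfolding pnorm_fscale[OF p0] by (intro sum_mono mult_right_mono C f) auto
    also have "\<dots> = (\<Sum>j\<in>J. C j * pnorm M p (x j)) * pnorm M p f"
      unfolding sum_distrib_right by (simp add: mult_ac)
    finally show ?thesis by (simp add: K_def distrib_right)
  qed
  have "\<exists>g\<in>pw.span (x ` J). AE t in M. f t = g t" if f: "f \<in> X" for f
  proof
    show "(\<Sum>j\<in>J. xs j f *\<^sub>F x j) \<in> pw.span (x ` J)"
      by (intro pw.span_sum pw.span_scale pw.span_base) auto
    have "pnorm M p (R f) \<le> 0 + e" if e: "0 < e" for e
    proof -
      have "f \<in> Lp_closure M p (pw.span (x ` J))" using dense f by simp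
      moreover have "0 < ennreal (e / K)" using e K by simp
      ultimately obtain g where g: "g \<in> pw.span (x ` J)" "Lnorm M (ennreal p) (f - g) < ennreal (e / K)"
        unfolding Lp_closure_def by blast
      have gX: "g \<in> X" "R g = 0" using R_span[OF g(1)] by auto
      have fg: "f - g \<in> X" by (intro pw.subspace_diff[OF subspace] f gX)
      have "pnorm M p (f - g) < e / K"
        using g(2) by (simp add: Lnorm_eq_pnorm[OF p0 XLp[OF fg]] ennreal_less_iff)
      moreover have "R f = R (f - g)" unfolding R_diff[OF f gX(1)] gX(2) by (simp only: diff_zero)
      ultimately show ?thesis using R_bound[OF fg] K by (simp add: field_simps)
    qed
    then have "pnorm M p (R f) \<le> 0" by (rule field_le_epsilon)
    then have "pnorm M p (R f) = 0" using pnorm_nonneg[of M p "R f"] by linarith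
    then have "AE t in M. R f t = 0" using pnorm_eq_0_iff[OF p0 XLp[OF R_X[OF f]]] by blast
    then show "AE t in M. f t = (\<Sum>j\<in>J. xs j f *\<^sub>F x j) t"
      by eventually_elim (simp add: R_def)
  qed
  moreover have "x ` J \<subseteq> X" "finite (x ` J)" using xX J by auto
  ultimately show False using inf unfolding infinite_dimensional_def by blast
qed

end

context unconditional_sequence
begin

text \<open>
  The functionals \<open>x\<^sub>k\<^sup>* \<circ> P\<close>.  They are linear on functions although \<open>P\<close> is linear only almost
  everywhere, because bounded functionals do not see null sets.
\<close>

theorem complemented_imp_extended_functionals:
  assumes "complemented M p X"
  obtains L :: "nat \<Rightarrow> ('a \<Rightarrow> 'k) \<Rightarrow> 'k" and K' where
    "\<And>k g h. g \<in> Lp M p \<Longrightarrow> h \<in> Lp M p \<Longrightarrow> L k (g + h) = L k g + L k h"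
    "\<And>k c g. g \<in> Lp M p \<Longrightarrow> L k (c *\<^sub>F g) = c * L k g"
    "\<And>k f. f \<in> X \<Longrightarrow> L k f = xs k f"
    "0 < K'" "\<And>A F g. finite F \<Longrightarrow> g \<in> Lp M p \<Longrightarrow> pnorm M p (signed_sum F (\<lambda>k. L k g) x A) \<le> K' * pnorm M p g"
proof -
  obtain P where P: "bounded_operator M p P" "\<forall>f\<in>Lp M p. AE t in M. P (P f) t = P f t"
    "X = {g \<in> Lp M p. \<exists>f\<in>Lp M p. AE t in M. g t = P f t}"
    using assms unfolding complemented_def by blast
  have PL: "P f \<in> Lp M p" if "f \<in> Lp M p" for f using P(1) that unfolding bounded_operator_def by blast
  have PX: "P f \<in> X" if "f \<in> Lp M p" for f using P(3) PL[OF that] that by auto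
  have P_add: "AE t in M. P (f + g) t = (P f + P g) t" if "f \<in> Lp M p" "g \<in> Lp M p" for f g
    using P(1) that unfolding bounded_operator_def plus_fun_apply by blast
  have P_scale: "AE t in M. P (c *\<^sub>F f) t = (c *\<^sub>F P f) t" if "f \<in> Lp M p" for c f
    using P(1) that unfolding bounded_operator_def fscale_def by blast
  obtain C where C: "\<And>f. f \<in> Lp M p \<Longrightarrow> Lnorm M (ennreal p) (P f) \<le> ennreal C * Lnorm M (ennreal p) f"
    using P(1) unfolding bounded_operator_def by blast
  define C' where "C' = max C 1"
  have C': "0 < C'" by (simp add: C'_def)
  have P_bound: "pnorm M p (P f) \<le> C' * pnorm M p f" if f: "f \<in> Lp M p" for f
  proof -
    have "ennreal (pnorm M p (P f)) \<le> ennreal C * ennreal (pnorm M p f)"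
      using C[OF f] unfolding Lnorm_eq_pnorm[OF p0 f] Lnorm_eq_pnorm[OF p0 PL[OF f]] .
    also have "\<dots> \<le> ennreal C' * ennreal (pnorm M p f)"
      by (intro mult_right_mono ennreal_leI) (auto simp: C'_def)
    also have "\<dots> = ennreal (C' * pnorm M p f)" by (simp add: ennreal_mult'')
    finally show ?thesis using C' by (subst (asm) ennreal_le_iff) auto
  qed
  have xs_cong: "xs k u = xs k v" if uv: "u \<in> X" "v \<in> X" and ae: "AE t in M. u t = v t" for k u v
  proof -
    obtain B where B: "\<And>f. f \<in> X \<Longrightarrow> norm (xs k f) \<le> B * pnorm M p f" using xs_bound by blast
    have d: "u - v \<in> X" using subspace uv by (rule pw.subspace_diff)
    have "AE t in M. (u - v) t = 0" using ae by eventually_elim simp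
    then have "pnorm M p (u - v) = 0" using pnorm_eq_0_iff[OF p0 XLp[OF d]] by blast
    then have "norm (xs k (u - v)) \<le> 0" using B[OF d] by simp
    moreover have "xs k ((u - v) + v) = xs k (u - v) + xs k v" by (intro xs_add d uv)
    ultimately show ?thesis by (simp only: diff_add_cancel norm_le_zero_iff add_0)
  qed
  have P_X: "AE t in M. P f t = f t" if f: "f \<in> X" for f
  proof -
    obtain g where g: "g \<in> Lp M p" "AE t in M. f t = P g t" using f P(3) by auto
    have d: "f - P g \<in> Lp M p" by (intro Lp_diff p1 XLp f PL g)
    have "AE t in M. (f - P g) t = 0" using g(2) by eventually_elim simp
    then have "pnorm M p (f - P g) = 0" using pnorm_eq_0_iff[OF p0 d] by blast
    then have "pnorm M p (P (f - P g)) = 0" using P_bound[OF d] pnorm_nonneg[of M p "P (f - P g)"] by simp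
    then have "AE t in M. P (f - P g) t = 0" using pnorm_eq_0_iff[OF p0 PL[OF d]] by blast
    moreover have "AE t in M. P ((f - P g) + P g) t = (P (f - P g) + P (P g)) t"
      by (intro P_add d PL g)
    moreover have "AE t in M. P (P g) t = P g t" using P(2) g by blast
    ultimately show ?thesis using g(2) unfolding diff_add_cancel by eventually_elim simp
  qed
  obtain K where K: "0 < K"
    and K1: "\<And>A F f. f \<in> X \<Longrightarrow> finite F \<Longrightarrow> pnorm M p (signed_sum F (\<lambda>j. xs j f) x A) \<le> K * pnorm M p f"
    and K2: "\<And>A F a. finite F \<Longrightarrow> pnorm M p (\<Sum>j\<in>F. a j *\<^sub>F x j) \<le> K * pnorm M p (signed_sum F a x A)"
    by (rule signed_sum_comparable, rule that)
  show thesis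
  proof (rule that[of "\<lambda>k g. xs k (P g)" "K * C'"])
    fix k :: nat and g h :: "'a \<Rightarrow> 'k" assume gh: "g \<in> Lp M p" "h \<in> Lp M p"
    have "xs k (P (g + h)) = xs k (P g + P h)"
      by (intro xs_cong PX Lp_add p1 gh pw.subspace_add[OF subspace] P_add)
    then show "xs k (P (g + h)) = xs k (P g) + xs k (P h)" by (simp only: xs_add PX gh)
  next
    fix k :: nat and c and g :: "'a \<Rightarrow> 'k" assume g: "g \<in> Lp M p"
    have "xs k (P (c *\<^sub>F g)) = xs k (c *\<^sub>F P g)"
      by (intro xs_cong PX Lp_fscale p0 g pw.subspace_scale[OF subspace] P_scale)
    then show "xs k (P (c *\<^sub>F g)) = c * xs k (P g)" by (simp only: xs_scale PX g)
  next
    fix k f assume f: "f \<in> X"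
    show "xs k (P f) = xs k f" by (intro xs_cong PX XLp f P_X)
  next
    show "0 < K * C'" using K C' by simp
  next
    fix A F and g :: "'a \<Rightarrow> 'k" assume F: "finite (F :: nat set)" and g: "g \<in> Lp M p"
    have "pnorm M p (signed_sum F (\<lambda>k. xs k (P g)) x A) \<le> K * pnorm M p (P g)" by (intro K1 PX g F)
    also have "\<dots> \<le> K * (C' * pnorm M p g)" using K by (intro mult_left_mono P_bound g) auto
    finally show "pnorm M p (signed_sum F (\<lambda>k. xs k (P g)) x A) \<le> K * C' * pnorm M p g" by (simp add: mult.assoc)
  qed
qed

end

section \<open>Bases that do not concentrate\<close>

context unconditional_sequence
begin

lemma hilbertian_of_l2_estimates:
  assumes "scalar_conjugation cj" and "infinite (UNIV :: 'a set)"
    and "\<exists>C\<ge>0. \<forall>F f. finite F \<and> f \<in> X \<longrightarrow>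
      (\<Sum>j\<in>F. (norm (xs j f))\<^sup>2) \<le> C * (pnorm M p f)\<^sup>2 \<and>
      (pnorm M p (\<Sum>j\<in>F. xs j f *\<^sub>F x j))\<^sup>2 \<le> C * (\<Sum>j\<in>F. (norm (xs j f))\<^sup>2)"
  shows "hilbertian cj M p X"
proof -
  obtain C where C: "0 \<le> C" and est: "\<forall>F f. finite F \<and> f \<in> X \<longrightarrow>
      (\<Sum>j\<in>F. (norm (xs j f))\<^sup>2) \<le> C * (pnorm M p f)\<^sup>2 \<and>
      (pnorm M p (\<Sum>j\<in>F. xs j f *\<^sub>F x j))\<^sup>2 \<le> C * (\<Sum>j\<in>F. (norm (xs j f))\<^sup>2)"
    using assms(3) by (elim exE conjE) (rule that)
  have "l2_basis M p X x xs C"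
    by (intro l2_basis.intro unconditional_sequence_axioms l2_basis_axioms.intro C)
      (simp_all only: est[rule_format] conjI)
  then show ?thesis using assms(1,2) by (rule l2_basis.hilbertian_of_l2_basis)
qed

text \<open>
  Finitely many exceptional indices are harmless, since no basis vector vanishes almost everywhere.
\<close>

lemma hilbertian_of_second_moments:
  assumes "finite_measure M" and p2: "2 < p"
    and cj: "scalar_conjugation cj" and inf: "infinite (UNIV :: 'a set)"
    and B: "\<And>j. pnorm M p (x j) \<le> B" and b: "\<And>j. pnorm M p (x j) \<noteq> 0"
    and E: "finite E" and d: "0 < d" "\<And>j. j \<notin> E \<Longrightarrow> d \<le> (\<integral>t. norm (x j t) powr 2 \<partial>M)"
  shows "hilbertian cj M p X"
proof -
  interpret finite_measure M by fact
  let ?I = "\<lambda>j. \<integral>t. norm (x j t) powr 2 \<partial>M"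
  have xL2: "x j \<in> Lp M 2" for j
    by (rule lower_power_integral(1)[OF _ _ xL zero_less_one]) (use p2 in auto)
  have pos: "0 < ?I j" for j
  proof -
    have "?I j \<noteq> 0"
    proof
      assume "?I j = 0"
      then have "pnorm M 2 (x j) = 0" by (simp add: pnorm_def)
      then have "AE t in M. x j t = 0" using pnorm_eq_0_iff[OF _ xL2] by simp
      then show False using b[of j] pnorm_eq_0_iff[OF p0 xL] by blast
    qed
    moreover have "0 \<le> ?I j" by (intro Bochner_Integration.integral_nonneg) simp
    ultimately show ?thesis by linarith
  qed
  define d' where "d' = Min (insert d (?I ` E))"
  have fin: "finite (insert d (?I ` E))" using E by simp
  have "0 < d'" unfolding d'_def using fin d(1) pos by (subst Min_gr_iff) auto
  moreover have "d' \<le> ?I j" for j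
  proof (cases "j \<in> E")
    case True
    then show ?thesis unfolding d'_def by (intro Min_le fin) simp
  next
    case False
    have "d' \<le> d" unfolding d'_def by (intro Min_le fin) simp
    then show ?thesis using d(2)[OF False] by linarith
  qed
  ultimately have "\<exists>C\<ge>0. \<forall>F f. finite F \<and> f \<in> X \<longrightarrow>
      (\<Sum>j\<in>F. (norm (xs j f))\<^sup>2) \<le> C * (pnorm M p f)\<^sup>2 \<and>
      (pnorm M p (\<Sum>j\<in>F. xs j f *\<^sub>F x j))\<^sup>2 \<le> C * (\<Sum>j\<in>F. (norm (xs j f))\<^sup>2)"
    using p2 by (intro l2_estimates_above_2[where B = B and d = d'] \<open>finite_measure M\<close> B) auto
  with cj inf show ?thesis by (rule hilbertian_of_l2_estimates)
qed

theorem hilbertian_of_norms_bounded_below: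
  assumes fm: "finite_measure M" and p2: "2 < p"
    and cj: "scalar_conjugation cj" and inf: "infinite (UNIV :: 'a set)"
    and B: "\<And>j. pnorm M p (x j) \<le> B" and b: "\<And>j. pnorm M p (x j) \<noteq> 0"
    and q: "0 < q" "q < p" and E: "finite E"
    and c: "0 < c" "\<And>j. j \<notin> E \<Longrightarrow> c \<le> (\<integral>t. norm (x j t) powr q \<partial>M)"
  shows "hilbertian cj M p X"
proof -
  interpret finite_measure M by fact
  have B0: "0 \<le> B" using order_trans[OF pnorm_nonneg B] .
  have xL2: "x j \<in> Lp M 2" for j
    by (rule lower_power_integral(1)[OF _ _ xL zero_less_one]) (use p2 in auto)
  obtain d where d: "0 < d" "\<forall>f :: 'a \<Rightarrow> 'k. f \<in> Lp M p \<and> f \<in> Lp M 2 \<and>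
      (\<integral>t. norm (f t) powr p \<partial>M) \<le> B powr p \<and> c \<le> (\<integral>t. norm (f t) powr q \<partial>M) \<longrightarrow>
      d \<le> (\<integral>t. norm (f t) powr 2 \<partial>M)"
    using second_moment_lower_bound[OF q c(1), of "B powr p", where 'k = 'k] by auto
  have "d \<le> (\<integral>t. norm (x j t) powr 2 \<partial>M)" if j: "j \<notin> E" for j
    using B[of j] c(2)[OF j] by (intro d(2)[rule_format] conjI xL xL2) (simp_all add: pnorm_le_iff[OF p0 B0])
  with fm p2 cj inf B b E d(1) show ?thesis by (rule hilbertian_of_second_moments)
qed

text \<open>
  For \<open>p > 2\<close> the norms in \<open>L\<^sub>p\<close> and \<open>L\<^sub>q\<close> bound the second moments from below.  For \<open>p < 2\<close> the bound in \<open>L\<^sub>q\<close>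
  makes one truncation level suffice for all but finitely many basis vectors, and each of the others has a
  level of its own.
\<close>

theorem hilbertian_of_norms_bounded_above:
  assumes fm: "finite_measure M" and p2: "p \<noteq> 2" and comp: "complemented M p X"
    and cj: "scalar_conjugation cj" and inf: "infinite (UNIV :: 'a set)"
    and B: "\<And>j. pnorm M p (x j) \<le> B" and b: "0 < b" "\<And>j. b \<le> pnorm M p (x j)"
    and q: "p < q" and E: "finite E"
    and xq: "\<And>j. j \<notin> E \<Longrightarrow> x j \<in> Lp M q" and D: "\<And>j. j \<notin> E \<Longrightarrow> (\<integral>t. norm (x j t) powr q \<partial>M) \<le> D"
  shows "hilbertian cj M p X"
proof -
  interpret finite_measure M by fact
  have q0: "0 < q" using p0 q by linarith
  have bp: "0 < b powr p" using b(1) by simp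
  define D' where "D' = max D 1"
  have D': "0 < D'" "\<And>j. j \<notin> E \<Longrightarrow> (\<integral>t. norm (x j t) powr q \<partial>M) \<le> D'"
    using D by (auto simp: D'_def intro: max.coboundedI1)
  have bx: "b powr p \<le> (\<integral>t. norm (x j t) powr p \<partial>M)" for j
    unfolding pnorm_powr[OF p0, symmetric] using b p0 by (intro powr_mono2) auto
  have ne: "pnorm M p (x j) \<noteq> 0" for j using b(1) b(2)[of j] by linarith
  show ?thesis
  proof (cases "2 < p")
    case True
    have xL2: "x j \<in> Lp M 2" for j
      by (rule lower_power_integral(1)[OF _ _ xL zero_less_one]) (use True in auto)
    obtain d where d: "0 < d" "\<forall>f :: 'a \<Rightarrow> 'k. f \<in> Lp M q \<and> f \<in> Lp M 2 \<and>
        (\<integral>t. norm (f t) powr q \<partial>M) \<le> D' \<and> b powr p \<le> (\<integral>t. norm (f t) powr p \<partial>M) \<longrightarrow>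
        d \<le> (\<integral>t. norm (f t) powr 2 \<partial>M)"
      using second_moment_lower_bound[OF p0 q bp, of D', where 'k = 'k] D'(1) by auto
    have "d \<le> (\<integral>t. norm (x j t) powr 2 \<partial>M)" if j: "j \<notin> E" for j
      by (intro d(2)[rule_format] conjI xq xL2 D' bx j)
    with fm True cj inf B ne E d(1) show ?thesis by (rule hilbertian_of_second_moments)
  next
    case False
    then have p2': "p \<le> 2" using p2 by simp
    have approx: "\<exists>\<kappa>. \<forall>j. \<exists>f\<in>borel_measurable M. (\<forall>t. norm (f t) \<le> \<kappa>) \<and> pnorm M p (x j - f) \<le> \<delta>"
      if \<delta>: "0 < \<delta>" for \<delta>
    proof -
      have \<delta>p: "0 < \<delta> powr p" using \<delta> by simp
      define \<kappa>0 where "\<kappa>0 = (\<delta> powr p / D') powr (1 / (p - q))"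
      have \<kappa>0: "0 < \<kappa>0" "\<kappa>0 powr (p - q) * D' = \<delta> powr p"
        using \<delta> D'(1) q by (simp_all add: \<kappa>0_def powr_powr)
      have "\<exists>n :: nat. (\<integral>t. norm ((x j - truncation (real n) (x j)) t) powr p \<partial>M) < \<delta> powr p" for j
        using order_tendstoD(2)[OF truncation_error_tendsto_0[OF p0 xL] \<delta>p]
        by (rule eventually_happens'[OF sequentially_bot])
      then obtain n :: "nat \<Rightarrow> nat" where
        n: "\<And>j. (\<integral>t. norm ((x j - truncation (real (n j)) (x j)) t) powr p \<partial>M) < \<delta> powr p" by metis
      define \<kappa> where "\<kappa> = Max (insert \<kappa>0 ((\<lambda>j. real (n j)) ` E))"
      have fin: "finite (insert \<kappa>0 ((\<lambda>j. real (n j)) ` E))" using E by simp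
      have "\<exists>f\<in>borel_measurable M. (\<forall>t. norm (f t) \<le> \<kappa>) \<and> pnorm M p (x j - f) \<le> \<delta>" for j
      proof -
        define l where "l = (if j \<in> E then real (n j) else \<kappa>0)"
        have l0: "0 \<le> l" using \<kappa>0(1) by (simp add: l_def)
        have "l \<le> \<kappa>" unfolding \<kappa>_def by (intro Max_ge fin) (auto simp: l_def)
        then have "norm (truncation l (x j) t) \<le> \<kappa>" for t
          using norm_truncation_le[OF l0, of "x j" t] by linarith
        moreover have "(\<integral>t. norm ((x j - truncation l (x j)) t) powr p \<partial>M) \<le> \<delta> powr p"
        proof (cases "j \<in> E")
          case True
          then show ?thesis using n[of j] by (simp add: l_def)
        next
          case False
          have "(\<integral>t. norm ((x j - truncation \<kappa>0 (x j)) t) powr p \<partial>M)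
              \<le> \<kappa>0 powr (p - q) * (\<integral>t. norm (x j t) powr q \<partial>M)"
            by (intro truncation_error_uniform p0 q \<kappa>0(1) xL xq False)
          also have "\<dots> \<le> \<kappa>0 powr (p - q) * D'" by (intro mult_left_mono D' False) simp
          finally show ?thesis using False \<kappa>0(2) by (simp add: l_def)
        qed
        then have "pnorm M p (x j - truncation l (x j)) \<le> \<delta>" using \<delta> by (subst pnorm_le_iff[OF p0]) auto
        moreover have "truncation l (x j) \<in> borel_measurable M"
          by (intro truncation_measurable Lp_measurable[OF xL])
        ultimately show ?thesis by blast
      qed
      then show ?thesis by blast
    qed
    show ?thesis
    proof (rule complemented_imp_extended_functionals[OF comp])
      fix L K'
      assume L: "\<And>k g h. g \<in> Lp M p \<Longrightarrow> h \<in> Lp M p \<Longrightarrow> L k (g + h) = L k g + L k h"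
        "\<And>k c g. g \<in> Lp M p \<Longrightarrow> L k (c *\<^sub>F g) = c * L k g"
        "\<And>k f. f \<in> X \<Longrightarrow> L k f = xs k f"
        "0 < K'" "\<And>A F g. finite F \<Longrightarrow> g \<in> Lp M p \<Longrightarrow> pnorm M p (signed_sum F (\<lambda>k. L k g) x A) \<le> K' * pnorm M p g"
      have "\<exists>C\<ge>0. \<forall>F f. finite F \<and> f \<in> X \<longrightarrow>
          (\<Sum>j\<in>F. (norm (xs j f))\<^sup>2) \<le> C * (pnorm M p f)\<^sup>2 \<and>
          (pnorm M p (\<Sum>j\<in>F. xs j f *\<^sub>F x j))\<^sup>2 \<le> C * (\<Sum>j\<in>F. (norm (xs j f))\<^sup>2)"
        by (rule l2_estimates_below_2[of b L K', OF fm p2' b approx L])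
      with cj inf show ?thesis by (rule hilbertian_of_l2_estimates)
    qed
  qed
qed

end

section \<open>Unconditional bases of complemented subspaces\<close>

lemma unconditional_basis_sequence:
  fixes X :: "('a \<Rightarrow> 'k::{real_normed_field, euclidean_space}) set"
  assumes p: "1 < p" and X: "closed_subspace M p X" and basis: "unconditional_basis M p X J x"
  obtains \<pi> :: "nat \<Rightarrow> 'i" and xs where "bij_betw \<pi> UNIV J"
    "unconditional_sequence M p X (\<lambda>n. x (\<pi> n)) xs"
proof -
  obtain xs where xs: "coordinate_functionals M p X J x xs"
    and conv: "\<And>f \<pi>. f \<in> X \<Longrightarrow> bij_betw \<pi> (UNIV :: nat set) J \<Longrightarrow>
      (\<lambda>N. Lnorm M (ennreal p) (f - (\<Sum>n<N. xs (\<pi> n) f *\<^sub>F x (\<pi> n)))) \<longlonglongrightarrow> 0"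
    using basis unfolding unconditional_basis_def by blast
  have b: "infinite_dimensional M X" "separable_in M p X" "\<And>j. j \<in> J \<Longrightarrow> x j \<in> X"
    "Lp_closure M p (pw.span (x ` J)) = X"
    using basis unfolding unconditional_basis_def basis_def by blast+
  interpret biorthogonal_system M p X J x xs by unfold_locales (use p X b xs in auto)
  have "countable J" "infinite J" using countable_index[OF b(2)] infinite_index[OF b(4,1)] .
  then obtain \<pi> where \<pi>: "bij_betw \<pi> (UNIV :: nat set) J"
    using bij_betw_from_nat_into by blast
  have J: "\<pi> n \<in> J" for n using \<pi> by (auto simp: bij_betw_def)
  have inj: "\<pi> m = \<pi> n \<longleftrightarrow> m = n" for m n using \<pi> by (auto simp: bij_betw_def inj_on_def)
  have "unconditional_sequence M p X (\<lambda>n. x (\<pi> n)) (\<lambda>n. xs (\<pi> n))"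
  proof
    fix f \<sigma> assume f: "f \<in> X" and \<sigma>: "bij (\<sigma> :: nat \<Rightarrow> nat)"
    have "bij_betw (\<pi> \<circ> \<sigma>) UNIV J" by (rule bij_betw_trans[OF \<sigma> \<pi>])
    then have lim: "(\<lambda>N. Lnorm M (ennreal p) (f - (\<Sum>n<N. xs (\<pi> (\<sigma> n)) f *\<^sub>F x (\<pi> (\<sigma> n))))) \<longlonglongrightarrow> 0"
      using conv[OF f, of "\<pi> \<circ> \<sigma>"] by (simp only: o_apply)
    have mem: "f - (\<Sum>n<N. xs (\<pi> (\<sigma> n)) f *\<^sub>F x (\<pi> (\<sigma> n))) \<in> Lp M p" for N
      by (intro Lp_diff Lp_sum Lp_fscale p1 p0 XLp f xL J)
    show "(\<lambda>N. pnorm M p (f - (\<Sum>n<N. xs (\<pi> (\<sigma> n)) f *\<^sub>F x (\<pi> (\<sigma> n))))) \<longlonglongrightarrow> 0"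
      using lim unfolding Lnorm_eq_pnorm[OF p0 mem]
      by (subst (asm) ennreal_0[symmetric], subst (asm) tendsto_ennreal_iff) auto
  qed (use p X b(3) J xs_functional xs_x inj in auto)
  with \<pi> show thesis by (rule that)
qed

text \<open>
  A finite upper limit, or a positive lower limit, is a bound on the norms of all but finitely many
  basis vectors, which would make the space Hilbertian.
\<close>

theorem basis_norms_limsup_liminf:
  fixes X :: "('a \<Rightarrow> 'k::{real_normed_field, euclidean_space}) set" and x :: "'i \<Rightarrow> 'a \<Rightarrow> 'k"
  assumes fm: "finite_measure M" and p: "1 < p" and p2: "p \<noteq> 2"
    and cj: "scalar_conjugation cj"
    and X: "closed_subspace M p X" and nh: "\<not> hilbertian cj M p X" and comp: "complemented M p X"
    and basis: "unconditional_basis M p X J x" and sn: "semi_normalized M p J x"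
  shows "(\<forall>q. ennreal p < q \<longrightarrow> limsup_on J (\<lambda>j. Lnorm M q (x j)) = \<infinity>) \<and>
    (\<forall>q. 0 < q \<and> max q 2 < ennreal p \<longrightarrow> liminf_on J (\<lambda>j. Lnorm M q (x j)) = 0)"
proof -
  interpret finite_measure M by fact
  obtain \<pi> :: "nat \<Rightarrow> 'i" and xs where \<pi>: "bij_betw \<pi> UNIV J"
    and seq: "unconditional_sequence M p X (\<lambda>n. x (\<pi> n)) xs"
    by (rule unconditional_basis_sequence[OF p X basis])
  interpret unconditional_sequence M p X "\<lambda>n. x (\<pi> n)" xs by (rule seq)
  have J: "\<pi> n \<in> J" for n using \<pi> by (auto simp: bij_betw_def)
  have inj: "inj \<pi>" using \<pi> by (auto simp: bij_betw_def)
  have inf: "infinite (UNIV :: 'a set)"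
    using basis unfolding unconditional_basis_def basis_def by (intro infinite_dimensional_imp_infinite_domain) blast
  have N: "Lnorm M (ennreal p) (x (\<pi> n)) = ennreal (pnorm M p (x (\<pi> n)))" for n
    by (rule Lnorm_eq_pnorm[OF p0 xL])
  obtain b where b: "0 < b" "\<And>n. b \<le> pnorm M p (x (\<pi> n))"
  proof -
    obtain e where e: "0 < e" "e < (INF j\<in>J. Lnorm M (ennreal p) (x j))"
      using sn unfolding semi_normalized_def by (meson dense)
    have "e < ennreal (pnorm M p (x (\<pi> n)))" for n
      unfolding N[symmetric] by (rule less_INF_D[OF e(2) J])
    moreover obtain b where "e = ennreal b" "0 \<le> b" using e(2) by (cases e) auto
    ultimately show thesis using e(1) by (intro that[of b]) (auto simp: ennreal_less_iff less_imp_le)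
  qed
  obtain B where B: "\<And>n. pnorm M p (x (\<pi> n)) \<le> B"
  proof -
    obtain B where B: "(SUP j\<in>J. Lnorm M (ennreal p) (x j)) = ennreal B" "0 \<le> B"
      using sn unfolding semi_normalized_def by (cases "SUP j\<in>J. Lnorm M (ennreal p) (x j)") auto
    have "ennreal (pnorm M p (x (\<pi> n))) \<le> ennreal B" for n
      unfolding N[symmetric] B(1)[symmetric] by (rule SUP_upper[OF J])
    then show thesis using B(2) by (intro that[of B]) simp
  qed
  have ne: "pnorm M p (x (\<pi> n)) \<noteq> 0" for n using b(1) b(2)[of n] by linarith
  have "limsup_on J (\<lambda>j. Lnorm M q (x j)) = \<infinity>" if q: "ennreal p < q" for q
  proof (rule ccontr)
    assume "limsup_on J (\<lambda>j. Lnorm M q (x j)) \<noteq> \<infinity>"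
    then have "limsup_on J (\<lambda>j. Lnorm M q (x j)) < \<infinity>" by (simp add: less_top)
    then obtain F where F: "finite F" "(SUP j\<in>J - F. Lnorm M q (x j)) < \<infinity>"
      unfolding limsup_on_def by (auto simp: INF_less_iff)
    then obtain c where c: "(SUP j\<in>J - F. Lnorm M q (x j)) = ennreal c" "0 \<le> c"
      by (cases "SUP j\<in>J - F. Lnorm M q (x j)") auto
    have le: "Lnorm M q (x j) \<le> ennreal c" if "j \<in> J - F" for j
      unfolding c(1)[symmetric] by (rule SUP_upper[OF that])
    obtain r where r: "p < r" "q = ennreal r \<or> q = \<infinity>"
    proof (cases "q = \<infinity>")
      case True
      then show thesis by (intro that[of "p + 1"]) auto
    next
      case False
      then obtain r where "q = ennreal r" "0 \<le> r" by (cases q) auto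
      then show thesis using q p0 by (intro that[of r]) (auto simp: ennreal_less_iff)
    qed
    have r0: "0 < r" using p0 r by linarith
    define E where "E = {n. \<pi> n \<in> F}"
    have E: "finite E" unfolding E_def using finite_vimageI[OF F(1) inj] by (simp add: vimage_def)
    have xr: "x (\<pi> n) \<in> Lp M r \<and> (\<integral>t. norm (x (\<pi> n) t) powr r \<partial>M) \<le> c powr r * (measure M (space M) + 1)"
      if "n \<notin> E" for n
      using that J by (intro Lnorm_le_imp_Lp[OF Lp_measurable[OF xL] r0 r(2) le c(2)]) (simp add: E_def)
    have "hilbertian cj M p X"
      by (rule hilbertian_of_norms_bounded_above[OF fm p2 comp cj inf B b r(1) E conjunct1[OF xr] conjunct2[OF xr]])
    then show False using nh by contradiction
  qed
  moreover have "liminf_on J (\<lambda>j. Lnorm M q (x j)) = 0" if q: "0 < q" "max q 2 < ennreal p" for q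
  proof (rule ccontr)
    assume "liminf_on J (\<lambda>j. Lnorm M q (x j)) \<noteq> 0"
    then have "0 < liminf_on J (\<lambda>j. Lnorm M q (x j))" by (simp add: zero_less_iff_neq_zero)
    then obtain F where F: "finite F" "0 < (INF j\<in>J - F. Lnorm M q (x j))"
      unfolding liminf_on_def by (auto simp: less_SUP_iff)
    obtain e where e: "0 < e" "e < (INF j\<in>J - F. Lnorm M q (x j))" using dense[OF F(2)] by blast
    obtain c where c: "e = ennreal c" "0 \<le> c" using e(2) by (cases e) auto
    have c0: "0 < c" using e(1) c by simp
    obtain r where r: "q = ennreal r" "0 \<le> r" using q(2) by (cases q) auto
    have r0: "0 < r" and rp: "r < p" using q r p0 by (auto simp: ennreal_less_iff)
    have "ennreal 2 < ennreal p" using q(2) by simp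
    then have p2': "2 < p" by (subst (asm) ennreal_less_iff) auto
    define E where "E = {n. \<pi> n \<in> F}"
    have E: "finite E" unfolding E_def using finite_vimageI[OF F(1) inj] by (simp add: vimage_def)
    have low: "c powr r \<le> (\<integral>t. norm (x (\<pi> n) t) powr r \<partial>M)" if n: "n \<notin> E" for n
    proof -
      have "x (\<pi> n) \<in> Lp M r"
        by (rule lower_power_integral(1)[OF r0 _ xL zero_less_one]) (use rp in simp)
      then have "ennreal c < ennreal (pnorm M r (x (\<pi> n)))"
        using less_INF_D[OF e(2), of "\<pi> n"] n J unfolding r(1) c(1) by (simp add: E_def Lnorm_eq_pnorm[OF r0])
      then have "c \<le> pnorm M r (x (\<pi> n))" using c(2) by (simp add: ennreal_less_iff)
      then show ?thesis unfolding pnorm_powr[OF r0, symmetric] using c(2) r0 by (intro powr_mono2) auto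
    qed
    have "0 < c powr r" using c0 by simp
    then have "hilbertian cj M p X"
      using low by (rule hilbertian_of_norms_bounded_below[OF fm p2' cj inf B ne r0 rp E])
    then show False using nh by contradiction
  qed
  ultimately show ?thesis by blast
qed

lemma scalar_conjugation_real: "scalar_conjugation (\<lambda>a :: real. a)"
  by (intro scalar_conjugation.intro bounded_linear_ident) (auto simp: power2_eq_square)

lemma scalar_conjugation_complex: "scalar_conjugation cnj"
  by (intro scalar_conjugation.intro bounded_linear_cnj) (auto simp: complex_mult_cnj cmod_power2)

theorem theorem1p2:
  fixes M :: "'a measure" and p :: real and J :: "'i set"
  assumes "finite_measure M" and "1 < p" and "p \<noteq> 2"
  shows
    "(\<forall>(X :: ('a \<Rightarrow> real) set) x.
        closed_subspace M p X \<and> \<not> hilbertian (\<lambda>a. a) M p X \<and> complemented M p X \<and>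
        unconditional_basis M p X J x \<and> semi_normalized M p J x \<longrightarrow>
          (\<forall>q. ennreal p < q \<longrightarrow> limsup_on J (\<lambda>j. Lnorm M q (x j)) = \<infinity>) \<and>
          (\<forall>q. 0 < q \<and> max q 2 < ennreal p \<longrightarrow> liminf_on J (\<lambda>j. Lnorm M q (x j)) = 0)) \<and>
     (\<forall>(X :: ('a \<Rightarrow> complex) set) x.
        closed_subspace M p X \<and> \<not> hilbertian cnj M p X \<and> complemented M p X \<and>
        unconditional_basis M p X J x \<and> semi_normalized M p J x \<longrightarrow>
          (\<forall>q. ennreal p < q \<longrightarrow> limsup_on J (\<lambda>j. Lnorm M q (x j)) = \<infinity>) \<and>
          (\<forall>q. 0 < q \<and> max q 2 < ennreal p \<longrightarrow> liminf_on J (\<lambda>j. Lnorm M q (x j)) = 0))"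
  by (rule conjI; intro allI impI; elim conjE)
    (rule basis_norms_limsup_liminf[OF assms scalar_conjugation_real]
      basis_norms_limsup_liminf[OF assms scalar_conjugation_complex]; assumption)+

end
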